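(* Let $V:\mathbb{R}^3\to\mathbb{C}$ belong to the class $H(\mathbb{R}^3)$ of Hardy-type potentials, i.e. $V\in L^1_{\mathrm{loc}}(\mathbb{R}^3)$ and $\|V\|_{H(\mathbb{R}^3)}:=\operatorname{ess\,sup}_{x\in\mathbb{R}^3}|x|^2|V(x)|<\infty$. Then $$\sigma_{\mathrm p}(H_V)\subset\left\{\lambda\in\mathbb{C}:\ |\lambda|\le16\,\|V\|_{H(\mathbb{R}^3)}^2\right\},$$ where $H_V=\Delta^2\dot{+}V$ in $L^2(\mathbb{R}^3)$.
   Context: Every $V\in H(\mathbb{R}^3)$ satisfies the following: there exist $a\in(0,1)$ and $b\in\mathbb{R}$ with $\int_{\mathbb{R}^3}|V||\psi|^2\le a\int_{\mathbb{R}^3}|\Delta\psi|^2+b\int_{\mathbb{R}^3}|\psi|^2$ for all $\psi$ in the Sobolev space $H^2(\mathbb{R}^3)$. Under this condition the operator $H_V=\Delta^2\dot{+}V$ is the m-sectorial operator in $L^2(\mathbb{R}^3)$ associated, via the representation theorem, with the closed sectorial form $h_V(\varphi,\psi)=\int_{\mathbb{R}^3}\overline{\Delta\varphi}\,\Delta\psi+\int_{\mathbb{R}^3}V\,\overline{\varphi}\,\psi$ with form domain the Sobolev space $H^2(\mathbb{R}^3)$. That is, $\psi\in H^2(\mathbb{R}^3)$ belongs to the domain of $H_V$ with $H_V\psi=f\in L^2(\mathbb{R}^3)$ if and only if $h_V(\varphi,\psi)=\int_{\mathbb{R}^3}\overline{\varphi}f$ for all $\varphi\in H^2(\mathbb{R}^3)$.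 The point spectrum $\sigma_{\mathrm p}(H_V)$ is the set of all eigenvalues $\lambda\in\mathbb{C}$ of $H_V$ (including those lying in $[0,+\infty)$). *)

theory Defs
  imports "HOL-Analysis.Analysis" "HOL-Probability.Essential_Supremum"
begin

text \<open>
  Elements of \<open>L\<^sup>2\<close> and of Sobolev spaces are represented by functions rather than by
  classes modulo almost everywhere equality; membership in these spaces, weak
  derivatives and the operator below are invariant under changes on null sets.
\<close>

subsection \<open>Smooth functions and test functions\<close>

text \<open>Multi-indices are lists of coordinates: \<open>[i, j]\<close> stands for \<open>\<partial>\<^sub>i \<partial>\<^sub>j\<close>.\<close>

fun partials :: "'n list \<Rightarrow> (real^'n \<Rightarrow> complex) \<Rightarrow> real^'n \<Rightarrow> complex" where
  "partials [] f = f"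
| "partials (i # is) f = (\<lambda>x. frechet_derivative (partials is f) (at x) (axis i 1))"

text \<open>
  Differentiability of all iterated partial derivatives includes their continuity, so this is
  the class \<open>C\<^sup>\<infinity>\<close>.
\<close>

definition smooth :: "(real^'n \<Rightarrow> complex) \<Rightarrow> bool" where
  "smooth f \<longleftrightarrow> (\<forall>is x. partials is f differentiable (at x))"

definition test_functions :: "(real^'n \<Rightarrow> complex) set" where
  "test_functions = {\<phi>. smooth \<phi> \<and> compact (closure {x. \<phi> x \<noteq> 0})}"

subsection \<open>Function spaces and weak derivatives\<close>

definition L1_loc :: "(real^'n \<Rightarrow> complex) set" where
  "L1_loc = {f. \<forall>K. compact K \<longrightarrow> f absolutely_integrable_on K}"

definition L2 :: "(real^'n \<Rightarrow> complex) set" where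
  "L2 = {f \<in> borel_measurable lebesgue. integrable lebesgue (\<lambda>x. (cmod (f x))\<^sup>2)}"

definition has_weak_deriv ::
    "(real^'n \<Rightarrow> complex) \<Rightarrow> 'n list \<Rightarrow> (real^'n \<Rightarrow> complex) \<Rightarrow> bool" where
  "has_weak_deriv f is g \<longleftrightarrow> f \<in> L1_loc \<and> g \<in> L1_loc \<and>
     (\<forall>\<phi>\<in>test_functions.
        (LINT x|lebesgue. f x * partials is \<phi> x) =
        (-1) ^ length is * (LINT x|lebesgue. g x * \<phi> x))"

text \<open>
  Weak derivatives are unique up to null sets, so the choice only affects the representative.
\<close>

definition weak_deriv ::
    "'n list \<Rightarrow> (real^'n \<Rightarrow> complex) \<Rightarrow> real^'n \<Rightarrow> complex" where
  "weak_deriv is f = (SOME g. has_weak_deriv f is g)"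

definition sobolev :: "nat \<Rightarrow> (real^'n \<Rightarrow> complex) set" where
  "sobolev k = {f \<in> L2. \<forall>is. length is \<le> k \<longrightarrow> (\<exists>g\<in>L2. has_weak_deriv f is g)}"

definition laplacian :: "(real^'n \<Rightarrow> complex) \<Rightarrow> real^'n \<Rightarrow> complex" where
  "laplacian f x = (\<Sum>i\<in>UNIV. weak_deriv [i, i] f x)"

subsection \<open>Hardy-type potentials\<close>

definition hardy_norm :: "(real^3 \<Rightarrow> complex) \<Rightarrow> ereal" where
  "hardy_norm V = esssup lebesgue (\<lambda>x. ereal ((norm x)\<^sup>2 * cmod (V x)))"

definition hardy_class :: "(real^3 \<Rightarrow> complex) set" where
  "hardy_class = {V \<in> L1_loc. hardy_norm V < \<infinity>}"

subsection \<open>The operator \<open>\<Delta>\<^sup>2 + V\<close> (form sum)\<close>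

text \<open>
  For a potential of Hardy type both integrals below converge absolutely on \<open>sobolev 2\<close>,
  by the Rellich (or Hardy) inequality.
\<close>

definition form_hV ::
    "(real^3 \<Rightarrow> complex) \<Rightarrow> (real^3 \<Rightarrow> complex) \<Rightarrow> (real^3 \<Rightarrow> complex) \<Rightarrow> complex" where
  "form_hV V \<phi> \<psi> =
     (LINT x|lebesgue. cnj (laplacian \<phi> x) * laplacian \<psi> x) +
     (LINT x|lebesgue. V x * cnj (\<phi> x) * \<psi> x)"

text \<open>
  Unbounded operators in \<open>L\<^sup>2\<close> are given by their graphs. The following is the graph of the
  operator that the representation theorem associates with the form \<^term>\<open>form_hV V\<close> on the
  form domain \<^term>\<open>sobolev 2 :: (real^3 \<Rightarrow> complex) set\<close>.
\<close>

definition op_HV ::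
    "(real^3 \<Rightarrow> complex) \<Rightarrow> ((real^3 \<Rightarrow> complex) \<times> (real^3 \<Rightarrow> complex)) set" where
  "op_HV V = {(\<psi>, f). \<psi> \<in> sobolev 2 \<and> f \<in> L2 \<and>
     (\<forall>\<phi>\<in>sobolev 2. form_hV V \<phi> \<psi> = (LINT x|lebesgue. cnj (\<phi> x) * f x))}"

text \<open>An eigenfunction is nonzero as an element of \<open>L\<^sup>2\<close>, i.e. not almost everywhere zero.\<close>

definition point_spectrum ::
    "((real^'n \<Rightarrow> complex) \<times> (real^'n \<Rightarrow> complex)) set \<Rightarrow> complex set" where
  "point_spectrum T =
     {z. \<exists>\<psi>. (\<psi>, \<lambda>x. z * \<psi> x) \<in> T \<and> \<not> (AE x in lebesgue. \<psi> x = 0)}"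

end

theory Submission
  imports Defs
begin

text \<open>
  Let \<open>\<psi>\<close> be an eigenfunction for \<open>\<lambda> \<noteq> 0\<close> (there is nothing to prove for \<open>\<lambda> = 0\<close>) and write
  \<open>\<lambda> = k\<^sup>4\<close> with \<open>k\<close> in the closed first quadrant, so that \<open>(\<Delta>\<^sup>2 - k\<^sup>4) \<psi> = - V \<psi>\<close>. Since \<open>\<Delta>\<^sup>2 - k\<^sup>4 = (\<Delta> + k\<^sup>2)(\<Delta> - k\<^sup>2)\<close>, the inverse of
  \<open>\<Delta>\<^sup>2 - k\<^sup>4\<close> is the convolution with \<open>(exp (\<i>k\<bar>x\<bar>) - exp (-k\<bar>x\<bar>)) / (8 \<pi> k\<^sup>2 \<bar>x\<bar>)\<close>. Both exponentials
  are bounded by \<open>1\<close>, so this kernel is at most \<open>\<bar>k\<bar>\<^sup>-\<^sup>2\<close> times the Newton kernel \<open>1 / (4 \<pi> \<bar>x\<bar>)\<close> of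
  \<open>(-\<Delta>)\<^sup>-\<^sup>1\<close>. Hardy's inequality says that \<open>\<bar>x\<bar>\<^sup>-\<^sup>1 (-\<Delta>)\<^sup>-\<^sup>1 \<bar>x\<bar>\<^sup>-\<^sup>1\<close> has norm \<open>4\<close> on \<open>L\<^sup>2\<close>. With
  \<open>\<bar>V\<bar> \<le> N / \<bar>x\<bar>\<^sup>2\<close> it follows that the norm of \<open>\<psi> / \<bar>x\<bar>\<close> is at most \<open>4 N \<bar>k\<bar>\<^sup>-\<^sup>2\<close> times itself. If
  this norm is finite and nonzero, then \<open>\<bar>k\<bar>\<^sup>2 \<le> 4 N\<close>, that is \<open>\<bar>\<lambda>\<bar> \<le> 16 N\<^sup>2\<close>.

  The argument is carried out by duality, in \<open>resolvent_pairing_bound\<close>. The equation of \<open>\<psi>\<close> is tested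
  with \<open>\<phi> = (exp (\<i>kr)/r - exp (-kr)/r) * \<eta>\<close>, the convolution of a test function \<open>\<eta>\<close> with a difference
  of two Yukawa kernels \<open>exp (-zr)/r\<close>, \<open>Re z \<ge> 0\<close>. For \<open>\<lambda> > 0\<close>, an eigenvalue embedded in the
  continuous spectrum of \<open>\<Delta>\<^sup>2\<close>, one of the kernels does not decay exponentially, and \<open>\<phi>\<close> is only
  \<open>O(1/\<bar>x\<bar>)\<close>. This still suffices to truncate \<open>\<phi>\<close>, because \<open>(1 + \<bar>x\<bar>)\<^sup>-\<^sup>2\<close> is in \<open>L\<^sup>2(\<real>\<^sup>3)\<close>
  (\<open>cutoff_errors_integral\<close>). The result is the bound \<open>2 N (\<integral>\<bar>\<psi>\<bar>\<^sup>2/\<bar>x\<bar>\<^sup>2 + \<integral>\<bar>\<eta>\<bar>\<^sup>2\<bar>x\<bar>\<^sup>2)\<close> for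
  \<open>\<bar>k\<bar>\<^sup>2 \<bar>\<integral>\<psi>\<eta>\<bar>\<close>, and \<open>\<eta> \<rightarrow> cnj \<psi> / \<bar>x\<bar>\<^sup>2\<close> gives the theorem. Hardy's inequality enters in the dual form
  \<open>Hardy_bilinear\<close>, which is a Schur test with the weight \<open>\<bar>x\<bar> powr (-3/2)\<close> whose key integral
  \<open>Newton_potential_power\<close> comes from the superharmonic function \<open>\<bar>x\<bar> powr (-1/2)\<close>. The
  normalisation \<open>4 \<pi>\<close> of the fundamental solution cancels and is never evaluated.

  Two points remain. The norm of \<open>\<psi> / \<bar>x\<bar>\<close> is finite because \<open>\<psi>\<close> is bounded: \<open>(1 - \<Delta>) \<psi>\<close> and
  \<open>exp (-r)/r\<close> are both in \<open>L\<^sup>2\<close>, and \<open>\<psi>\<close> is a multiple of their convolution (\<open>pairing_le_L1_norm\<close>,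
  \<open>AE_bounded_if_pairing_le_L1_norm\<close>). The limit \<open>\<eta> \<rightarrow> cnj \<psi> / \<bar>x\<bar>\<^sup>2\<close> rests on the density of test
  functions in three senses at once (\<open>approximating_test_functions\<close>).
\<close>

section \<open>Iterated partial derivatives\<close>

text \<open>
  One step of \<^const>\<open>partials\<close>, separated out so that the calculus rules can be stated for a single
  derivative and then iterated by induction on the multi-index.
\<close>

definition pdir :: "'n::finite \<Rightarrow> (real^'n \<Rightarrow> complex) \<Rightarrow> real^'n \<Rightarrow> complex" where
  "pdir i f = (\<lambda>x. frechet_derivative f (at x) (axis i 1))"

lemma partials_Cons: "partials (i # is) f = pdir i (partials is f)"
  by (simp add: pdir_def)

declare partials.simps(2) [simp del]

lemma partials_append: "partials (is @ js) f = partials is (partials js f)"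
  by (induction "is") (auto simp: partials_Cons)

lemma pdir_eqI: "(f has_derivative f') (at x) \<Longrightarrow> pdir i f x = f' (axis i 1)"
  unfolding pdir_def using frechet_derivative_at by metis

text \<open>
  Higher derivatives never have to be computed: it is enough to name a set of differentiable
  functions that is closed under taking partial derivatives.
\<close>

lemma smooth_coinduct:
  assumes "f \<in> S" and "\<And>g x. g \<in> S \<Longrightarrow> g differentiable at x" and "\<And>g i. g \<in> S \<Longrightarrow> pdir i g \<in> S"
  shows "smooth f"
proof -
  have "partials is f \<in> S" for "is" by (induction "is") (auto simp: partials_Cons assms)
  thus ?thesis using assms(2) by (auto simp: smooth_def)
qed

lemma smooth_partials: "smooth f \<Longrightarrow> smooth (partials is f)"
  by (simp add: smooth_def flip: partials_append)

lemma smooth_pdir: "smooth f \<Longrightarrow> smooth (pdir i f)"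
  using smooth_partials[of f "[i]"] by (simp add: partials_Cons)

lemma smooth_differentiable: "smooth f \<Longrightarrow> f differentiable at x"
  unfolding smooth_def by (metis partials.simps(1))

lemma smooth_continuous: "smooth f \<Longrightarrow> continuous_on S f"
  by (meson differentiable_imp_continuous_on differentiable_at_imp_differentiable_on smooth_differentiable)

lemma pdir_add:
  assumes "f differentiable at x" "g differentiable at x"
  shows "pdir i (\<lambda>x. f x + g x) x = pdir i f x + pdir i g x"
proof -
  have "((\<lambda>x. f x + g x) has_derivative
      (\<lambda>h. frechet_derivative f (at x) h + frechet_derivative g (at x) h)) (at x)"
    using assms by (intro has_derivative_add) (auto simp: frechet_derivative_works)
  from pdir_eqI[OF this, of i] show ?thesis by (simp add: pdir_def)
qed

lemma pdir_mult:
  assumes "f differentiable at x" "g differentiable at x"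
  shows "pdir i (\<lambda>x. f x * g x) x = pdir i f x * g x + f x * pdir i g x"
proof -
  have "((\<lambda>x. f x * g x) has_derivative
      (\<lambda>h. f x * frechet_derivative g (at x) h + frechet_derivative f (at x) h * g x)) (at x)"
    using assms by (intro has_derivative_mult) (auto simp: frechet_derivative_works)
  from pdir_eqI[OF this, of i] show ?thesis by (simp add: pdir_def)
qed

lemma pdir_const [simp]: "pdir i (\<lambda>x. c) = (\<lambda>x. 0)"
  by (auto simp: pdir_def)

lemma smooth_const: "smooth (\<lambda>x. c)"
  by (rule smooth_coinduct[of _ "range (\<lambda>c x. c)"]) auto

lemma coord_has_derivative:
  "((\<lambda>x. complex_of_real (x $ j)) has_derivative (\<lambda>h. of_real (h $ j))) (at x)"
  by (rule bounded_linear_imp_has_derivative)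
     (rule bounded_linear_compose[OF bounded_linear_of_real bounded_linear_vec_nth])

lemma pdir_coord: "pdir i (\<lambda>x. of_real (x $ j)) = (\<lambda>x. if i = j then 1 else 0)"
  by (rule ext) (simp add: pdir_eqI[OF coord_has_derivative] axis_def)

lemma coord_differentiable: "(\<lambda>x. complex_of_real (x $ j)) differentiable at x"
  using coord_has_derivative by (auto simp: differentiable_def)

lemma smooth_coord: "smooth (\<lambda>x. of_real (x $ j))"
  by (rule smooth_coinduct[of _ "{\<lambda>x. of_real (x $ j)} \<union> {f. smooth f}"])
     (auto simp: pdir_coord smooth_const smooth_pdir smooth_differentiable coord_differentiable)

text \<open>
  The module over the smooth functions generated by \<open>B\<close>. The derivatives of the functions
  constructed below (bumps, regularised kernels) are combinations of further functions of the
  same family with smooth coefficients, so such a module is the natural invariant set for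
  \<open>smooth_coinduct\<close>.
\<close>

inductive_set smooth_span :: "(real^'n \<Rightarrow> complex) set \<Rightarrow> (real^'n \<Rightarrow> complex) set"
  for B where
  base: "b \<in> B \<Longrightarrow> b \<in> smooth_span B"
| add: "f \<in> smooth_span B \<Longrightarrow> g \<in> smooth_span B \<Longrightarrow> (\<lambda>x. f x + g x) \<in> smooth_span B"
| mult: "smooth g \<Longrightarrow> f \<in> smooth_span B \<Longrightarrow> (\<lambda>x. g x * f x) \<in> smooth_span B"

lemma smooth_span_smooth:
  assumes "f \<in> smooth_span B"
    and "\<And>b x. b \<in> B \<Longrightarrow> b differentiable at x"
    and "\<And>b i. b \<in> B \<Longrightarrow> pdir i b \<in> smooth_span B"
  shows "smooth f"
proof -
  have d: "g differentiable at x" if "g \<in> smooth_span B" for g x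
    using that by induction (auto simp: assms smooth_differentiable)
  have p: "pdir i g \<in> smooth_span B" if "g \<in> smooth_span B" for g i
    using that
  proof induction
    case (base b) thus ?case by (rule assms)
  next
    case (add f g)
    have "pdir i (\<lambda>x. f x + g x) = (\<lambda>x. pdir i f x + pdir i g x)"
      by (intro ext pdir_add d add)
    thus ?case using add by (auto intro: smooth_span.add)
  next
    case (mult g f)
    have "pdir i (\<lambda>x. g x * f x) = (\<lambda>x. pdir i g x * f x + g x * pdir i f x)"
      by (intro ext pdir_mult d mult smooth_differentiable)
    thus ?case using mult by (auto intro!: smooth_span.add smooth_span.mult smooth_pdir)
  qed
  show ?thesis by (rule smooth_coinduct[OF assms(1)]) (auto simp: d p)
qed

lemma smooth_add: "smooth f \<Longrightarrow> smooth g \<Longrightarrow> smooth (\<lambda>x. f x + g x)"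
  by (rule smooth_span_smooth[of _ "Collect smooth"])
     (auto intro: smooth_span.intros smooth_pdir smooth_differentiable)

lemma smooth_mult: "smooth f \<Longrightarrow> smooth g \<Longrightarrow> smooth (\<lambda>x. f x * g x)"
  by (rule smooth_span_smooth[of _ "Collect smooth"])
     (auto intro: smooth_span.intros smooth_pdir smooth_differentiable)

lemma smooth_minus: "smooth f \<Longrightarrow> smooth (\<lambda>x. - f x)"
  using smooth_mult[OF smooth_const[of "-1"]] by simp

lemma smooth_diff: "smooth f \<Longrightarrow> smooth g \<Longrightarrow> smooth (\<lambda>x. f x - g x)"
  using smooth_add[OF _ smooth_minus] by simp

lemma smooth_sum: "(\<And>i. i \<in> I \<Longrightarrow> smooth (f i)) \<Longrightarrow> smooth (\<lambda>x. \<Sum>i\<in>I. f i x)"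
  by (induction I rule: infinite_finite_induct) (auto intro: smooth_const smooth_add)

lemma smooth_prod: "(\<And>i. i \<in> I \<Longrightarrow> smooth (f i)) \<Longrightarrow> smooth (\<lambda>x. \<Prod>i\<in>I. f i x)"
  by (induction I rule: infinite_finite_induct) (auto intro: smooth_const smooth_mult)

lemma smooth_power: "smooth f \<Longrightarrow> smooth (\<lambda>x. f x ^ n)"
  by (induction n) (auto intro: smooth_const smooth_mult)

lemma pdir_smooth_add: "smooth f \<Longrightarrow> smooth g \<Longrightarrow> pdir i (\<lambda>x. f x + g x) = (\<lambda>x. pdir i f x + pdir i g x)"
  by (intro ext pdir_add smooth_differentiable)

lemma pdir_smooth_mult: "smooth f \<Longrightarrow> smooth g \<Longrightarrow> pdir i (\<lambda>x. f x * g x) = (\<lambda>x. pdir i f x * g x + f x * pdir i g x)"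
  by (intro ext pdir_mult smooth_differentiable)

lemma partials_add: "smooth f \<Longrightarrow> smooth g \<Longrightarrow> partials is (\<lambda>x. f x + g x) = (\<lambda>x. partials is f x + partials is g x)"
  by (induction "is") (auto simp: partials_Cons pdir_smooth_add smooth_partials)

lemma pdir_cmult: "f differentiable at x \<Longrightarrow> pdir i (\<lambda>x. c * f x) x = c * pdir i f x"
  by (subst pdir_mult) auto

lemma partials_cmult: "smooth f \<Longrightarrow> partials is (\<lambda>x. c * f x) = (\<lambda>x. c * partials is f x)"
  by (induction "is") (auto simp: partials_Cons pdir_cmult smooth_partials smooth_differentiable)

lemma partials_diff: "smooth f \<Longrightarrow> smooth g \<Longrightarrow> partials is (\<lambda>x. f x - g x) = (\<lambda>x. partials is f x - partials is g x)"
  using partials_add[of f "\<lambda>x. -1 * g x" "is"] partials_cmult[of g "is" "-1"] smooth_minus[of g]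
  by simp

lemma partials_sum: "finite I \<Longrightarrow> (\<And>i. i \<in> I \<Longrightarrow> smooth (f i)) \<Longrightarrow>
   partials is (\<lambda>x. \<Sum>i\<in>I. f i x) = (\<lambda>x. \<Sum>i\<in>I. partials is (f i) x)"
proof (induction I rule: finite_induct)
  case empty
  have "partials is (\<lambda>x. 0) = (\<lambda>x::real^'b. 0)" by (induction "is") (auto simp: partials_Cons)
  thus ?case by simp
next
  case (insert x F) thus ?case by (simp add: partials_add smooth_sum)
qed

lemma pdir_linear_subst:
  assumes "f differentiable at (a + r *\<^sub>R x)"
  shows "pdir i (\<lambda>x. f (a + r *\<^sub>R x)) x = of_real r * pdir i f (a + r *\<^sub>R x)"
    and "(\<lambda>x. f (a + r *\<^sub>R x)) differentiable at x"
proof -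
  let ?D = "frechet_derivative f (at (a + r *\<^sub>R x))"
  have D: "(f has_derivative ?D) (at (a + r *\<^sub>R x))" using assms frechet_derivative_works by blast
  have "((\<lambda>x. a + r *\<^sub>R x) has_derivative (\<lambda>h. r *\<^sub>R h)) (at x)"
    by (auto intro!: derivative_eq_intros)
  from has_derivative_compose[OF this D]
  have *: "((\<lambda>x. f (a + r *\<^sub>R x)) has_derivative (\<lambda>h. ?D (r *\<^sub>R h))) (at x)" by simp
  show "(\<lambda>x. f (a + r *\<^sub>R x)) differentiable at x" using * by (auto simp: differentiable_def)
  have "?D (r *\<^sub>R h) = r *\<^sub>R ?D h" for h
    using D by (meson has_derivative_bounded_linear linear_simps(5))
  thus "pdir i (\<lambda>x. f (a + r *\<^sub>R x)) x = of_real r * pdir i f (a + r *\<^sub>R x)"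
    using pdir_eqI[OF *, of i] by (simp add: pdir_def scaleR_conv_of_real)
qed

lemma partials_affine:
  assumes "smooth f"
  shows "partials is (\<lambda>x. f (a + r *\<^sub>R x)) = (\<lambda>x. of_real r ^ length is * partials is f (a + r *\<^sub>R x))"
proof (induction "is")
  case (Cons i "is")
  have d: "partials is f differentiable at y" for y using assms smooth_def by blast
  have "pdir i (\<lambda>x. of_real r ^ length is * partials is f (a + r *\<^sub>R x)) x =
     of_real r ^ length is * (of_real r * pdir i (partials is f) (a + r *\<^sub>R x))" for x
    by (subst pdir_cmult) (auto simp: pdir_linear_subst d)
  thus ?case by (auto simp: partials_Cons Cons)
qed auto

lemma smooth_affine: "smooth f \<Longrightarrow> smooth (\<lambda>x. f (a + r *\<^sub>R x))"
  unfolding smooth_def[of "\<lambda>x. f (a + r *\<^sub>R x)"]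
  by (auto simp: partials_affine smooth_def intro!: differentiable_mult pdir_linear_subst)

lemma pdir_cnj:
  assumes "f differentiable at x"
  shows "pdir i (\<lambda>x. cnj (f x)) x = cnj (pdir i f x)" "(\<lambda>x. cnj (f x)) differentiable at x"
proof -
  have D: "(f has_derivative frechet_derivative f (at x)) (at x)" using assms frechet_derivative_works by blast
  have *: "((\<lambda>x. cnj (f x)) has_derivative (\<lambda>h. cnj (frechet_derivative f (at x) h))) (at x)"
    by (rule bounded_linear.has_derivative[OF bounded_linear_cnj D])
  from pdir_eqI[OF *, of i] show "pdir i (\<lambda>x. cnj (f x)) x = cnj (pdir i f x)" by (simp add: pdir_def)
  show "(\<lambda>x. cnj (f x)) differentiable at x" using * by (auto simp: differentiable_def)
qed

lemma partials_cnj: "smooth f \<Longrightarrow> partials is (\<lambda>x. cnj (f x)) = (\<lambda>x. cnj (partials is f x))"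
  by (induction "is") (auto simp: partials_Cons pdir_cnj smooth_partials smooth_differentiable)

lemma smooth_cnj: "smooth f \<Longrightarrow> smooth (\<lambda>x. cnj (f x))"
  unfolding smooth_def[of "\<lambda>x. cnj (f x)"] by (auto simp: partials_cnj smooth_def pdir_cnj)

definition lap :: "(real^'n \<Rightarrow> complex) \<Rightarrow> real^'n \<Rightarrow> complex" where
  "lap f = (\<lambda>x. \<Sum>i\<in>UNIV. partials [i, i] f x)"

lemma smooth_lap: "smooth f \<Longrightarrow> smooth (lap f)"
  unfolding lap_def by (intro smooth_sum smooth_partials)

section \<open>Test functions\<close>

lemma test_smooth: "\<phi> \<in> test_functions \<Longrightarrow> smooth \<phi>"
  by (simp add: test_functions_def)

lemma test_functionsI:
  assumes "smooth \<phi>" "compact K" "\<And>x. x \<notin> K \<Longrightarrow> \<phi> x = 0"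
  shows "\<phi> \<in> test_functions"
proof -
  have "closure {x. \<phi> x \<noteq> 0} \<subseteq> K"
    using assms by (intro closure_minimal) (auto simp: compact_imp_closed)
  hence "compact (closure {x. \<phi> x \<noteq> 0})"
    using compact_Int_closed[OF assms(2) closed_closure, of "{x. \<phi> x \<noteq> 0}"] by (simp add: Int_absorb1)
  with assms(1) show ?thesis by (simp add: test_functions_def)
qed

lemma test_functionsE:
  assumes "\<phi> \<in> test_functions"
  obtains R where "R > 0" "\<And>x. norm x \<ge> R \<Longrightarrow> \<phi> x = 0"
proof -
  have "bounded (closure {x. \<phi> x \<noteq> 0})" using assms by (simp add: test_functions_def compact_imp_bounded)
  then obtain b where b: "\<And>x. x \<in> closure {x. \<phi> x \<noteq> 0} \<Longrightarrow> norm x \<le> b" by (auto simp: bounded_iff)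
  show ?thesis
  proof (rule that[of "max b 0 + 1"])
    show "\<phi> x = 0" if "norm x \<ge> max b 0 + 1" for x
      using b[of x] closure_subset[of "{x. \<phi> x \<noteq> 0}"] that by (cases "\<phi> x = 0") auto
  qed auto
qed

lemma test_functionsI':
  assumes "smooth \<phi>" "\<And>x. norm x \<ge> R \<Longrightarrow> \<phi> x = 0"
  shows "\<phi> \<in> test_functions"
  by (rule test_functionsI[OF assms(1), of "cball 0 R"]) (auto simp: assms(2))

lemma pdir_zero_outside:
  assumes "\<And>x. norm x \<ge> R \<Longrightarrow> f x = 0" "norm x > R"
  shows "pdir i f x = 0"
proof -
  have "open {y. R < norm (y::real^'a)}"
    by (rule open_Collect_less[OF continuous_on_const continuous_on_norm_id])
  from has_derivative_transform_within_open[OF has_derivative_const this, of x 0 f] assms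
  have "(f has_derivative (\<lambda>_. 0)) (at x)" by auto
  from pdir_eqI[OF this] show ?thesis .
qed

text \<open>
  Where a function vanishes for \<open>norm x \<ge> R\<close>, its derivatives are seen to vanish only for
  \<open>norm x > R\<close>. To iterate this, the gap between \<open>R\<close> and \<open>R'\<close> is split among the derivatives.
\<close>

lemma partials_zero_outside:
  assumes "\<And>x. norm x \<ge> R \<Longrightarrow> f x = 0" "R < R'"
  shows "norm x \<ge> R' \<Longrightarrow> partials is f x = 0"
  using assms(2)
proof (induction "is" arbitrary: x R')
  case (Cons i "is")
  have "pdir i (partials is f) x = 0"
  proof (rule pdir_zero_outside)
    show "partials is f y = 0" if "norm y \<ge> (R+R')/2" for y
      by (rule Cons.IH[OF that]) (use Cons in auto)
  qed (use Cons in auto)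
  thus ?case by (simp add: partials_Cons)
qed (use assms in auto)

lemma test_partials: "\<phi> \<in> test_functions \<Longrightarrow> partials is \<phi> \<in> test_functions"
proof -
  assume *: "\<phi> \<in> test_functions"
  then obtain R where R: "\<And>x. norm x \<ge> R \<Longrightarrow> \<phi> x = 0" by (rule test_functionsE) auto
  show ?thesis
    by (rule test_functionsI'[OF _ partials_zero_outside[OF R], where R = "R+1"])
       (auto simp: * test_smooth smooth_partials)
qed

lemma test_pdir: "\<phi> \<in> test_functions \<Longrightarrow> pdir i \<phi> \<in> test_functions"
  using test_partials[of \<phi> "[i]"] by (simp add: partials_Cons)

lemma test_mult: "smooth f \<Longrightarrow> \<phi> \<in> test_functions \<Longrightarrow> (\<lambda>x. f x * \<phi> x) \<in> test_functions"
  by (frule test_smooth, erule test_functionsE, rule test_functionsI') (auto intro: smooth_mult)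

lemma test_add: "f \<in> test_functions \<Longrightarrow> g \<in> test_functions \<Longrightarrow> (\<lambda>x. f x + g x) \<in> test_functions"
proof -
  assume *: "f \<in> test_functions" "g \<in> test_functions"
  obtain R where R: "\<And>x. norm x \<ge> R \<Longrightarrow> f x = 0" using *(1) by (rule test_functionsE) auto
  obtain S where S: "\<And>x. norm x \<ge> S \<Longrightarrow> g x = 0" using *(2) by (rule test_functionsE) auto
  show ?thesis
    by (rule test_functionsI'[where R = "max R S"]) (auto simp: R S intro: smooth_add[OF *[THEN test_smooth]])
qed

lemma test_0: "(\<lambda>x. 0) \<in> test_functions"
  by (rule test_functionsI'[where R=0]) (auto simp: smooth_const)

lemma test_sum: "(\<And>i. i \<in> I \<Longrightarrow> f i \<in> test_functions) \<Longrightarrow> (\<lambda>x. \<Sum>i\<in>I. f i x) \<in> test_functions"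
  by (induction I rule: infinite_finite_induct) (auto intro: test_add test_0)

lemma test_cmult: "\<phi> \<in> test_functions \<Longrightarrow> (\<lambda>x. c * \<phi> x) \<in> test_functions"
  by (rule test_mult[OF smooth_const])

lemma test_diff: "f \<in> test_functions \<Longrightarrow> g \<in> test_functions \<Longrightarrow> (\<lambda>x. f x - g x) \<in> test_functions"
  using test_add[OF _ test_cmult[of g "-1"], of f] by simp

lemma test_lap: "\<phi> \<in> test_functions \<Longrightarrow> lap \<phi> \<in> test_functions"
  unfolding lap_def by (intro test_sum test_partials)

lemma test_cnj: "\<phi> \<in> test_functions \<Longrightarrow> (\<lambda>x. cnj (\<phi> x)) \<in> test_functions"
  by (frule test_smooth, erule test_functionsE, rule test_functionsI') (auto intro: smooth_cnj)

lemma test_affine: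
  assumes "\<phi> \<in> test_functions" "r \<noteq> 0"
  shows "(\<lambda>x. \<phi> (a + r *\<^sub>R x)) \<in> test_functions"
proof -
  obtain R where R: "\<And>x. norm x \<ge> R \<Longrightarrow> \<phi> x = 0" using assms(1) by (rule test_functionsE) auto
  show ?thesis
  proof (rule test_functionsI'[where R = "(R + norm a) / \<bar>r\<bar>"])
    fix x :: "real^'a" assume "norm x \<ge> (R + norm a) / \<bar>r\<bar>"
    hence "norm (r *\<^sub>R x) \<ge> R + norm a" using assms by (simp add: field_simps)
    moreover have "norm (r *\<^sub>R x) \<le> norm (a + r *\<^sub>R x) + norm a"
      using norm_triangle_ineq4[of "a + r *\<^sub>R x" a] by simp
    ultimately show "\<phi> (a + r *\<^sub>R x) = 0" by (intro R) linarith
  qed (auto simp: smooth_affine assms test_smooth)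
qed

lemma test_bounded:
  assumes "\<phi> \<in> test_functions" obtains C where "C > 0" "\<And>x. norm (\<phi> x) \<le> C"
proof -
  obtain R where R: "\<And>x. norm x \<ge> R \<Longrightarrow> \<phi> x = 0" using assms(1) by (rule test_functionsE) auto
  have "compact (\<phi> ` cball 0 R)"
    by (intro compact_continuous_image smooth_continuous test_smooth assms compact_cball)
  then obtain b where b: "\<And>x. norm x \<le> R \<Longrightarrow> norm (\<phi> x) \<le> b"
    by (force dest: compact_imp_bounded simp: bounded_iff)
  show ?thesis
  proof (rule that[of "max b 0 + 1"])
    show "norm (\<phi> x) \<le> max b 0 + 1" for x using b[of x] R[of x] by (cases "norm x \<le> R") auto
  qed auto
qed

lemma smooth_measurable: "smooth f \<Longrightarrow> f \<in> borel_measurable borel"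
  by (rule borel_measurable_continuous_onI[OF smooth_continuous])

lemma smooth_measurable_lborel: "smooth f \<Longrightarrow> f \<in> borel_measurable lborel"
  using smooth_measurable by simp

lemma vanishing_integrable:
  fixes f :: "'a::euclidean_space \<Rightarrow> complex"
  assumes "continuous_on UNIV f" "\<And>x. norm x \<ge> R \<Longrightarrow> f x = 0"
  shows "integrable lborel f"
proof -
  have "integrable lborel (\<lambda>x. indicator (cball 0 R) x *\<^sub>R f x)"
    by (rule borel_integrable_compact[OF compact_cball continuous_on_subset[OF assms(1)]]) auto
  also have "(\<lambda>x. indicator (cball 0 R) x *\<^sub>R f x) = f"
    using assms(2) by (auto simp: indicator_def)
  finally show ?thesis .
qed

lemma test_integrable: "\<phi> \<in> test_functions \<Longrightarrow> integrable lborel \<phi>"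
  by (frule test_functionsE, rule vanishing_integrable[OF smooth_continuous[OF test_smooth]]) auto

section \<open>Integration by parts\<close>

lemma pdir_line:
  assumes "f differentiable at (x + t *\<^sub>R axis i 1)"
  shows "((\<lambda>t. f (x + t *\<^sub>R axis i 1)) has_vector_derivative pdir i f (x + t *\<^sub>R axis i 1)) (at t)"
proof -
  have 1: "((\<lambda>t. x + t *\<^sub>R axis i 1) has_derivative (\<lambda>h. h *\<^sub>R axis i 1)) (at t)"
    by (auto intro!: derivative_eq_intros)
  have D: "(f has_derivative frechet_derivative f (at (x + t *\<^sub>R axis i 1))) (at (x + t *\<^sub>R axis i 1))"
    using assms frechet_derivative_works by blast
  show ?thesis
    using has_derivative_compose[OF 1 D]
      linear_simps(5)[OF has_derivative_bounded_linear[OF D]]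
    by (simp add: has_vector_derivative_def pdir_def)
qed

lemma smooth_line:
  "smooth f \<Longrightarrow> ((\<lambda>t. f (x + t *\<^sub>R axis i 1)) has_vector_derivative pdir i f (x + t *\<^sub>R axis i 1)) (at t)"
  by (rule pdir_line[OF smooth_differentiable])

lemma pdir_line_bound:
  assumes "smooth f" "\<And>x. norm (pdir i f x) \<le> B" "h \<ge> 0"
  shows "norm (f (x + h *\<^sub>R axis i 1) - f x) \<le> B * h"
proof -
  let ?g = "\<lambda>t. f (x + t *\<^sub>R axis i 1)" and ?g' = "\<lambda>t. pdir i f (x + t *\<^sub>R axis i 1)"
  have "norm (?g h - ?g 0) \<le> B * norm (h - 0)"
  proof (rule differentiable_bound[where S = "{0..h}" and f' = "\<lambda>t h. h *\<^sub>R ?g' t"])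
    show "(?g has_derivative (\<lambda>h. h *\<^sub>R ?g' t)) (at t within {0..h})" for t
      using smooth_line[OF assms(1), where x=x and t=t and i=i]
      by (simp add: has_vector_derivative_def has_derivative_at_withinI)
    show "onorm (\<lambda>h. h *\<^sub>R ?g' t) \<le> B" for t
      by (rule onorm_le) (simp add: mult.commute[of B] mult_left_mono[OF assms(2)])
  qed (use assms in auto)
  thus ?thesis using assms by simp
qed

lemma lborel_integral_affine:
  fixes f :: "'a::euclidean_space \<Rightarrow> 'b::{banach, second_countable_topology}"
  assumes c: "c \<noteq> 0"
  shows "(\<integral>x. f x \<partial>lborel) = (\<bar>c\<bar> ^ DIM('a)) *\<^sub>R (\<integral>x. f (t + c *\<^sub>R x) \<partial>lborel)"
    and "integrable lborel (\<lambda>x. f (t + c *\<^sub>R x)) \<longleftrightarrow> integrable lborel f"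
proof -
  have I: "integrable lborel (\<lambda>x. g (t + c *\<^sub>R x))" if "c \<noteq> 0" "integrable lborel g" for g :: "'a \<Rightarrow> 'b" and t c
  proof -
    have [measurable]: "g \<in> borel_measurable borel" using borel_measurable_integrable[OF that(2)] by simp
    have "integrable (density (distr lborel borel (\<lambda>x. t + c *\<^sub>R x)) (\<lambda>_. \<bar>c\<bar> ^ DIM('a))) g"
      using that(2) lborel_affine[OF that(1), of t] by argo
    hence "integrable (distr lborel borel (\<lambda>x. t + c *\<^sub>R x)) (\<lambda>x. \<bar>c\<bar> ^ DIM('a) *\<^sub>R g x)"
      by (subst (asm) integrable_density) auto
    hence "integrable lborel (\<lambda>x. \<bar>c\<bar> ^ DIM('a) *\<^sub>R g (t + c *\<^sub>R x))"
      by (subst (asm) integrable_distr_eq) auto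
    from integrable_scaleR_right[OF this, of "inverse (\<bar>c\<bar> ^ DIM('a))"] show ?thesis using that(1) by simp
  qed
  show iff: "integrable lborel (\<lambda>x. f (t + c *\<^sub>R x)) \<longleftrightarrow> integrable lborel f"
    using I[OF c, of f t] I[of "1/c" "\<lambda>x. f (t + c *\<^sub>R x)" "-(1/c) *\<^sub>R t"] c
    by (auto simp: algebra_simps)
  show "(\<integral>x. f x \<partial>lborel) = (\<bar>c\<bar> ^ DIM('a)) *\<^sub>R (\<integral>x. f (t + c *\<^sub>R x) \<partial>lborel)"
  proof (cases "integrable lborel f")
    case True
    have [measurable]: "f \<in> borel_measurable borel" using borel_measurable_integrable[OF True] by simp
    have "(\<integral>x. f x \<partial>lborel) = (\<integral>x. f x \<partial>density (distr lborel borel (\<lambda>x. t + c *\<^sub>R x)) (\<lambda>_. \<bar>c\<bar> ^ DIM('a)))"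
      using lborel_affine[OF c, of t] by argo
    also have "\<dots> = (\<integral>x. \<bar>c\<bar> ^ DIM('a) *\<^sub>R f x \<partial>distr lborel borel (\<lambda>x. t + c *\<^sub>R x))"
      by (subst integral_density) auto
    also have "\<dots> = (\<integral>x. \<bar>c\<bar> ^ DIM('a) *\<^sub>R f (t + c *\<^sub>R x) \<partial>lborel)"
      by (subst integral_distr) auto
    finally show ?thesis by simp
  next
    case False thus ?thesis by (simp add: iff not_integrable_integral_eq)
  qed
qed

lemma nn_integral_lborel_affine:
  fixes f :: "'a::euclidean_space \<Rightarrow> ennreal"
  assumes c: "c \<noteq> 0" and [measurable]: "f \<in> borel_measurable borel"
  shows "(\<integral>\<^sup>+x. f x \<partial>lborel) = ennreal (\<bar>c\<bar> ^ DIM('a)) * (\<integral>\<^sup>+x. f (t + c *\<^sub>R x) \<partial>lborel)"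
proof -
  have "(\<integral>\<^sup>+x. f x \<partial>lborel) = (\<integral>\<^sup>+x. f x \<partial>density (distr lborel borel (\<lambda>x. t + c *\<^sub>R x)) (\<lambda>_. \<bar>c\<bar> ^ DIM('a)))"
    using lborel_affine[OF c, of t] by argo
  also have "\<dots> = (\<integral>\<^sup>+x. ennreal (\<bar>c\<bar> ^ DIM('a)) * f x \<partial>distr lborel borel (\<lambda>x. t + c *\<^sub>R x))"
    by (subst nn_integral_density) auto
  also have "\<dots> = (\<integral>\<^sup>+x. ennreal (\<bar>c\<bar> ^ DIM('a)) * f (t + c *\<^sub>R x) \<partial>lborel)"
    by (subst nn_integral_distr) auto
  finally show ?thesis by (simp add: nn_integral_cmult)
qed

lemma has_vector_derivative_quotient:
  assumes "(f has_vector_derivative D) (at 0)"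
  shows "((\<lambda>t. (f t - f 0) /\<^sub>R t) \<longlongrightarrow> D) (at 0)"
proof -
  have "((\<lambda>h. norm (f h - f 0 - h *\<^sub>R D) / norm h) \<longlongrightarrow> 0) (at 0)"
    using assms unfolding has_vector_derivative_def has_derivative_at by simp
  also have "?this \<longleftrightarrow> ((\<lambda>t. norm ((f t - f 0) /\<^sub>R t - D)) \<longlongrightarrow> 0) (at 0)"
  proof (rule filterlim_cong[OF refl refl])
    show "\<forall>\<^sub>F h in at 0. norm (f h - f 0 - h *\<^sub>R D) / norm h = norm ((f h - f 0) /\<^sub>R h - D)"
      unfolding eventually_at_filter
    proof (rule always_eventually, intro allI impI)
      fix h :: real assume "h \<noteq> 0"
      hence "(f h - f 0) /\<^sub>R h - D = (f h - f 0 - h *\<^sub>R D) /\<^sub>R h" by (simp add: scaleR_diff_right)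
      thus "norm (f h - f 0 - h *\<^sub>R D) / norm h = norm ((f h - f 0) /\<^sub>R h - D)"
        by (simp add: divide_inverse mult.commute)
    qed
  qed
  finally show ?thesis using Lim_null tendsto_norm_zero_iff by blast
qed

text \<open>
  By translation invariance every difference quotient of \<open>\<phi>\<close> has integral zero; the quotients
  converge to the derivative, bounded by its supremum on a fixed ball.
\<close>

lemma integral_pdir_test:
  assumes "\<phi> \<in> test_functions"
  shows "(\<integral>x. pdir i \<phi> x \<partial>lborel) = 0"
proof -
  have sm: "smooth \<phi>" using assms by (rule test_smooth)
  obtain R where R: "R > 0" "\<And>x. norm x \<ge> R \<Longrightarrow> \<phi> x = 0" by (rule test_functionsE[OF assms]) auto
  obtain B where B: "B > 0" "\<And>x. norm (pdir i \<phi> x) \<le> B" by (rule test_bounded[OF test_pdir[OF assms, of i]]) auto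
  define h where "h n = 1 / real (Suc n)" for n
  have h: "h n > 0" "h n \<le> 1" for n by (auto simp: h_def)
  define q where "q n x = (\<phi> (x + h n *\<^sub>R axis i 1) - \<phi> x) /\<^sub>R h n" for n x
  have int: "integrable lborel \<phi>" by (rule test_integrable[OF assms])
  have tr: "integrable lborel (\<lambda>x. \<phi> (x + a))" "(\<integral>x. \<phi> (x + a) \<partial>lborel) = (\<integral>x. \<phi> x \<partial>lborel)" for a
    using lborel_integral_affine[of 1 \<phi> a] int by (auto simp: add.commute)
  have q0: "(\<integral>x. q n x \<partial>lborel) = 0" for n
    unfolding q_def using tr int by (simp add: Bochner_Integration.integral_diff)
  have "(\<lambda>n. \<integral>x. q n x \<partial>lborel) \<longlonglongrightarrow> (\<integral>x. pdir i \<phi> x \<partial>lborel)"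
  proof (rule integral_dominated_convergence)
    show "pdir i \<phi> \<in> borel_measurable lborel" by (rule smooth_measurable_lborel[OF smooth_pdir[OF sm]])
    show "q n \<in> borel_measurable lborel" for n
      unfolding q_def using borel_measurable_integrable[OF tr(1)] smooth_measurable_lborel[OF sm] by measurable
    show "integrable lborel (\<lambda>x. indicator (cball 0 (R + 1)) x *\<^sub>R B)"
      by (rule borel_integrable_compact) auto
    show "AE x in lborel. norm (q n x) \<le> indicator (cball 0 (R + 1)) x *\<^sub>R B" for n
    proof (rule AE_I2)
      fix x
      show "norm (q n x) \<le> indicator (cball 0 (R + 1)) x *\<^sub>R B"
      proof (cases "norm x \<le> R + 1")
        case True
        have "norm (q n x) \<le> (B * h n) / h n"
          using pdir_line_bound[OF sm B(2), of "h n" x] h[of n]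
          by (simp add: q_def divide_simps)
        thus ?thesis using True h[of n] by (simp add: indicator_def)
      next
        case False
        have "norm x \<le> norm (x + h n *\<^sub>R axis i 1) + norm (h n *\<^sub>R axis i (1::real))"
          using norm_triangle_ineq4[of "x + h n *\<^sub>R axis i 1" "h n *\<^sub>R axis i 1"] by simp
        hence "norm x \<le> norm (x + h n *\<^sub>R axis i 1) + 1" using h[of n] by simp
        hence "q n x = 0" using False R by (simp add: q_def)
        thus ?thesis by (simp add: indicator_def B(1) less_imp_le)
      qed
    qed
    show "AE x in lborel. (\<lambda>n. q n x) \<longlonglongrightarrow> pdir i \<phi> x"
    proof (rule AE_I2)
      fix x
      have "((\<lambda>t. \<phi> (x + t *\<^sub>R axis i 1)) has_vector_derivative pdir i \<phi> x) (at 0)"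
        using smooth_line[OF sm, where x=x and t=0 and i=i] by simp
      from has_vector_derivative_quotient[OF this]
      have "((\<lambda>t. (\<phi> (x + t *\<^sub>R axis i 1) - \<phi> x) /\<^sub>R t) \<longlongrightarrow> pdir i \<phi> x) (at 0)"
        by simp
      moreover have "filterlim h (at 0) sequentially"
      proof (rule filterlim_atI)
        show "h \<longlonglongrightarrow> 0" using LIMSEQ_inverse_real_of_nat by (simp add: h_def[abs_def] inverse_eq_divide)
        show "\<forall>\<^sub>F n in sequentially. h n \<noteq> 0" using h(1) by (auto intro!: always_eventually simp: less_imp_neq[symmetric])
      qed
      ultimately show "(\<lambda>n. q n x) \<longlonglongrightarrow> pdir i \<phi> x"
        unfolding q_def by (rule filterlim_compose)
    qed
  qed
  hence "(\<lambda>n. 0) \<longlonglongrightarrow> (\<integral>x. pdir i \<phi> x \<partial>lborel)" by (simp add: q0)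
  thus ?thesis using LIMSEQ_unique tendsto_const by metis
qed

lemma test_mult2: "\<phi> \<in> test_functions \<Longrightarrow> smooth f \<Longrightarrow> (\<lambda>x. \<phi> x * f x) \<in> test_functions"
  using test_mult[of f \<phi>] by (simp add: mult.commute)

lemma integral_by_parts:
  assumes f: "smooth f" and g: "g \<in> test_functions"
  shows "(\<integral>x. f x * pdir i g x \<partial>lborel) = - (\<integral>x. pdir i f x * g x \<partial>lborel)"
proof -
  have 1: "integrable lborel (\<lambda>x. f x * pdir i g x)" by (intro test_integrable test_mult f test_pdir g)
  have 2: "integrable lborel (\<lambda>x. pdir i f x * g x)" by (intro test_integrable test_mult smooth_pdir f g)
  have "(\<integral>x. pdir i (\<lambda>x. f x * g x) x \<partial>lborel) = 0" by (intro integral_pdir_test test_mult f g)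
  hence "(\<integral>x. pdir i f x * g x \<partial>lborel) + (\<integral>x. f x * pdir i g x \<partial>lborel) = 0"
    unfolding pdir_smooth_mult[OF f test_smooth[OF g]] Bochner_Integration.integral_add[OF 2 1] .
  thus ?thesis by (simp only: eq_neg_iff_add_eq_0 add.commute)
qed

lemma integral_lap_by_parts:
  assumes f: "smooth f" and g: "g \<in> test_functions"
  shows "(\<integral>x. f x * lap g x \<partial>lborel) = (\<integral>x. lap f x * g x \<partial>lborel)"
proof -
  have "(\<integral>x. f x * partials [i,i] g x \<partial>lborel) = (\<integral>x. partials [i,i] f x * g x \<partial>lborel)" for i
    using integral_by_parts[OF f test_pdir[OF g], of i i] integral_by_parts[OF smooth_pdir[OF f] g, of i i]
    by (simp add: partials_Cons)
  moreover have "integrable lborel (\<lambda>x. f x * partials [i,i] g x)" for i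
    by (intro test_integrable test_mult f test_partials g)
  moreover have "integrable lborel (\<lambda>x. partials [i,i] f x * g x)" for i
    by (intro test_integrable test_mult f smooth_partials g)
  ultimately show ?thesis
    unfolding lap_def sum_distrib_left sum_distrib_right
    by (subst (1 2) Bochner_Integration.integral_sum) auto
qed

section \<open>Integrable powers of the norm\<close>

text \<open>
  The one-dimensional factor for \<open>powr_integrable\<close>. The value \<open>\<infinity>\<close> at \<open>0\<close> makes the product
  bound there hold at every point, also where a coordinate vanishes; the convention \<open>0 powr p
  = 0\<close> would break it.
\<close>

lemma powr_integrable_line:
  assumes "a < (1::real)" "b \<ge> 0" "a + b > 1"
  shows "(\<integral>\<^sup>+t. (if t = 0 then \<infinity> else ennreal (\<bar>t\<bar> powr -a * (1 + \<bar>t\<bar>) powr -b)) \<partial>lborel) < \<infinity>"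
proof -
  define F where "F t = ennreal (t powr -a) * indicator {0..1} t + ennreal (t powr -(a+b)) * indicator {1..} t" for t :: real
  have [measurable]: "F \<in> borel_measurable borel" unfolding F_def by measurable
  have "(\<integral>\<^sup>+t. F t \<partial>lborel) = (\<integral>\<^sup>+t. ennreal (t powr -a) * indicator {0..1} t \<partial>lborel) +
      (\<integral>\<^sup>+t. ennreal (t powr -(a+b)) * indicator {1..} t \<partial>lborel)"
    unfolding F_def by (rule nn_integral_add) auto
  also have "(\<integral>\<^sup>+t. ennreal (t powr -a) * indicator {0..1} t \<partial>lborel) = ennreal (1 powr (-a+1) / (-a+1))"
    by (rule nn_integral_has_integral_lebesgue'[OF _ has_integral_powr_from_0]) (use assms in auto)
  also have "(\<integral>\<^sup>+t. ennreal (t powr -(a+b)) * indicator {1..} t \<partial>lborel) = ennreal (-(1 powr (-(a+b)+1)) / (-(a+b)+1))"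
    by (rule nn_integral_has_integral_lebesgue'[OF _ has_integral_powr_to_inf]) (use assms in auto)
  finally have fin: "(\<integral>\<^sup>+t. F t \<partial>lborel) < \<infinity>" by simp
  have "(\<integral>\<^sup>+t. (if t = 0 then \<infinity> else ennreal (\<bar>t\<bar> powr -a * (1 + \<bar>t\<bar>) powr -b)) \<partial>lborel) \<le> (\<integral>\<^sup>+t. F t + F (0 + (-1) * t) \<partial>lborel)"
  proof (rule nn_integral_mono_AE)
    have *: "ennreal (s powr -a * (1 + s) powr -b) \<le> F s" if "s > 0" for s
    proof (cases "s \<le> 1")
      case True
      have "(1 + s) powr -b \<le> 1" using that assms powr_mono[of "-b" 0 "1+s"] by simp
      hence "s powr -a * (1 + s) powr -b \<le> s powr -a" by (simp add: mult_left_le)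
      hence "ennreal (s powr -a * (1 + s) powr -b) \<le> ennreal (s powr -a)" by (rule ennreal_leI)
      also have "\<dots> \<le> F s" using True that by (simp add: F_def)
      finally show ?thesis .
    next
      case False
      have "(1 + s) powr -b \<le> s powr -b" using that assms by (intro powr_mono2') auto
      hence "s powr -a * (1 + s) powr -b \<le> s powr -a * s powr -b" by (simp add: mult_left_mono)
      also have "\<dots> = s powr (-(a+b))" using powr_add[of s "-a" "-b"] by (simp add: algebra_simps)
      finally have "ennreal (s powr -a * (1 + s) powr -b) \<le> ennreal (s powr (-(a+b)))" by (rule ennreal_leI)
      also have "\<dots> \<le> F s" using False that by (simp add: F_def)
      finally show ?thesis .
    qed
    show "AE t in lborel. (if t = 0 then \<infinity> else ennreal (\<bar>t\<bar> powr -a * (1 + \<bar>t\<bar>) powr -b)) \<le> F t + F (0 + (-1) * t)"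
      using AE_lborel_singleton[of 0]
    proof eventually_elim
      fix t :: real assume "t \<noteq> 0"
      hence "ennreal (\<bar>t\<bar> powr -a * (1 + \<bar>t\<bar>) powr -b) \<le> F \<bar>t\<bar>" by (intro *) auto
      also have "F \<bar>t\<bar> \<le> F t + F (0 + (-1) * t)" by (cases "t > 0") auto
      finally show "(if t = 0 then \<infinity> else ennreal (\<bar>t\<bar> powr -a * (1 + \<bar>t\<bar>) powr -b)) \<le> F t + F (0 + (-1) * t)"
        using \<open>t \<noteq> 0\<close> by simp
    qed
  qed
  also have "\<dots> = (\<integral>\<^sup>+t. F t \<partial>lborel) + (\<integral>\<^sup>+t. F (0 + (-1) * t) \<partial>lborel)"
    by (rule nn_integral_add) auto
  also have "(\<integral>\<^sup>+t. F (0 + (-1) * t) \<partial>lborel) = (\<integral>\<^sup>+t. F t \<partial>lborel)"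
    using nn_integral_real_affine[of F "-1" 0] by simp
  also have "(\<integral>\<^sup>+t. F t \<partial>lborel) + (\<integral>\<^sup>+t. F t \<partial>lborel) < \<infinity>" using fin by simp
  finally show ?thesis .
qed

text \<open>
  No polar coordinates: as \<open>norm x\<close> dominates each coordinate, the integrand is at most a
  product of functions of one coordinate each, every factor taking a third of both exponents.
\<close>

lemma powr_integrable:
  fixes a b :: real
  assumes "0 \<le> a" "a < 3" "b \<ge> 0" "a + b > 3"
  shows "integrable lborel (\<lambda>x::real^3. norm x powr -a * (1 + norm x) powr -b)"
proof -
  define h where "h = (\<lambda>t::real. if t = 0 then \<infinity> else ennreal (\<bar>t\<bar> powr -(a/3) * (1 + \<bar>t\<bar>) powr -(b/3)))"
  have [measurable]: "h \<in> borel_measurable borel" unfolding h_def by measurable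
  have h1: "(\<integral>\<^sup>+t. h t \<partial>lborel) < \<infinity>" unfolding h_def by (rule powr_integrable_line) (use assms in auto)
  have card: "card (Basis :: (real^3) set) = 3" by simp
  have le: "ennreal (norm x powr -a * (1 + norm x) powr -b) \<le> (\<Prod>e\<in>Basis. h (x \<bullet> e))" for x :: "real^3"
  proof -
    have "ennreal (norm x powr -(a/3) * (1 + norm x) powr -(b/3)) \<le> h (x \<bullet> e)" if "e \<in> Basis" for e
    proof (cases "x \<bullet> e = 0")
      case False
      have "\<bar>x \<bullet> e\<bar> \<le> norm x" using that by (rule Basis_le_norm)
      thus ?thesis unfolding h_def using False assms
        by (auto intro!: ennreal_leI mult_mono powr_mono2')
    qed (simp add: h_def)
    then have "(\<Prod>e\<in>(Basis::(real^3) set). ennreal (norm x powr -(a/3) * (1 + norm x) powr -(b/3))) \<le> (\<Prod>e\<in>Basis. h (x \<bullet> e))"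
      by (intro prod_mono_ennreal)
    also have "(\<Prod>e\<in>(Basis::(real^3) set). ennreal (norm x powr -(a/3) * (1 + norm x) powr -(b/3)))
       = ennreal ((norm x powr -(a/3) * (1 + norm x) powr -(b/3)) ^ 3)"
      by (simp add: ennreal_power)
    also have "(norm x powr -(a/3) * (1 + norm x) powr -(b/3)) ^ 3 = norm x powr -a * (1 + norm x) powr -b"
    proof -
      have "1 + norm x \<noteq> 0" using norm_ge_zero[of x] by linarith
      thus ?thesis by (cases "x = 0") (auto simp: power_mult_distrib powr_power)
    qed
    finally show ?thesis .
  qed
  have "(\<integral>\<^sup>+x. ennreal (norm x powr -a * (1 + norm x) powr -b) \<partial>(lborel::(real^3) measure))
     \<le> (\<integral>\<^sup>+x. (\<Prod>e\<in>Basis. h (x \<bullet> e)) \<partial>(lborel::(real^3) measure))"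
    using le by (rule nn_integral_mono)
  also have "\<dots> = (\<Prod>e\<in>(Basis::(real^3) set). (\<integral>\<^sup>+t. h t \<partial>lborel))"
    by (rule nn_integral_lborel_prod) auto
  also have "\<dots> < \<infinity>" using h1 by (simp add: power_less_top_ennreal)
  finally show ?thesis by (intro integrableI_nonneg) auto
qed

lemma integrable_japanese:
  assumes "b > 3"
  shows "integrable lborel (\<lambda>x::real^3. (1 + norm x) powr -b)"
proof (rule Bochner_Integration.integrable_bound)
  show "integrable lborel (\<lambda>x::real^3. norm x powr -0 * (1 + norm x) powr -b)"
    by (rule powr_integrable) (use assms in auto)
  show "AE x::real^3 in lborel. norm ((1 + norm x) powr -b) \<le> norm (norm x powr -0 * (1 + norm x) powr -b)"
    using AE_lborel_singleton[of "0::real^3"] by eventually_elim auto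
qed auto

lemma test_decay:
  fixes \<phi> :: "real^'n \<Rightarrow> complex"
  assumes "\<phi> \<in> test_functions" "p \<ge> 0"
  obtains C where "C > 0" "\<And>x. norm (\<phi> x) \<le> C * (1 + norm x) powr -p"
proof -
  obtain R where R: "R > 0" "\<And>x. norm x \<ge> R \<Longrightarrow> \<phi> x = 0" by (rule test_functionsE[OF assms(1)]) auto
  obtain B where B: "B > 0" "\<And>x. norm (\<phi> x) \<le> B" by (rule test_bounded[OF assms(1)]) auto
  show ?thesis
  proof (rule that)
    show "B * (1 + R) powr p > 0" using B R by simp
    show "norm (\<phi> x) \<le> B * (1 + R) powr p * (1 + norm x) powr -p" for x
    proof (cases "norm x \<ge> R")
      case True thus ?thesis using R(2)[OF True] B(1) by simp
    next
      case False
      have "1 + norm x > 0" by (simp add: add_pos_nonneg)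
      hence "1 = (1 + norm x) powr p * (1 + norm x) powr -p" by (simp add: powr_minus)
      also have "\<dots> \<le> (1 + R) powr p * (1 + norm x) powr -p"
        using False assms by (intro mult_right_mono powr_mono2) auto
      finally have "B * 1 \<le> B * ((1 + R) powr p * (1 + norm x) powr -p)"
        using B(1) by (intro mult_left_mono) auto
      thus ?thesis using B(2)[of x] by simp
    qed
  qed
qed

section \<open>The fundamental solution\<close>

text \<open>A smooth substitute for \<^term>\<open>norm x\<close>, recovered for \<open>\<epsilon> \<rightarrow> 0\<close>.\<close>

definition reg_norm :: "real \<Rightarrow> real^3 \<Rightarrow> real" where
  "reg_norm \<epsilon> x = sqrt ((norm x)\<^sup>2 + \<epsilon>\<^sup>2)"

text \<open>
  A smooth substitute for \<open>exp (- z * norm x) * norm x powr p\<close>. For fixed \<open>\<epsilon>\<close> and \<open>z\<close> these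
  functions span a space that is closed under differentiation up to polynomial coefficients.
\<close>

definition reg_kernel :: "real \<Rightarrow> complex \<Rightarrow> real \<Rightarrow> real^3 \<Rightarrow> complex" where
  "reg_kernel \<epsilon> z p x = exp (- z * of_real (reg_norm \<epsilon> x)) * of_real (reg_norm \<epsilon> x powr p)"

lemma reg_norm_pos: "\<epsilon> > 0 \<Longrightarrow> reg_norm \<epsilon> x > 0"
  by (simp add: reg_norm_def add_nonneg_pos)

lemma reg_norm_ge_norm: "norm x \<le> reg_norm \<epsilon> x"
  unfolding reg_norm_def by (rule real_le_rsqrt) simp

lemma reg_norm_has_derivative:
  assumes "\<epsilon> > 0"
  shows "(reg_norm \<epsilon> has_derivative (\<lambda>h. (x \<bullet> h) / reg_norm \<epsilon> x)) (at x)"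
proof -
  have pos: "x \<bullet> x + \<epsilon>\<^sup>2 > 0" using assms by (simp add: add_nonneg_pos)
  have "((\<lambda>y. sqrt (y \<bullet> y + \<epsilon>\<^sup>2)) has_derivative (\<lambda>h. (x \<bullet> h) / sqrt (x \<bullet> x + \<epsilon>\<^sup>2))) (at x)"
    using pos by (auto intro!: derivative_eq_intros simp: inner_commute field_simps)
  thus ?thesis by (simp add: reg_norm_def[abs_def] power2_norm_eq_inner)
qed

lemma reg_kernel_has_derivative:
  assumes "\<epsilon> > 0"
  shows "(reg_kernel \<epsilon> z p has_derivative
     (\<lambda>h. of_real (x \<bullet> h) * (- z * reg_kernel \<epsilon> z (p - 1) x + of_real p * reg_kernel \<epsilon> z (p - 2) x))) (at x)"
proof -
  let ?s = "reg_norm \<epsilon> x"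
  define G where "G t = exp (- z * of_real t) * of_real (t powr p)" for t :: real
  have pos: "?s > 0" by (rule reg_norm_pos[OF assms])
  have "((\<lambda>t. exp (- z * of_real t)) has_vector_derivative (- z * exp (- z * of_real ?s))) (at ?s)"
    by (auto intro!: derivative_eq_intros has_vector_derivative_real_field)
  moreover have "((\<lambda>t. complex_of_real (t powr p)) has_vector_derivative of_real (p * ?s powr (p - 1))) (at ?s)"
    by (intro has_vector_derivative_of_real)
       (use has_real_derivative_powr[OF pos, of p] in \<open>simp add: has_real_derivative_iff_has_vector_derivative\<close>)
  ultimately have "(G has_vector_derivative (exp (- z * of_real ?s) * of_real (p * ?s powr (p - 1)) +
      - z * exp (- z * of_real ?s) * of_real (?s powr p))) (at ?s)"
    unfolding G_def by (rule has_vector_derivative_mult)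
  hence "(G has_derivative (\<lambda>h. h *\<^sub>R (exp (- z * of_real ?s) * of_real (p * ?s powr (p - 1)) +
      - z * exp (- z * of_real ?s) * of_real (?s powr p)))) (at ?s)"
    by (simp only: has_vector_derivative_def)
  from has_derivative_compose[OF reg_norm_has_derivative[OF assms] this]
  have D: "((\<lambda>x. G (reg_norm \<epsilon> x)) has_derivative (\<lambda>h. ((x \<bullet> h) / ?s) *\<^sub>R (exp (- z * of_real ?s) * of_real (p * ?s powr (p - 1)) +
      - z * exp (- z * of_real ?s) * of_real (?s powr p)))) (at x)" .
  have e1: "?s powr (p - 1) = ?s powr p / ?s" "?s powr (p - 2) = ?s powr p / ?s\<^sup>2"
    using pos by (auto simp: powr_diff powr_numeral)
  have "((x \<bullet> h) / ?s) *\<^sub>R (exp (- z * of_real ?s) * of_real (p * ?s powr (p - 1)) +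
      - z * exp (- z * of_real ?s) * of_real (?s powr p)) =
     of_real (x \<bullet> h) * (- z * reg_kernel \<epsilon> z (p - 1) x + of_real p * reg_kernel \<epsilon> z (p - 2) x)" for h
    using pos unfolding reg_kernel_def e1 by (simp add: scaleR_conv_of_real field_simps power2_eq_square)
  moreover have "(\<lambda>x. G (reg_norm \<epsilon> x)) = reg_kernel \<epsilon> z p" by (auto simp: G_def reg_kernel_def)
  ultimately show ?thesis using D by simp
qed

lemma reg_kernel_differentiable: "\<epsilon> > 0 \<Longrightarrow> reg_kernel \<epsilon> z p differentiable at x"
  using reg_kernel_has_derivative[of \<epsilon> z p x] unfolding differentiable_def by blast

lemma pdir_reg_kernel:
  assumes "\<epsilon> > 0"
  shows "pdir i (reg_kernel \<epsilon> z p) = (\<lambda>x. of_real (x $ i) * (- z * reg_kernel \<epsilon> z (p - 1) x + of_real p * reg_kernel \<epsilon> z (p - 2) x))"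
  by (rule ext) (simp add: pdir_eqI[OF reg_kernel_has_derivative[OF assms]] inner_axis)

lemma smooth_reg_kernel:
  assumes "\<epsilon> > 0" shows "smooth (reg_kernel \<epsilon> z p)"
proof (rule smooth_span_smooth[where B = "range (reg_kernel \<epsilon> z)"])
  show "reg_kernel \<epsilon> z p \<in> smooth_span (range (reg_kernel \<epsilon> z))" by (intro smooth_span.base) auto
  fix b assume "b \<in> range (reg_kernel \<epsilon> z)"
  then obtain q where b: "b = reg_kernel \<epsilon> z q" by auto
  show "b differentiable at x" for x using b reg_kernel_differentiable[OF assms] by simp
  have 1: "(\<lambda>x. c * reg_kernel \<epsilon> z r x) \<in> smooth_span (range (reg_kernel \<epsilon> z))" for c r
    by (rule smooth_span.mult[OF smooth_const smooth_span.base]) auto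
  show "pdir i b \<in> smooth_span (range (reg_kernel \<epsilon> z))" for i
    unfolding b pdir_reg_kernel[OF assms]
    by (rule smooth_span.mult[OF smooth_coord smooth_span.add[OF 1 1]])
qed

lemma reg_kernel_shift: "\<epsilon> > 0 \<Longrightarrow> of_real ((norm x)\<^sup>2) * reg_kernel \<epsilon> z p x = reg_kernel \<epsilon> z (p + 2) x - of_real (\<epsilon>\<^sup>2) * reg_kernel \<epsilon> z p x"
proof -
  assume e: "\<epsilon> > 0"
  have "reg_norm \<epsilon> x powr (p + 2) = reg_norm \<epsilon> x powr p * (reg_norm \<epsilon> x)\<^sup>2" using reg_norm_pos[OF e, of x] by (simp add: powr_add powr_numeral)
  also have "(reg_norm \<epsilon> x)\<^sup>2 = (norm x)\<^sup>2 + \<epsilon>\<^sup>2" by (simp add: reg_norm_def)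
  finally show ?thesis unfolding reg_kernel_def by (simp add: algebra_simps)
qed

text \<open>
  Two exponents matter. For \<open>p = -1\<close> the terms without \<open>\<epsilon>\<^sup>2\<close> collapse to \<open>z\<^sup>2\<close> times the
  kernel, which makes \<open>exp (-zr)/r\<close> a fundamental solution. For \<open>p = -1/2\<close> and \<open>z = 0\<close> both
  remaining terms are negative, which gives the superharmonic function behind Hardy's
  inequality.
\<close>

lemma lap_reg_kernel:
  assumes "\<epsilon> > 0"
  shows "lap (reg_kernel \<epsilon> z p) x = z\<^sup>2 * reg_kernel \<epsilon> z p x - (2 * of_real p + 2) * z * reg_kernel \<epsilon> z (p - 1) x + of_real (p * (p + 1)) * reg_kernel \<epsilon> z (p - 2) x
     - of_real (\<epsilon>\<^sup>2) * (z\<^sup>2 * reg_kernel \<epsilon> z (p - 2) x - (2 * of_real p - 1) * z * reg_kernel \<epsilon> z (p - 3) x + of_real (p * (p - 2)) * reg_kernel \<epsilon> z (p - 4) x)"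
proof -
  let ?k = "\<lambda>q. reg_kernel \<epsilon> z q x"
  define G where "G = - z * ?k (p - 1) + of_real p * ?k (p - 2)"
  define H where "H = z\<^sup>2 * ?k (p - 2) - (2 * of_real p - 1) * z * ?k (p - 3) + of_real (p * (p - 2)) * ?k (p - 4)"
  note sm = smooth_mult smooth_add smooth_const smooth_coord smooth_reg_kernel[OF assms]
  have "partials [i,i] (reg_kernel \<epsilon> z p) x = G + of_real ((x $ i)\<^sup>2) * H" for i
  proof -
    have "partials [i,i] (reg_kernel \<epsilon> z p) x = pdir i (\<lambda>x. of_real (x $ i) * (- z * reg_kernel \<epsilon> z (p - 1) x + of_real p * reg_kernel \<epsilon> z (p - 2) x)) x"
      by (simp add: partials_Cons pdir_reg_kernel[OF assms])
    also have "\<dots> = G + of_real (x $ i) * (- z * (of_real (x $ i) * (- z * ?k (p - 1 - 1) + of_real (p - 1) * ?k (p - 1 - 2)))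
           + of_real p * (of_real (x $ i) * (- z * ?k (p - 2 - 1) + of_real (p - 2) * ?k (p - 2 - 2))))"
      by (subst pdir_smooth_mult, (intro sm)+, subst pdir_smooth_add, (intro sm)+, (subst pdir_smooth_mult, (intro sm)+)+)
         (simp add: pdir_coord pdir_reg_kernel[OF assms] G_def)
    also have "\<dots> = G + of_real ((x $ i)\<^sup>2) * H"
      unfolding H_def by (simp add: algebra_simps power2_eq_square)
    finally show ?thesis .
  qed
  hence "lap (reg_kernel \<epsilon> z p) x = 3 * G + of_real (\<Sum>i\<in>UNIV. (x $ i)\<^sup>2) * H"
    by (simp add: lap_def sum.distrib sum_distrib_right)
  also have "(\<Sum>i\<in>UNIV. (x $ i)\<^sup>2) = (norm x)\<^sup>2"
    by (simp add: norm_vec_def L2_set_def sum_nonneg)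
  also have "of_real ((norm x)\<^sup>2) * H = z\<^sup>2 * (of_real ((norm x)\<^sup>2) * ?k (p - 2)) - (2 * of_real p - 1) * z * (of_real ((norm x)\<^sup>2) * ?k (p - 3)) + of_real (p * (p - 2)) * (of_real ((norm x)\<^sup>2) * ?k (p - 4))"
    unfolding H_def by (simp add: algebra_simps)
  also have "\<dots> = z\<^sup>2 * ?k p - (2 * of_real p - 1) * z * ?k (p - 1) + of_real (p * (p - 2)) * ?k (p - 2) - of_real (\<epsilon>\<^sup>2) * H"
    unfolding reg_kernel_shift[OF assms] H_def by (simp add: algebra_simps)
  finally show ?thesis unfolding G_def H_def by (simp add: algebra_simps)
qed

text \<open>
  Up to the factor \<open>Newton_const\<close>, the fundamental solution of \<open>z\<^sup>2 - \<Delta>\<close>. Division by zero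
  gives the value \<open>0\<close> at the origin.
\<close>

definition yukawa :: "complex \<Rightarrow> real^3 \<Rightarrow> complex" where
  "yukawa z x = exp (- z * of_real (norm x)) / of_real (norm x)"

text \<open>
  The number \<open>4 \<pi>\<close>, in the form in which it arises in the next proof. Only its positivity is
  used: it cancels in the final estimate.
\<close>

definition Newton_const :: real where
  "Newton_const = (\<integral>x. 3 * reg_norm 1 x powr -5 \<partial>lborel)"

lemma reg_norm_bound: "p \<ge> 0 \<Longrightarrow> reg_norm 1 x powr -p \<le> 2 powr p * (1 + norm x) powr -p"
proof -
  assume p: "p \<ge> 0"
  have "(1 + norm x)\<^sup>2 = 1 + 2 * norm x + (norm x)\<^sup>2" "(2 * reg_norm 1 x)\<^sup>2 = 4 * (norm x)\<^sup>2 + 4"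
    "2 * norm x \<le> 1 + (norm x)\<^sup>2"
    using sum_squares_bound[of 1 "norm x"] by (auto simp: reg_norm_def power2_sum power_mult_distrib)
  hence "(1 + norm x)\<^sup>2 \<le> (2 * reg_norm 1 x)\<^sup>2" using zero_le_power2[of "norm x"] by linarith
  hence "(1 + norm x) / 2 \<le> reg_norm 1 x" using power2_le_imp_le[of "1 + norm x" "2 * reg_norm 1 x"] reg_norm_pos[of 1 x] by simp
  hence "reg_norm 1 x powr -p \<le> ((1 + norm x) / 2) powr -p"
    using p by (intro powr_mono2') (auto simp: add_pos_nonneg)
  also have "\<dots> = 2 powr p * (1 + norm x) powr -p"
    by (simp add: powr_divide powr_minus field_simps)
  finally show ?thesis .
qed

lemma reg_norm_measurable [measurable]: "reg_norm \<epsilon> \<in> borel_measurable borel"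
  unfolding reg_norm_def by measurable

lemma reg_kernel_measurable [measurable]: "reg_kernel \<epsilon> z p \<in> borel_measurable borel"
  unfolding reg_kernel_def by measurable

lemma yukawa_measurable [measurable]: "yukawa z \<in> borel_measurable borel"
  unfolding yukawa_def by measurable

lemma integrable_reg_norm: "p > 3 \<Longrightarrow> integrable lborel (\<lambda>x. reg_norm 1 x powr -p)"
proof (rule Bochner_Integration.integrable_bound)
  assume p: "p > 3"
  show "integrable lborel (\<lambda>x::real^3. 2 powr p * (1 + norm x) powr -p)"
    by (intro integrable_mult_right integrable_japanese p)
  show "AE x in lborel. norm (reg_norm 1 x powr -p) \<le> norm (2 powr p * (1 + norm x) powr -p)"
    using reg_norm_bound p by auto
qed auto

lemma Newton_const_pos: "Newton_const > 0"
proof -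
  have i: "integrable lborel (\<lambda>x. 3 * reg_norm 1 x powr -5)" by (intro integrable_mult_right integrable_reg_norm) auto
  have p: "3 * reg_norm 1 x powr -5 > 0" for x using reg_norm_pos[of 1 x] by simp
  have "Newton_const \<ge> 0" unfolding Newton_const_def by (intro integral_nonneg_AE) auto
  moreover have "Newton_const \<noteq> 0"
  proof
    assume "Newton_const = 0"
    hence "AE x in lborel. 3 * reg_norm 1 x powr -5 = 0"
      using integral_nonneg_eq_0_iff_AE[OF i] p unfolding Newton_const_def by (auto simp: less_imp_le)
    hence "AE x in (lborel::(real^3) measure). False" by eventually_elim (use p in \<open>auto simp: less_le\<close>)
    thus False using AE_iff_measurable[of "UNIV" "lborel::(real^3) measure" "\<lambda>_. False"] emeasure_lborel_UNIV by auto
  qed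
  ultimately show ?thesis by simp
qed

lemma norm_reg_kernel_le:
  assumes "\<epsilon> > 0" "Re z \<ge> 0"
  shows "norm (reg_kernel \<epsilon> z p x) \<le> reg_norm \<epsilon> x powr p"
proof -
  have "norm (exp (- z * of_real (reg_norm \<epsilon> x))) \<le> 1"
    using assms reg_norm_pos[of \<epsilon> x] by (simp add: mult_nonneg_nonneg less_imp_le)
  thus ?thesis unfolding reg_kernel_def norm_mult by (simp add: mult_left_le_one_le)
qed

lemma norm_yukawa_le: "Re z \<ge> 0 \<Longrightarrow> norm (yukawa z x) \<le> 1 / norm x"
  by (simp add: yukawa_def norm_divide divide_right_mono)

lemma reg_norm_tendsto: "(\<lambda>n. reg_norm (1 / real (Suc n)) x) \<longlonglongrightarrow> norm x"
proof -
  have "(\<lambda>n. sqrt ((norm x)\<^sup>2 + (1 / real (Suc n))\<^sup>2)) \<longlonglongrightarrow> sqrt ((norm x)\<^sup>2 + 0\<^sup>2)"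
    using LIMSEQ_inverse_real_of_nat by (intro tendsto_intros) (simp add: inverse_eq_divide)
  thus ?thesis by (simp add: reg_norm_def)
qed

lemma reg_norm_scale: "\<epsilon> > 0 \<Longrightarrow> reg_norm \<epsilon> (\<epsilon> *\<^sub>R w) = \<epsilon> * reg_norm 1 w"
proof -
  assume e: "\<epsilon> > 0"
  have "(norm (\<epsilon> *\<^sub>R w))\<^sup>2 + \<epsilon>\<^sup>2 = \<epsilon>\<^sup>2 * ((norm w)\<^sup>2 + 1)"
    using e by (simp add: power_mult_distrib algebra_simps)
  thus ?thesis using e by (simp add: reg_norm_def real_sqrt_mult)
qed

text \<open>
  Integrate by parts against the regularised kernel. The regularisation leaves an error \<open>\<epsilon>\<^sup>2
  E\<close> concentrated near the origin; after the substitution \<open>x = \<epsilon> w\<close> only its most singular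
  term survives in the limit, and that term is the integrand of \<open>Newton_const\<close>.
\<close>

lemma yukawa_fundamental_solution:
  assumes z: "Re z \<ge> 0" and u: "u \<in> test_functions"
  shows "(\<integral>x. yukawa z x * (lap u x - z\<^sup>2 * u x) \<partial>lborel) = - of_real Newton_const * u 0"
proof -
  define h where "h n = 1 / real (Suc n)" for n
  have h: "h n > 0" "h n \<le> 1" for n by (auto simp: h_def)
  have h0: "h \<longlonglongrightarrow> 0" using LIMSEQ_inverse_real_of_nat by (simp add: h_def[abs_def] inverse_eq_divide)
  define g where "g x = lap u x - z\<^sup>2 * u x" for x
  have g: "g \<in> test_functions" unfolding g_def by (intro test_diff test_lap test_cmult u)
  note sm = smooth_reg_kernel[OF h(1)]
  \<comment> \<open>The error term of \<open>lap_reg_kernel\<close> for \<open>p = -1\<close>, without the factor \<open>\<epsilon>\<^sup>2\<close>.\<close>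
  define E where "E \<epsilon> x = z\<^sup>2 * reg_kernel \<epsilon> z (-3) x + 3 * z * reg_kernel \<epsilon> z (-4) x + 3 * reg_kernel \<epsilon> z (-5) x" for \<epsilon> x
  have A: "(\<integral>x. reg_kernel (h n) z (-1) x * g x \<partial>lborel) = - (\<integral>x. of_real ((h n)\<^sup>2) * E (h n) x * u x \<partial>lborel)" for n
  proof -
    have i1: "integrable lborel (\<lambda>x. reg_kernel (h n) z (-1) x * lap u x)"
      by (intro test_integrable test_mult sm test_lap u)
    have i2: "integrable lborel (\<lambda>x. reg_kernel (h n) z (-1) x * (z\<^sup>2 * u x))"
      by (intro test_integrable test_mult sm test_cmult u)
    have i3: "integrable lborel (\<lambda>x. lap (reg_kernel (h n) z (-1)) x * u x)"
      by (intro test_integrable test_mult smooth_lap sm u)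
    have "(\<integral>x. reg_kernel (h n) z (-1) x * g x \<partial>lborel) = (\<integral>x. reg_kernel (h n) z (-1) x * lap u x - reg_kernel (h n) z (-1) x * (z\<^sup>2 * u x) \<partial>lborel)"
      by (simp add: g_def algebra_simps)
    also have "\<dots> = (\<integral>x. lap (reg_kernel (h n) z (-1)) x * u x - reg_kernel (h n) z (-1) x * (z\<^sup>2 * u x) \<partial>lborel)"
      using Bochner_Integration.integral_diff[OF i1 i2] Bochner_Integration.integral_diff[OF i3 i2]
        integral_lap_by_parts[OF sm u, of n z "-1"] by simp
    also have "(\<lambda>x. lap (reg_kernel (h n) z (-1)) x * u x - reg_kernel (h n) z (-1) x * (z\<^sup>2 * u x)) =
        (\<lambda>x. - (of_real ((h n)\<^sup>2) * E (h n) x * u x))"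
      by (rule ext) (simp add: lap_reg_kernel[OF h(1)] E_def algebra_simps)
    finally show ?thesis by simp
  qed
  \<comment> \<open>The error term after \<open>x = h n * w\<close>; the Jacobian \<open>(h n)\<^sup>3\<close> and the factor \<open>(h n)\<^sup>2\<close> exactly
    compensate the singularity of degree \<open>-5\<close>.\<close>
  define G where "G n w = exp (- z * of_real (h n * reg_norm 1 w)) * of_real (reg_norm 1 w powr -5) *
         (z\<^sup>2 * of_real ((h n * reg_norm 1 w)\<^sup>2) + 3 * z * of_real (h n * reg_norm 1 w) + 3) * u (h n *\<^sub>R w)" for n w
  have B: "(\<integral>x. of_real ((h n)\<^sup>2) * E (h n) x * u x \<partial>lborel) =
      (\<integral>w. G n w \<partial>lborel)" for n
  proof -
    have key: "of_real (h n ^ 3) * (of_real ((h n)\<^sup>2) * E (h n) (h n *\<^sub>R w) * u (h n *\<^sub>R w)) =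
      G n w" for w
    proof -
      let ?r = "reg_norm 1 w" and ?h = "h n"
      have p: "?r > 0" "?h > 0" by (auto simp: reg_norm_pos h)
      have eq: "?h ^ 3 * ?h\<^sup>2 * (?h * ?r) powr -3 = ?r powr -5 * (?h * ?r)\<^sup>2"
        "?h ^ 3 * ?h\<^sup>2 * (?h * ?r) powr -4 = ?r powr -5 * (?h * ?r)"
        "?h ^ 3 * ?h\<^sup>2 * (?h * ?r) powr -5 = ?r powr -5"
        using p by (auto simp: powr_mult powr_minus powr_numeral power_mult_distrib field_simps eval_nat_numeral)
      have "of_real (?h ^ 3) * (of_real (?h\<^sup>2) * E ?h (?h *\<^sub>R w) * u (?h *\<^sub>R w)) =
         exp (- z * of_real (?h * ?r)) * (z\<^sup>2 * of_real (?h ^ 3 * ?h\<^sup>2 * (?h * ?r) powr -3) +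
           3 * z * of_real (?h ^ 3 * ?h\<^sup>2 * (?h * ?r) powr -4) + 3 * of_real (?h ^ 3 * ?h\<^sup>2 * (?h * ?r) powr -5)) * u (?h *\<^sub>R w)"
        unfolding E_def reg_kernel_def reg_norm_scale[OF p(2)] by (simp add: algebra_simps)
      also have "\<dots> = exp (- z * of_real (?h * ?r)) * of_real (?r powr -5) *
         (z\<^sup>2 * of_real ((?h * ?r)\<^sup>2) + 3 * z * of_real (?h * ?r) + 3) * u (?h *\<^sub>R w)"
        unfolding eq by (simp add: algebra_simps)
      finally show ?thesis by (simp only: G_def)
    qed
    let ?F = "\<lambda>x. of_real ((h n)\<^sup>2) * E (h n) x * u x"
    have "h n \<noteq> 0" using h(1)[of n] by simp
    from lborel_integral_affine(1)[OF this, of ?F 0]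
    have "(\<integral>x. ?F x \<partial>lborel) = of_real (h n ^ 3) * (\<integral>w. ?F (h n *\<^sub>R w) \<partial>lborel)"
      using h(1)[of n] by (simp add: scaleR_conv_of_real[where 'a=complex])
    also have "\<dots> = (\<integral>w. of_real (h n ^ 3) * ?F (h n *\<^sub>R w) \<partial>lborel)" by (rule integral_mult_right_zero[symmetric])
    finally show ?thesis by (simp only: key)
  qed
  obtain C where C: "C > 0" "\<And>x. norm (u x) \<le> C * (1 + norm x) powr -1" by (rule test_decay[OF u, of 1]) auto
  have L1: "(\<lambda>n. \<integral>x. reg_kernel (h n) z (-1) x * g x \<partial>lborel) \<longlonglongrightarrow> (\<integral>x. yukawa z x * g x \<partial>lborel)"
  proof -
    obtain D where D: "D > 0" "\<And>x. norm (g x) \<le> D * (1 + norm x) powr -3" by (rule test_decay[OF g, of 3]) auto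
    show ?thesis
    proof (rule integral_dominated_convergence)
      show "(\<lambda>x. yukawa z x * g x) \<in> borel_measurable lborel" "(\<lambda>x. reg_kernel (h n) z (-1) x * g x) \<in> borel_measurable lborel" for n
        using smooth_measurable[OF test_smooth[OF g]] by measurable
      show "integrable lborel (\<lambda>x::real^3. D * (norm x powr -1 * (1 + norm x) powr -3))"
        by (intro integrable_mult_right powr_integrable) auto
      show "AE x in lborel. norm (reg_kernel (h n) z (-1) x * g x) \<le> D * (norm x powr -1 * (1 + norm x) powr -3)" for n
        using AE_lborel_singleton[of "0::real^3"]
      proof eventually_elim
        fix x :: "real^3" assume "x \<noteq> 0"
        have "norm (reg_kernel (h n) z (-1) x) \<le> reg_norm (h n) x powr -1" by (rule norm_reg_kernel_le[OF h(1) z])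
        also have "\<dots> \<le> norm x powr -1" using \<open>x \<noteq> 0\<close> by (intro powr_mono2' reg_norm_ge_norm) auto
        finally have "norm (reg_kernel (h n) z (-1) x) * norm (g x) \<le> norm x powr -1 * (D * (1 + norm x) powr -3)"
          by (intro mult_mono D(2)) auto
        thus "norm (reg_kernel (h n) z (-1) x * g x) \<le> D * (norm x powr -1 * (1 + norm x) powr -3)"
          by (simp add: norm_mult mult_ac)
      qed
      show "AE x in lborel. (\<lambda>n. reg_kernel (h n) z (-1) x * g x) \<longlonglongrightarrow> yukawa z x * g x"
        using AE_lborel_singleton[of "0::real^3"]
      proof eventually_elim
        fix x :: "real^3" assume x: "x \<noteq> 0"
        have "(\<lambda>n. reg_kernel (h n) z (-1) x * g x) \<longlonglongrightarrow> exp (- z * of_real (norm x)) * of_real (norm x powr -1) * g x"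
          unfolding reg_kernel_def h_def using x by (intro tendsto_intros reg_norm_tendsto) auto
        thus "(\<lambda>n. reg_kernel (h n) z (-1) x * g x) \<longlonglongrightarrow> yukawa z x * g x"
          by (simp add: yukawa_def powr_minus divide_inverse)
      qed
    qed
  qed
  have L2: "(\<lambda>n. \<integral>w. G n w \<partial>lborel)
     \<longlonglongrightarrow> (\<integral>w. of_real (3 * reg_norm 1 w powr -5) * u 0 \<partial>lborel)"
  proof (rule integral_dominated_convergence)
    have [measurable]: "u \<in> borel_measurable borel" by (rule smooth_measurable[OF test_smooth[OF u]])
    show "(\<lambda>w. complex_of_real (3 * reg_norm 1 w powr -5) * u 0) \<in> borel_measurable lborel" by measurable
    show "(\<lambda>w. G n w) \<in> borel_measurable lborel" for n
      unfolding G_def by measurable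
    \<comment> \<open>The polynomial factor may grow with \<open>w\<close>; the decay of \<open>u\<close> at the scale \<open>1 / h n\<close> pays for
      one power of it, which leaves the integrable \<open>(reg_norm 1 w) powr -4\<close>.\<close>
    let ?M = "(norm z)\<^sup>2 + 3 * norm z + 3"
    show "integrable lborel (\<lambda>w. (?M * 2 * C) * reg_norm 1 w powr -4)" by (intro integrable_mult_right integrable_reg_norm) auto
    show "AE w in lborel. norm (G n w) \<le> (?M * 2 * C) * reg_norm 1 w powr -4" for n
    proof (rule AE_I2)
      fix w :: "real^3"
      let ?r = "reg_norm 1 w" and ?h = "h n"
      have r: "?r \<ge> 1" by (simp add: reg_norm_def)
      have "?r \<le> norm w + 1" unfolding reg_norm_def by (rule real_le_lsqrt) (auto simp: power2_sum)
      hence hr1: "?h * ?r \<le> ?h * norm w + 1" using h[of n] mult_left_mono[of ?r "norm w + 1" ?h] by (simp add: algebra_simps)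
      have hr0: "0 < ?h * ?r" using h[of n] r by (intro mult_pos_pos) auto
      have hrr: "?h * ?r \<le> ?r" using h[of n] r by (intro mult_left_le_one_le) auto
      have e: "norm (exp (- z * of_real (?h * ?r))) \<le> 1" using z hr0 by (simp add: mult_nonneg_nonneg)
      have "norm (z\<^sup>2 * of_real ((?h * ?r)\<^sup>2) + 3 * z * of_real (?h * ?r) + 3) \<le> (norm z)\<^sup>2 * (?h * ?r)\<^sup>2 + 3 * norm z * (?h * ?r) + 3"
        using hr0 r by (intro norm_triangle_mono) (auto simp: abs_of_pos[OF reg_norm_pos[of 1 w]] norm_mult norm_power abs_mult power_mult_distrib h(1) less_imp_le)
      also have "\<dots> \<le> (norm z)\<^sup>2 * (?r * (?h * norm w + 1)) + 3 * norm z * (?r * (?h * norm w + 1)) + 3 * (?r * (?h * norm w + 1))"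
      proof (intro add_mono mult_left_mono)
        show "(?h * ?r)\<^sup>2 \<le> ?r * (?h * norm w + 1)" unfolding power2_eq_square
          using hr0 hrr hr1 r by (intro mult_mono) auto
        have "1 \<le> ?h * norm w + 1" using h[of n] by (simp add: less_imp_le)
        thus "?h * ?r \<le> ?r * (?h * norm w + 1)" using mult_mono[OF hrr, of 1 "?h * norm w + 1"] r by simp
        show "3 \<le> 3 * (?r * (?h * norm w + 1))" using mult_mono[OF r \<open>1 \<le> ?h * norm w + 1\<close>] r by simp
      qed auto
      also have "\<dots> = ?M * (?r * (1 + ?h * norm w))" by (simp add: algebra_simps)
      finally have 1: "norm (z\<^sup>2 * of_real ((?h * ?r)\<^sup>2) + 3 * z * of_real (?h * ?r) + 3) \<le> ?M * (?r * (1 + ?h * norm w))" .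
      have 2: "norm (u (?h *\<^sub>R w)) \<le> C / (1 + ?h * norm w)" using C(2)[of "?h *\<^sub>R w"] h(1)[of n]
        by (simp add: powr_minus divide_inverse add_pos_nonneg)
      have pos: "1 + ?h * norm w > 0" using h(1)[of n] by (simp add: add_pos_nonneg)
      have "norm (G n w) \<le>
         1 * ?r powr -5 * (?M * (?r * (1 + ?h * norm w))) * (C / (1 + ?h * norm w))"
        unfolding G_def norm_mult using e 1 2 C(1) pos r
        by (intro mult_mono) (auto intro!: mult_nonneg_nonneg simp: norm_mult)
      also have "\<dots> = (?M * C) * (?r powr -5 * ?r)" using pos by simp
      also have "?r powr -5 * ?r = ?r powr -4" using r powr_add[of ?r "-5" 1] by simp
      also have "(?M * C) * ?r powr -4 \<le> (?M * 2 * C) * ?r powr -4" using C(1) by (intro mult_right_mono) auto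
      finally show "norm (G n w) \<le> (?M * 2 * C) * ?r powr -4" .
    qed
    show "AE w in lborel. (\<lambda>n. G n w) \<longlonglongrightarrow> of_real (3 * reg_norm 1 w powr -5) * u 0"
    proof (rule AE_I2)
      fix w :: "real^3"
      have "isCont u 0" using smooth_continuous[OF test_smooth[OF u], of UNIV] by (simp add: continuous_on_eq_continuous_at)
      moreover have "(\<lambda>n. h n *\<^sub>R w) \<longlonglongrightarrow> 0 *\<^sub>R w" by (intro tendsto_intros h0)
      ultimately have ul: "(\<lambda>n. u (h n *\<^sub>R w)) \<longlonglongrightarrow> u 0" using isCont_tendsto_compose[of 0 u] by simp
      have "(\<lambda>n. G n w) \<longlonglongrightarrow>
         exp (- z * of_real (0 * reg_norm 1 w)) * of_real (reg_norm 1 w powr -5) *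
         (z\<^sup>2 * of_real ((0 * reg_norm 1 w)\<^sup>2) + 3 * z * of_real (0 * reg_norm 1 w) + 3) * u 0"
        unfolding G_def by (intro tendsto_intros h0 ul)
      thus "(\<lambda>n. G n w) \<longlonglongrightarrow> of_real (3 * reg_norm 1 w powr -5) * u 0"
        by (simp add: mult_ac)
    qed
  qed
  have "(\<integral>w. of_real (3 * reg_norm 1 w powr -5) * u 0 \<partial>lborel) = of_real Newton_const * u 0"
    unfolding Newton_const_def by (simp only: integral_mult_left_zero integral_complex_of_real)
  with tendsto_minus[OF L2] have "(\<lambda>n. \<integral>x. reg_kernel (h n) z (-1) x * g x \<partial>lborel) \<longlonglongrightarrow> - (of_real Newton_const * u 0)"
    by (simp only: A B)
  from LIMSEQ_unique[OF L1 this] show ?thesis by (simp add: g_def)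
qed

section \<open>Convolution with a test function\<close>

lemma frechet_pdir:
  assumes "f differentiable at x"
  shows "frechet_derivative f (at x) h = (\<Sum>i\<in>UNIV. of_real (h $ i) * pdir i f x)"
proof -
  let ?D = "frechet_derivative f (at x)"
  have lin: "linear ?D" using assms by (rule linear_frechet_derivative)
  have "?D h = ?D (\<Sum>i\<in>UNIV. (h $ i) *\<^sub>R axis i 1)" by (simp add: basis_expansion flip: scalar_mult_eq_scaleR)
  also have "\<dots> = (\<Sum>i\<in>UNIV. (h $ i) *\<^sub>R ?D (axis i 1))" using lin by (simp add: linear_sum linear_cmul)
  finally show ?thesis by (simp add: pdir_def scaleR_conv_of_real)
qed

lemma norm_frechet_le:
  assumes "f differentiable at x" "\<And>i. norm (pdir i f x) \<le> B"
  shows "norm (frechet_derivative f (at x) h) \<le> of_nat CARD('n) * B * norm (h :: real^'n)"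
proof -
  have "norm (frechet_derivative f (at x) h) \<le> (\<Sum>i\<in>UNIV. norm (of_real (h $ i) * pdir i f x))"
    unfolding frechet_pdir[OF assms(1)] by (rule norm_sum)
  also have "\<dots> \<le> (\<Sum>i\<in>(UNIV::'n set). norm h * B)"
    by (intro sum_mono) (auto simp: norm_mult intro!: mult_mono assms(2) component_le_norm_cart)
  finally show ?thesis by (simp add: mult_ac)
qed

lemma test_pdir_bounded:
  fixes u :: "real^'n \<Rightarrow> complex"
  assumes "u \<in> test_functions"
  obtains B where "B > 0" "\<And>i x. norm (pdir i u x) \<le> B"
proof -
  have "\<exists>B. \<forall>i. B i > 0 \<and> (\<forall>x. norm (pdir i u x) \<le> B i)"
    by (intro choice allI) (metis test_bounded test_pdir[OF assms])
  then obtain B where B: "\<And>i. B i > 0" "\<And>i x. norm (pdir i u x) \<le> B i" by auto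
  show ?thesis
  proof (rule that)
    show "sum B UNIV > 0" using B(1) by (intro sum_pos) auto
    have "B i \<le> sum B UNIV" for i using B(1) by (intro member_le_sum) (auto simp: less_imp_le)
    thus "norm (pdir i u x) \<le> sum B UNIV" for i x using B(2) order_trans by blast
  qed
qed

lemma test_lipschitz:
  fixes u :: "real^'n \<Rightarrow> complex"
  assumes "u \<in> test_functions"
  obtains L where "L > 0" "\<And>x y. norm (u x - u y) \<le> L * norm (x - y)"
proof -
  obtain B where B: "B > 0" "\<And>i x. norm (pdir i u x) \<le> B" by (rule test_pdir_bounded[OF assms]) blast
  note d = smooth_differentiable[OF test_smooth[OF assms]]
  show ?thesis
  proof (rule that)
    show "of_nat CARD('n) * B > 0" using B(1) by simp
    show "norm (u x - u y) \<le> of_nat CARD('n) * B * norm (x - y)" for x y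
    proof (rule differentiable_bound[of UNIV u "\<lambda>x. frechet_derivative u (at x)"])
      show "(u has_derivative frechet_derivative u (at x)) (at x within UNIV)" for x
        using d frechet_derivative_works by blast
      show "onorm (frechet_derivative u (at x)) \<le> of_nat CARD('n) * B" for x
        by (rule onorm_le) (rule norm_frechet_le[OF d B(2)])
    qed auto
  qed
qed

text \<open>
  The remainder is uniform in the base point, so that it can be integrated against a locally
  integrable kernel.
\<close>

lemma test_taylor:
  fixes u :: "real^'n \<Rightarrow> complex"
  assumes "u \<in> test_functions"
  obtains L where "L > 0" "\<And>x h. norm (u (x + h) - u x - (\<Sum>i\<in>UNIV. of_real (h $ i) * pdir i u x)) \<le> L * (norm h)\<^sup>2"
proof -
  have "\<exists>L. \<forall>i. L i > 0 \<and> (\<forall>x y. norm (pdir i u x - pdir i u y) \<le> L i * norm (x - y))"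
    by (intro choice allI) (metis test_lipschitz test_pdir[OF assms])
  then obtain L where L: "\<And>i. L i > 0" "\<And>i x y. norm (pdir i u x - pdir i u y) \<le> L i * norm (x - y)" by auto
  note d = smooth_differentiable[OF test_smooth[OF assms]]
  show ?thesis
  proof (rule that)
    show "sum L UNIV > 0" using L(1) by (intro sum_pos) auto
    fix x h :: "real^'n"
    have "norm (u (x + h) - u x - frechet_derivative u (at x) (x + h - x)) \<le> norm (x + h - x) * (sum L UNIV * norm h)"
    proof (rule differentiable_bound_linearization[where S = "cball x (norm h)" and f' = "\<lambda>x. frechet_derivative u (at x)"])
      show "x + t *\<^sub>R (x + h - x) \<in> cball x (norm h)" if "t \<in> {0..1}" for t
        using that by (simp add: dist_norm mult_left_le_one_le)
      show "(u has_derivative frechet_derivative u (at y)) (at y within cball x (norm h))" for y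
        using d frechet_derivative_works has_derivative_at_withinI by blast
      show "onorm (frechet_derivative u (at y) - frechet_derivative u (at x)) \<le> sum L UNIV * norm h" if y: "y \<in> cball x (norm h)" for y
        unfolding fun_diff_def
      proof (rule onorm_le)
        fix a :: "real^'n"
        have "norm (frechet_derivative u (at y) a - frechet_derivative u (at x) a) = norm (\<Sum>i\<in>UNIV. of_real (a $ i) * (pdir i u y - pdir i u x))"
          unfolding frechet_pdir[OF d] by (simp add: sum_subtractf right_diff_distrib)
        also have "\<dots> \<le> (\<Sum>i\<in>UNIV. norm (of_real (a $ i) * (pdir i u y - pdir i u x)))" by (rule norm_sum)
        also have "\<dots> \<le> (\<Sum>i\<in>UNIV. norm a * (L i * norm h))"
        proof (intro sum_mono)
          fix i
          have "norm (pdir i u y - pdir i u x) \<le> L i * norm (y - x)" by (rule L(2))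
          also have "\<dots> \<le> L i * norm h" using y L(1)[of i] by (intro mult_left_mono) (auto simp: dist_norm norm_minus_commute)
          finally show "norm (of_real (a $ i) * (pdir i u y - pdir i u x)) \<le> norm a * (L i * norm h)"
            by (auto simp: norm_mult intro!: mult_mono component_le_norm_cart)
        qed
        finally show "norm (frechet_derivative u (at y) a - frechet_derivative u (at x) a) \<le> sum L UNIV * norm h * norm a"
          by (simp add: sum_distrib_left sum_distrib_right mult_ac)
      qed
    qed auto
    thus "norm (u (x + h) - u x - (\<Sum>i\<in>UNIV. of_real (h $ i) * pdir i u x)) \<le> sum L UNIV * (norm h)\<^sup>2"
      by (simp add: frechet_pdir[OF d] power2_eq_square mult_ac)
  qed
qed

definition conv :: "(real^'n \<Rightarrow> complex) \<Rightarrow> (real^'n \<Rightarrow> complex) \<Rightarrow> real^'n \<Rightarrow> complex" where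
  "conv k u x = (\<integral>y. k y * u (x - y) \<partial>lborel)"

lemma test_reflect: "u \<in> test_functions \<Longrightarrow> (\<lambda>y. u (x - y)) \<in> test_functions"
  using test_affine[of u "-1" x] by simp

text \<open>
  The second bound is what carries a uniform estimate of \<open>u\<close>, such as a Taylor remainder,
  through the integral.
\<close>

lemma locally_integrable_mult:
  fixes k :: "real^'n \<Rightarrow> complex"
  assumes k: "\<And>R. integrable lborel (\<lambda>y. indicator (cball 0 R) y *\<^sub>R k y)"
    and u: "continuous_on UNIV u" "\<And>y. norm y \<ge> R \<Longrightarrow> u y = 0" "\<And>y. norm (u y) \<le> B"
  shows "integrable lborel (\<lambda>y. k y * u y)"
    and "norm (\<integral>y. k y * u y \<partial>lborel) \<le> B * (\<integral>y. norm (indicator (cball 0 R) y *\<^sub>R k y) \<partial>lborel)"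
proof -
  have eq: "k y * u y = (indicator (cball 0 R) y *\<^sub>R k y) * u y" for y using u(2)[of y] by (auto simp: indicator_def)
  have b: "norm ((indicator (cball 0 R) y *\<^sub>R k y) * u y) \<le> norm (B *\<^sub>R (indicator (cball 0 R) y *\<^sub>R k y))" for y
    unfolding norm_mult norm_scaleR mult.commute[of "\<bar>B\<bar>"] using u(3)[of y] by (intro mult_left_mono) auto
  have m: "u \<in> borel_measurable borel" by (rule borel_measurable_continuous_onI[OF u(1)])
  show i: "integrable lborel (\<lambda>y. k y * u y)" unfolding eq
  proof (rule Bochner_Integration.integrable_bound)
    show "integrable lborel (\<lambda>y. B *\<^sub>R (indicator (cball 0 R) y *\<^sub>R k y))" by (intro integrable_scaleR_right k)
    show "(\<lambda>y. (indicator (cball 0 R) y *\<^sub>R k y) * u y) \<in> borel_measurable lborel"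
      using m borel_measurable_integrable[OF k] by measurable
  qed (use b in auto)
  have B: "B \<ge> 0" using u(3)[of 0] norm_ge_zero order_trans by blast
  have "norm (\<integral>y. k y * u y \<partial>lborel) \<le> (\<integral>y. norm (k y * u y) \<partial>lborel)" by (rule integral_norm_bound)
  also have "\<dots> \<le> (\<integral>y. B * norm (indicator (cball 0 R) y *\<^sub>R k y) \<partial>lborel)"
  proof (rule integral_mono)
    show "norm (k y * u y) \<le> B * norm (indicator (cball 0 R) y *\<^sub>R k y)" for y
      using b[of y] B unfolding eq[of y] by (simp add: abs_mult mult_ac)
  qed (intro integrable_mult_right integrable_norm k i)+
  finally show "norm (\<integral>y. k y * u y \<partial>lborel) \<le> B * (\<integral>y. norm (indicator (cball 0 R) y *\<^sub>R k y) \<partial>lborel)" by simp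
qed

lemma locally_integrable_mult_test:
  fixes k :: "real^'n \<Rightarrow> complex"
  assumes k: "\<And>R. integrable lborel (\<lambda>y. indicator (cball 0 R) y *\<^sub>R k y)" and \<eta>: "\<eta> \<in> test_functions"
  shows "integrable lborel (\<lambda>y. k y * \<eta> y)"
proof -
  obtain R where R: "\<And>x. norm x \<ge> R \<Longrightarrow> \<eta> x = 0" by (rule test_functionsE[OF \<eta>]) auto
  obtain B where B: "\<And>x. norm (\<eta> x) \<le> B" by (rule test_bounded[OF \<eta>]) auto
  show ?thesis by (rule locally_integrable_mult(1)[OF k smooth_continuous[OF test_smooth[OF \<eta>]] R B])
qed

lemma conv_integrable:
  assumes k: "\<And>R. integrable lborel (\<lambda>y. indicator (cball 0 R) y *\<^sub>R k y)" and u: "u \<in> test_functions"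
  shows "integrable lborel (\<lambda>y. k y * u (x - y))"
  by (rule locally_integrable_mult_test[OF k test_reflect[OF u]])

text \<open>
  All derivatives fall on the smooth factor: the Taylor remainder of \<open>u\<close> is \<open>O(\<bar>h\<bar>\<^sup>2)\<close>
  uniformly and has support in a fixed ball, on which \<open>k\<close> is integrable.
\<close>

lemma conv_has_derivative:
  fixes k :: "real^'n \<Rightarrow> complex"
  assumes k: "\<And>R. integrable lborel (\<lambda>y. indicator (cball 0 R) y *\<^sub>R k y)" and u: "u \<in> test_functions"
  shows "(conv k u has_derivative (\<lambda>h. \<Sum>i\<in>UNIV. of_real (h $ i) * conv k (pdir i u) x)) (at x)"
proof -
  obtain L where L: "L > 0" "\<And>x h. norm (u (x + h) - u x - (\<Sum>i\<in>UNIV. of_real (h $ i) * pdir i u x)) \<le> L * (norm h)\<^sup>2"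
    by (rule test_taylor[OF u]) blast
  obtain R where R: "R > 0" "\<And>y. norm y \<ge> R \<Longrightarrow> u y = 0" by (rule test_functionsE[OF u]) auto
  \<comment> \<open>A ball containing the supports of \<open>u (x + h - _)\<close> for all \<open>\<bar>h\<bar> < 1\<close>.\<close>
  define R' where "R' = norm x + R + 1"
  define I where "I = (\<integral>y. norm (indicator (cball 0 R') y *\<^sub>R k y) \<partial>lborel)"
  show ?thesis
  proof (rule has_derivativeI_sandwich[where e = 1 and H = "\<lambda>y. L * I * norm (y - x)"])
    show "bounded_linear (\<lambda>h. \<Sum>i\<in>UNIV. of_real (h $ i) * conv k (pdir i u) x)"
      by (intro bounded_linear_sum bounded_linear_mult_const bounded_linear_compose[OF bounded_linear_of_real bounded_linear_vec_nth])
    show "((\<lambda>y. L * I * norm (y - x)) \<longlongrightarrow> 0) (at x within UNIV)"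
      by (auto intro!: tendsto_eq_intros)
    fix y assume y: "y \<noteq> x" "dist y x < 1"
    define h where "h = y - x"
    have h: "norm h < 1" "h \<noteq> 0" "y = x + h" using y by (auto simp: h_def dist_norm)
    define r where "r w = u (x + h - w) - u (x - w) - (\<Sum>i\<in>UNIV. of_real (h $ i) * pdir i u (x - w))" for w
    have ci: "integrable lborel (\<lambda>y. k y * u (x - y))" if "u \<in> test_functions" for u x
      by (rule conv_integrable[OF k that])
    have "conv k u y - conv k u x - (\<Sum>i\<in>UNIV. of_real (h $ i) * conv k (pdir i u) x) = (\<integral>w. k w * r w \<partial>lborel)"
    proof -
      have "(\<integral>w. k w * r w \<partial>lborel) = (\<integral>w. (k w * u (x + h - w) - k w * u (x - w)) - (\<Sum>i\<in>UNIV. of_real (h $ i) * (k w * pdir i u (x - w))) \<partial>lborel)"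
        by (intro Bochner_Integration.integral_cong) (auto simp: r_def algebra_simps sum_distrib_left)
      also have "\<dots> = (\<integral>w. k w * u (x + h - w) - k w * u (x - w) \<partial>lborel) - (\<integral>w. (\<Sum>i\<in>UNIV. of_real (h $ i) * (k w * pdir i u (x - w))) \<partial>lborel)"
        by (intro Bochner_Integration.integral_diff Bochner_Integration.integrable_diff Bochner_Integration.integrable_sum integrable_mult_right ci u test_pdir)
      also have "(\<integral>w. k w * u (x + h - w) - k w * u (x - w) \<partial>lborel) = conv k u y - conv k u x"
        unfolding conv_def h(3) by (intro Bochner_Integration.integral_diff ci u)
      also have "(\<integral>w. (\<Sum>i\<in>UNIV. of_real (h $ i) * (k w * pdir i u (x - w))) \<partial>lborel) = (\<Sum>i\<in>UNIV. \<integral>w. of_real (h $ i) * (k w * pdir i u (x - w)) \<partial>lborel)"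
        by (intro Bochner_Integration.integral_sum integrable_mult_right ci u test_pdir)
      finally show ?thesis unfolding conv_def by simp
    qed
    also have "norm \<dots> \<le> (L * (norm h)\<^sup>2) * I" unfolding I_def
    proof (rule locally_integrable_mult(2)[OF k])
      note sm = smooth_continuous[OF test_smooth[OF test_reflect]]
      show "continuous_on UNIV r" unfolding r_def
        by (intro continuous_intros sm u test_pdir)
      show "r w = 0" if "norm w \<ge> R'" for w
      proof -
        have "norm (x - w) \<ge> R + 1" using that norm_triangle_ineq2[of w x] by (simp add: R'_def norm_minus_commute)
        moreover have "norm (x - w) \<le> norm (x + h - w) + norm h" using norm_triangle_ineq4[of "x + h - w" h] by (simp add: algebra_simps)
        ultimately have "u (x + h - w) = 0" "u (x - w) = 0" "pdir i u (x - w) = 0" for i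
          using h R(2) pdir_zero_outside[of R u "x - w" i] by auto
        thus ?thesis by (simp add: r_def)
      qed
      show "norm (r w) \<le> L * (norm h)\<^sup>2" for w using L(2)[of "x - w" h] by (simp add: r_def algebra_simps)
    qed
    finally show "norm (conv k u y - conv k u x - (\<Sum>i\<in>UNIV. of_real ((y - x) $ i) * conv k (pdir i u) x)) / norm (y - x) \<le> L * I * norm (y - x)"
      using h(2) unfolding h_def[symmetric] by (simp add: divide_le_eq power2_eq_square mult_ac)
  qed auto
qed

lemma pdir_conv:
  fixes k :: "real^'n \<Rightarrow> complex"
  assumes k: "\<And>R. integrable lborel (\<lambda>y. indicator (cball 0 R) y *\<^sub>R k y)" and u: "u \<in> test_functions"
  shows "pdir i (conv k u) = conv k (pdir i u)"
proof
  fix x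
  have "(\<Sum>j\<in>UNIV. of_real (axis i (1::real) $ j) * conv k (pdir j u) x) = (\<Sum>j\<in>UNIV. if j = i then conv k (pdir j u) x else 0)"
    by (intro sum.cong) (auto simp: axis_def)
  thus "pdir i (conv k u) x = conv k (pdir i u) x"
    using pdir_eqI[OF conv_has_derivative[OF k u], of i x] by simp
qed

lemma smooth_conv:
  fixes k :: "real^'n \<Rightarrow> complex"
  assumes k: "\<And>R. integrable lborel (\<lambda>y. indicator (cball 0 R) y *\<^sub>R k y)" and u: "u \<in> test_functions"
  shows "smooth (conv k u)"
  by (rule smooth_coinduct[of _ "conv k ` test_functions"])
     (use u conv_has_derivative[OF k] in \<open>auto simp: differentiable_def pdir_conv[OF k] test_pdir\<close>)

lemma partials_conv:
  fixes k :: "real^'n \<Rightarrow> complex"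
  assumes k: "\<And>R. integrable lborel (\<lambda>y. indicator (cball 0 R) y *\<^sub>R k y)" and u: "u \<in> test_functions"
  shows "partials is (conv k u) = conv k (partials is u)"
  by (induction "is") (auto simp: partials_Cons pdir_conv[OF k] test_partials u)

section \<open>Cut-off functions\<close>

text \<open>
  The functions \<open>t\<^sup>-\<^sup>m exp (-1/t)\<close>, among which the derivatives of \<open>exp (-1/t)\<close> stay.
\<close>

definition flat :: "nat \<Rightarrow> real \<Rightarrow> real" where
  "flat m t = (if t > 0 then inverse t ^ m * exp (- inverse t) else 0)"

lemma power_le_fact_exp: "s \<ge> 0 \<Longrightarrow> s ^ n \<le> fact n * exp (s::real)"
proof -
  assume s: "s \<ge> 0"
  have "(\<Sum>k\<in>{n}. s ^ k /\<^sub>R fact k) \<le> (\<Sum>k. s ^ k /\<^sub>R fact k)"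
    by (rule sum_le_suminf[OF summable_exp_generic]) (use s in auto)
  hence "s ^ n / fact n \<le> exp s" by (simp add: exp_def divide_inverse mult.commute)
  thus ?thesis by (simp add: divide_le_eq mult.commute)
qed

text \<open>
  Quadratic vanishing gives the derivative \<open>0\<close> at the origin, where the two branches of the
  definition meet.
\<close>

lemma flat_le: "t > 0 \<Longrightarrow> flat m t \<le> fact (m + 2) * t\<^sup>2"
proof -
  assume t: "t > 0"
  have "inverse t ^ (m + 2) \<le> fact (m + 2) * exp (inverse t)" by (rule power_le_fact_exp) (use t in simp)
  hence "inverse t ^ (m + 2) * exp (- inverse t) \<le> fact (m + 2) * exp (inverse t) * exp (- inverse t)"
    by (rule mult_right_mono) simp
  hence "inverse t ^ (m + 2) * exp (- inverse t) \<le> fact (m + 2)" by (simp only: mult.assoc exp_minus_inverse mult_1_right)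
  hence "inverse t ^ (m + 2) * exp (- inverse t) * t\<^sup>2 \<le> fact (m + 2) * t\<^sup>2" by (rule mult_right_mono) simp
  moreover have "inverse t ^ (m + 2) * exp (- inverse t) * t\<^sup>2 = inverse t ^ m * exp (- inverse t)"
    using t by (simp add: power_add field_simps power2_eq_square)
  ultimately have "inverse t ^ m * exp (- inverse t) \<le> fact (m + 2) * t\<^sup>2" by (simp only:)
  thus ?thesis using t unfolding flat_def by (simp only: if_True)
qed

lemma flat_has_derivative: "(flat m has_real_derivative (flat (m + 2) t - m * flat (m + 1) t)) (at t)"
proof -
  consider "t > 0" | "t < 0" | "t = 0" by linarith
  thus ?thesis
  proof cases
    case 1
    have "((\<lambda>t. inverse t ^ m) has_real_derivative (of_nat m * (- (inverse t ^ Suc (Suc 0)) * inverse t ^ (m - Suc 0)))) (at t)"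
      by (rule DERIV_power[OF DERIV_inverse]) (use 1 in simp)
    also have "of_nat m * (- (inverse t ^ Suc (Suc 0)) * inverse t ^ (m - Suc 0)) = - (of_nat m * inverse t ^ (m + 1))"
      by (cases m) auto
    finally have D1: "((\<lambda>t. inverse t ^ m) has_real_derivative - (of_nat m * inverse t ^ (m + 1))) (at t)" .
    have D2: "((\<lambda>t. exp (- inverse t)) has_real_derivative exp (- inverse t) * inverse t ^ 2) (at t)"
      using 1 by (auto intro!: derivative_eq_intros simp: power2_eq_square)
    have "((\<lambda>t. inverse t ^ m * exp (- inverse t)) has_real_derivative (flat (m + 2) t - m * flat (m + 1) t)) (at t)"
      by (rule DERIV_cong[OF DERIV_mult[OF D1 D2]]) (use 1 in \<open>simp add: flat_def power_add algebra_simps power2_eq_square\<close>)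
    thus ?thesis
      by (rule has_field_derivative_transform_within_open[of _ _ _ "{0<..}"]) (use 1 in \<open>auto simp: flat_def\<close>)
  next
    case 2
    have "((\<lambda>_. 0::real) has_real_derivative (flat (m + 2) t - m * flat (m + 1) t)) (at t)"
      using 2 by (simp add: flat_def)
    thus ?thesis
      by (rule has_field_derivative_transform_within_open[of _ _ _ "{..<0}"]) (use 2 in \<open>auto simp: flat_def\<close>)
  next
    case 3
    \<comment> \<open>The claimed derivative is \<open>0\<close> here; on the right of the origin it comes from the quadratic
      bound, on the left \<open>flat m\<close> vanishes.\<close>
    have "(flat m has_derivative (\<lambda>h. 0)) (at 0)"
    proof (rule has_derivativeI_sandwich[where e = 1 and H = "\<lambda>y. fact (m + 2) * \<bar>y\<bar>"])
      show "((\<lambda>y. fact (m + 2) * \<bar>y\<bar>) \<longlongrightarrow> 0) (at 0 within (UNIV::real set))"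
        by (auto intro!: tendsto_eq_intros)
      fix y :: real assume "y \<noteq> 0"
      show "norm (flat m y - flat m 0 - 0) / norm (y - 0) \<le> fact (m + 2) * \<bar>y\<bar>"
      proof (cases "y > 0")
        case True
        have "flat m y \<ge> 0" by (simp add: flat_def)
        thus ?thesis using flat_le[OF True, of m] True
          by (simp add: flat_def[of m 0] divide_le_eq power2_eq_square mult_ac)
      next
        case False
        have "0 \<le> fact (m + 2) * \<bar>y\<bar>" by (intro mult_nonneg_nonneg) auto
        with False show ?thesis by (simp add: flat_def)
      qed
    qed auto
    thus ?thesis using 3 by (simp add: has_field_derivative_def flat_def lambda_zero)
  qed
qed

definition bumpf :: "nat \<Rightarrow> real^'n \<Rightarrow> complex" where
  "bumpf m x = of_real (flat m (1 - (norm x)\<^sup>2))"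

lemma bumpf_has_derivative:
  "(bumpf m has_derivative (\<lambda>h. of_real (-2 * (x \<bullet> h)) * (bumpf (m + 2) x - of_nat m * bumpf (m + 1) x))) (at x)"
proof -
  let ?t = "1 - (norm x)\<^sup>2"
  have 1: "((\<lambda>x. 1 - x \<bullet> x) has_derivative (\<lambda>h. - (2 * (x \<bullet> h)))) (at x)"
    by (auto intro!: derivative_eq_intros simp: inner_commute)
  have "(flat m has_derivative (\<lambda>h. (flat (m + 2) ?t - m * flat (m + 1) ?t) * h)) (at ?t)"
    using flat_has_derivative[of m ?t] by (simp add: has_field_derivative_def)
  from has_derivative_compose[OF 1, of "flat m", OF this[unfolded power2_norm_eq_inner]]
  have "((\<lambda>x. flat m (1 - x \<bullet> x)) has_derivative (\<lambda>h. (flat (m + 2) ?t - m * flat (m + 1) ?t) * (- (2 * (x \<bullet> h))))) (at x)"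
    by (simp add: power2_norm_eq_inner)
  from has_derivative_of_real[OF this, where 'a = complex]
  show ?thesis unfolding bumpf_def[abs_def] power2_norm_eq_inner
    by (rule has_derivative_eq_rhs) (auto simp: algebra_simps)
qed

lemma smooth_bumpf: "smooth (bumpf m)"
proof (rule smooth_span_smooth[where B = "range bumpf"])
  show "bumpf m \<in> smooth_span (range bumpf)" by (intro smooth_span.base) auto
  fix b :: "real^'n \<Rightarrow> complex" assume "b \<in> range bumpf"
  then obtain q where b: "b = bumpf q" by auto
  show "b differentiable at x" for x unfolding differentiable_def b using bumpf_has_derivative[of q x] by blast
  have 1: "(\<lambda>x::real^'n. c * bumpf r x) \<in> smooth_span (range bumpf)" for c r
    by (rule smooth_span.mult[OF smooth_const smooth_span.base]) auto
  have "pdir i b = (\<lambda>x. (-2 * of_real (x $ i)) * (1 * bumpf (q + 2) x + (- of_nat q) * bumpf (q + 1) x))" for i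
    by (rule ext) (simp add: b pdir_eqI[OF bumpf_has_derivative] inner_axis)
  thus "pdir i b \<in> smooth_span (range bumpf)" for i
    by (simp only:) (intro smooth_span.mult smooth_span.add 1 smooth_mult smooth_const smooth_coord)
qed

text \<open>The factor \<open>exp 1\<close> normalises the value at the origin to \<open>1\<close>.\<close>

definition bump :: "real^'n \<Rightarrow> complex" where
  "bump x = of_real (exp 1) * bumpf 0 x"

lemma bump_test: "bump \<in> test_functions"
proof (rule test_functionsI'[of _ 1])
  show "smooth (bump :: real^'a \<Rightarrow> complex)" unfolding bump_def[abs_def] by (intro smooth_mult smooth_const smooth_bumpf)
  fix x :: "real^'a" assume "norm x \<ge> 1"
  hence "(norm x)\<^sup>2 \<ge> 1" by (rule one_le_power)
  thus "bump x = 0" by (simp add: bump_def bumpf_def flat_def)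
qed

lemma bump_real: "bump x = of_real (exp 1 * flat 0 (1 - (norm x)\<^sup>2))"
  by (simp add: bump_def bumpf_def)

lemma bump_0: "bump 0 = 1"
  by (simp add: bump_def bumpf_def flat_def exp_minus)

lemma flat_le_1: "exp 1 * flat 0 (1 - (norm x)\<^sup>2) \<le> 1" "exp 1 * flat 0 (1 - (norm x)\<^sup>2) \<ge> 0"
proof -
  have "exp 1 * flat 0 (1 - (norm x)\<^sup>2) \<le> exp 1 * exp (- 1)"
  proof (intro mult_left_mono)
    show "flat 0 (1 - (norm x)\<^sup>2) \<le> exp (- 1)"
    proof (cases "1 - (norm x)\<^sup>2 > 0")
      case True
      hence "1 \<le> inverse (1 - (norm x)\<^sup>2)" by (intro one_le_inverse) auto
      thus ?thesis using True by (simp add: flat_def)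
    qed (simp add: flat_def)
  qed auto
  thus "exp 1 * flat 0 (1 - (norm x)\<^sup>2) \<le> 1" by (simp add: exp_minus)
  show "exp 1 * flat 0 (1 - (norm x)\<^sup>2) \<ge> 0" by (simp add: flat_def)
qed

lemma norm_bump_le: "norm (bump x) \<le> 1"
  using flat_le_1[of x] by (simp add: bump_real norm_mult)

lemma bump_pos: "norm x < 1 \<Longrightarrow> exp 1 * flat 0 (1 - (norm x)\<^sup>2) > 0"
  by (simp add: flat_def power_less_one_iff)

lemma bump_outside: "norm x \<ge> 1 \<Longrightarrow> bump x = 0"
proof -
  assume "norm x \<ge> 1"
  hence "(norm x)\<^sup>2 \<ge> 1" by (rule one_le_power)
  thus ?thesis by (simp add: bump_real flat_def)
qed

text \<open>The scale \<open>n + 1\<close> keeps the definition meaningful for \<open>n = 0\<close>.\<close>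

definition cutoff :: "nat \<Rightarrow> real^'n \<Rightarrow> complex" where
  "cutoff n x = bump ((1 / real (Suc n)) *\<^sub>R x)"

lemma cutoff_affine: "cutoff n = (\<lambda>x. bump (0 + (1 / real (Suc n)) *\<^sub>R x))"
  by (auto simp: cutoff_def)

lemma cutoff_test: "cutoff n \<in> test_functions"
  unfolding cutoff_affine by (rule test_affine[OF bump_test]) simp

lemma smooth_cutoff: "smooth (cutoff n)"
  by (rule test_smooth[OF cutoff_test])

lemma norm_cutoff_le: "norm (cutoff n x) \<le> 1"
  by (simp add: cutoff_def norm_bump_le)

lemma cutoff_outside: "norm x \<ge> real (Suc n) \<Longrightarrow> cutoff n x = 0"
  by (simp add: cutoff_def bump_outside divide_simps)

lemma partials_cutoff: "partials is (cutoff n) x = of_real (1 / real (Suc n)) ^ length is * partials is bump ((1 / real (Suc n)) *\<^sub>R x)"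
  unfolding cutoff_affine by (subst partials_affine[OF test_smooth[OF bump_test]]) simp

lemma cutoff_tendsto:
  fixes x :: "real^'n"
  shows "(\<lambda>n. cutoff n x) \<longlonglongrightarrow> 1"
proof -
  have "isCont bump (0::real^'n)"
    using smooth_continuous[OF test_smooth[OF bump_test], of "UNIV :: (real^'n) set"] by (simp add: continuous_on_eq_continuous_at)
  moreover have "(\<lambda>n. (1 / real (Suc n)) *\<^sub>R x) \<longlonglongrightarrow> 0 *\<^sub>R x"
    using LIMSEQ_inverse_real_of_nat by (intro tendsto_intros) (simp add: inverse_eq_divide)
  hence "(\<lambda>n. (1 / real (Suc n)) *\<^sub>R x) \<longlonglongrightarrow> 0" by (simp only: scaleR_zero_left)
  ultimately have "(\<lambda>n. bump ((1 / real (Suc n)) *\<^sub>R x)) \<longlonglongrightarrow> bump (0::real^'n)"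
    by (rule isCont_tendsto_compose)
  thus ?thesis unfolding cutoff_def bump_0 .
qed

text \<open>Every derivative gains a factor \<open>1/(n+1)\<close> from the scaling.\<close>

lemma partials_cutoff_bound:
  fixes x :: "real^'n"
  obtains C where "C > 0" "\<And>n (x::real^'n). norm (partials is (cutoff n) x) \<le> C * (1 / real (Suc n)) ^ length is"
proof -
  obtain C where C: "C > 0" "\<And>x::real^'n. norm (partials is bump x) \<le> C" by (rule test_bounded[OF test_partials[OF bump_test]]) auto
  have "norm (partials is (cutoff n) x) \<le> C * (1 / real (Suc n)) ^ length is" for n and x :: "real^'n"
  proof -
    have "norm (of_real (1 / real (Suc n)) :: complex) = 1 / real (Suc n)" unfolding norm_of_real by simp
    thus ?thesis unfolding partials_cutoff norm_mult norm_power
      using mult_right_mono[OF C(2), of "(1 / real (Suc n)) ^ length is" "(1 / real (Suc n)) *\<^sub>R x"] by (simp only: mult.commute) simp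
  qed
  thus ?thesis using that C(1) by blast
qed

lemma lap_mult:
  assumes "smooth f" "smooth g"
  shows "lap (\<lambda>x. f x * g x) x = f x * lap g x + 2 * (\<Sum>i\<in>UNIV. pdir i f x * pdir i g x) + lap f x * g x"
proof -
  have "partials [i,i] (\<lambda>x. f x * g x) x = f x * partials [i,i] g x + 2 * (pdir i f x * pdir i g x) + partials [i,i] f x * g x" for i
    using assms by (simp add: partials_Cons pdir_smooth_mult pdir_smooth_add smooth_mult smooth_pdir)
  thus ?thesis by (simp add: lap_def sum.distrib sum_distrib_left sum_distrib_right)
qed

section \<open>Convolution with the Yukawa kernel\<close>

lemma yukawa_locally_integrable:
  assumes z: "Re z \<ge> 0"
  shows "integrable lborel (\<lambda>y. indicator (cball 0 R) y *\<^sub>R yukawa z y)"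
proof (rule Bochner_Integration.integrable_bound)
  show "integrable lborel (\<lambda>y::real^3. (1 + \<bar>R\<bar>) ^ 3 * (norm y powr -1 * (1 + norm y) powr -3))"
    by (intro integrable_mult_right powr_integrable) auto
  show "AE y in lborel. norm (indicator (cball 0 R) y *\<^sub>R yukawa z y) \<le> norm ((1 + \<bar>R\<bar>) ^ 3 * (norm y powr -1 * (1 + norm y) powr -3))"
    using AE_lborel_singleton[of "0::real^3"]
  proof eventually_elim
    fix y :: "real^3" assume y: "y \<noteq> 0"
    show "norm (indicator (cball 0 R) y *\<^sub>R yukawa z y) \<le> norm ((1 + \<bar>R\<bar>) ^ 3 * (norm y powr -1 * (1 + norm y) powr -3))"
    proof (cases "norm y \<le> R")
      case True
      have p: "1 + norm y > 0" by (simp add: add_pos_nonneg)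
      have "(1 + norm y) ^ 3 \<le> (1 + \<bar>R\<bar>) ^ 3" using True by (intro power_mono) auto
      hence "1 \<le> (1 + \<bar>R\<bar>) ^ 3 * (1 + norm y) powr -3"
        using p by (simp add: powr_minus powr_numeral divide_simps)
      hence "inverse (norm y) * 1 \<le> inverse (norm y) * ((1 + \<bar>R\<bar>) ^ 3 * (1 + norm y) powr -3)"
        by (rule mult_left_mono) simp
      moreover have "norm (yukawa z y) \<le> inverse (norm y)" using norm_yukawa_le[OF z, of y] by (simp add: inverse_eq_divide)
      ultimately have "norm (yukawa z y) \<le> inverse (norm y) * ((1 + \<bar>R\<bar>) ^ 3 * (1 + norm y) powr -3)"
        by linarith
      also have "\<dots> = (1 + \<bar>R\<bar>) ^ 3 * (norm y powr -1 * (1 + norm y) powr -3)"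
        using y by (simp add: powr_minus mult_ac)
      finally have "norm (yukawa z y) \<le> (1 + \<bar>R\<bar>) ^ 3 * (norm y powr -1 * (1 + norm y) powr -3)" .
      thus ?thesis using True by simp
    qed (simp add: indicator_def)
  qed
  show "(\<lambda>y. indicator (cball 0 R) y *\<^sub>R yukawa z y) \<in> borel_measurable lborel"
    using borel_measurable_scaleR[OF borel_measurable_indicator yukawa_measurable, of "cball 0 R" z] by simp
qed

lemma lap_conv:
  fixes k :: "real^'n \<Rightarrow> complex"
  assumes k: "\<And>R. integrable lborel (\<lambda>y. indicator (cball 0 R) y *\<^sub>R k y)" and u: "u \<in> test_functions"
  shows "lap (conv k u) = conv k (lap u)"
proof
  fix x
  have "conv k (lap u) x = (\<integral>y. (\<Sum>i\<in>UNIV. k y * partials [i,i] u (x - y)) \<partial>lborel)"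
    unfolding conv_def lap_def by (simp add: sum_distrib_left)
  also have "\<dots> = (\<Sum>i\<in>UNIV. conv k (partials [i,i] u) x)" unfolding conv_def
    by (intro Bochner_Integration.integral_sum conv_integrable[OF k] test_partials u)
  finally show "lap (conv k u) x = conv k (lap u) x" by (simp add: lap_def partials_conv[OF k u])
qed

text \<open>The fundamental solution property applied to the reflected translate \<open>y \<mapsto> u (x - y)\<close>.\<close>

lemma conv_yukawa_equation:
  assumes z: "Re z \<ge> 0" and u: "u \<in> test_functions"
  shows "lap (conv (yukawa z) u) x = z\<^sup>2 * conv (yukawa z) u x - of_real Newton_const * u x"
proof -
  note k = yukawa_locally_integrable[OF z]
  define v where "v y = u (x + (-1) *\<^sub>R y)" for y
  have v: "v \<in> test_functions" unfolding v_def by (rule test_affine[OF u]) simp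
  have lv: "lap v y = lap u (x - y)" for y
    unfolding lap_def v_def partials_affine[OF test_smooth[OF u]] by simp
  have "conv (yukawa z) (lap u) x - z\<^sup>2 * conv (yukawa z) u x = (\<integral>y. yukawa z y * lap u (x - y) - z\<^sup>2 * (yukawa z y * u (x - y)) \<partial>lborel)"
    unfolding conv_def integral_mult_right_zero[symmetric]
    by (intro Bochner_Integration.integral_diff[symmetric] integrable_mult_right conv_integrable[OF k] test_lap u)
  also have "\<dots> = (\<integral>y. yukawa z y * (lap v y - z\<^sup>2 * v y) \<partial>lborel)"
    unfolding lv by (simp add: v_def algebra_simps)
  also have "\<dots> = - of_real Newton_const * v 0" by (rule yukawa_fundamental_solution[OF z v])
  finally show ?thesis unfolding lap_conv[OF k u] by (simp add: v_def algebra_simps)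
qed

section \<open>Newtonian potentials and Hardy's inequality\<close>

lemma cutoff_derivative_bounds:
  obtains C where "C > 0"
    "\<And>n i (x::real^'n). norm (pdir i (cutoff n) x) \<le> C * (1 / real (Suc n))"
    "\<And>n (x::real^'n). norm (lap (cutoff n) x) \<le> C * (1 / real (Suc n))"
proof -
  have "\<exists>C. \<forall>i. C i > 0 \<and> (\<forall>n (x::real^'n). norm (pdir i (cutoff n) x) \<le> C i * (1 / real (Suc n)))"
  proof (intro choice allI)
    fix i :: 'n
    obtain C where "C > 0" "\<And>n (x::real^'n). norm (partials [i] (cutoff n) x) \<le> C * (1 / real (Suc n)) ^ length [i]"
      by (rule partials_cutoff_bound[of "[i]"]) blast
    thus "\<exists>C. C > 0 \<and> (\<forall>n (x::real^'n). norm (pdir i (cutoff n) x) \<le> C * (1 / real (Suc n)))"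
      by (auto simp: partials_Cons)
  qed
  then obtain C where C: "\<And>i. C i > 0" "\<And>i n (x::real^'n). norm (pdir i (cutoff n) x) \<le> C i * (1 / real (Suc n))" by blast
  have "\<exists>C. \<forall>i. C i > 0 \<and> (\<forall>n (x::real^'n). norm (partials [i,i] (cutoff n) x) \<le> C i * (1 / real (Suc n)))"
  proof (intro choice allI)
    fix i :: 'n
    obtain C where C: "C > 0" "\<And>n (x::real^'n). norm (partials [i,i] (cutoff n) x) \<le> C * (1 / real (Suc n)) ^ length [i,i]"
      by (rule partials_cutoff_bound[of "[i,i]"]) blast
    have "C * (1 / real (Suc n)) ^ length [i,i] \<le> C * (1 / real (Suc n)) ^ 1" for n
      using C(1) by (intro mult_left_mono power_decreasing) auto
    hence "norm (partials [i,i] (cutoff n) x) \<le> C * (1 / real (Suc n))" for n and x :: "real^'n"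
      using C(2)[of n x] order_trans power_one_right by metis
    thus "\<exists>C. C > 0 \<and> (\<forall>n (x::real^'n). norm (partials [i,i] (cutoff n) x) \<le> C * (1 / real (Suc n)))"
      using C(1) by auto
  qed
  then obtain D where D: "\<And>i. D i > 0" "\<And>i n (x::real^'n). norm (partials [i,i] (cutoff n) x) \<le> D i * (1 / real (Suc n))" by blast
  have sums: "C i \<le> sum C UNIV" "sum D UNIV \<ge> 0" "sum C UNIV > 0" for i
    using C(1) D(1) by (auto intro!: member_le_sum sum_nonneg sum_pos simp: less_imp_le)
  show ?thesis
  proof (rule that)
    show "sum C UNIV + sum D UNIV > 0" using sums by linarith
    show "norm (pdir i (cutoff n) x) \<le> (sum C UNIV + sum D UNIV) * (1 / real (Suc n))" for i n and x :: "real^'n"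
    proof -
      have "C i * (1 / real (Suc n)) \<le> (sum C UNIV + sum D UNIV) * (1 / real (Suc n))"
        using sums(1)[of i] sums(2) by (intro mult_right_mono) auto
      thus ?thesis using C(2)[of i n x] by linarith
    qed
    show "norm (lap (cutoff n) x) \<le> (sum C UNIV + sum D UNIV) * (1 / real (Suc n))" for n and x :: "real^'n"
    proof -
      have "norm (lap (cutoff n) x) \<le> (\<Sum>i\<in>UNIV. norm (partials [i,i] (cutoff n) x))" unfolding lap_def by (rule norm_sum)
      also have "\<dots> \<le> (\<Sum>i\<in>UNIV. D i * (1 / real (Suc n)))" by (intro sum_mono D(2))
      also have "\<dots> = sum D UNIV * (1 / real (Suc n))" by (simp only: sum_distrib_right)
      also have "\<dots> \<le> (sum C UNIV + sum D UNIV) * (1 / real (Suc n))"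
        using sums by (intro mult_right_mono) auto
      finally show ?thesis .
    qed
  qed
qed

lemma LIMSEQ_bounded_by_harmonic:
  fixes f :: "nat \<Rightarrow> complex"
  assumes "\<And>n. norm (f n) \<le> C * (1 / real (Suc n))"
  shows "f \<longlonglongrightarrow> 0"
proof (rule tendsto_norm_zero_cancel, rule tendsto_sandwich[OF _ _ tendsto_const])
  show "(\<lambda>n. C * (1 / real (Suc n))) \<longlonglongrightarrow> 0"
    using tendsto_mult_right_zero[OF LIMSEQ_inverse_real_of_nat, of C] by (simp add: inverse_eq_divide)
qed (use assms in auto)

lemma yukawa_integrable:
  assumes "\<delta> > 0"
  shows "integrable lborel (yukawa (of_real \<delta>))"
proof (rule Bochner_Integration.integrable_bound)
  show "integrable lborel (\<lambda>y::real^3. (6 * exp \<delta> / \<delta> ^ 3) * (norm y powr -1 * (1 + norm y) powr -3))"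
    by (intro integrable_mult_right powr_integrable) auto
  show "AE y in lborel. norm (yukawa (of_real \<delta>) y) \<le> norm ((6 * exp \<delta> / \<delta> ^ 3) * (norm y powr -1 * (1 + norm y) powr -3))"
    using AE_lborel_singleton[of "0::real^3"]
  proof eventually_elim
    fix y :: "real^3" assume y: "y \<noteq> 0"
    have p: "1 + norm y > 0" by (simp add: add_pos_nonneg)
    have "(\<delta> * (1 + norm y)) ^ 3 \<le> fact 3 * exp (\<delta> * (1 + norm y))" by (rule power_le_fact_exp) (use assms in simp)
    also have "\<dots> = 6 * (exp \<delta> * exp (\<delta> * norm y))" by (simp add: fact_numeral distrib_left exp_add)
    finally have "exp (- (\<delta> * norm y)) \<le> (6 * exp \<delta> / \<delta> ^ 3) * inverse ((1 + norm y) ^ 3)"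
      using p assms by (simp add: exp_minus divide_simps power_mult_distrib mult_ac)
    hence "exp (- (\<delta> * norm y)) \<le> (6 * exp \<delta> / \<delta> ^ 3) * (1 + norm y) powr -3"
      using p by (simp add: powr_minus powr_numeral)
    hence "exp (- (\<delta> * norm y)) * inverse (norm y) \<le> (6 * exp \<delta> / \<delta> ^ 3) * (1 + norm y) powr -3 * inverse (norm y)"
      by (rule mult_right_mono) simp
    moreover have "norm (yukawa (of_real \<delta>) y) = exp (- (\<delta> * norm y)) * inverse (norm y)"
      by (simp add: yukawa_def norm_divide norm_mult norm_inverse divide_inverse)
    ultimately show "norm (yukawa (of_real \<delta>) y) \<le> norm ((6 * exp \<delta> / \<delta> ^ 3) * (norm y powr -1 * (1 + norm y) powr -3))"
      using y assms by (simp add: powr_minus mult_ac)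
  qed
qed measurable

text \<open>
  For a positive mass \<open>\<delta>\<close> the kernel is integrable, so functions with bounded derivatives can
  replace compactly supported ones: multiply by cut-offs and pass to the limit by dominated
  convergence.
\<close>

lemma yukawa_fundamental_solution_bounded:
  assumes d: "\<delta> > 0" and w: "smooth w"
    and M: "\<And>x. norm (w x) \<le> M" "\<And>x i. norm (pdir i w x) \<le> M" "\<And>x. norm (lap w x) \<le> M"
  shows "(\<integral>x. yukawa (of_real \<delta>) x * (lap w x - (of_real \<delta>)\<^sup>2 * w x) \<partial>lborel) = - of_real Newton_const * w 0"
proof -
  obtain C where C: "C > 0" "\<And>n i (x::real^3). norm (pdir i (cutoff n) x) \<le> C * (1 / real (Suc n))"
    "\<And>n (x::real^3). norm (lap (cutoff n) x) \<le> C * (1 / real (Suc n))" by (rule cutoff_derivative_bounds) blast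
  have M0: "M \<ge> 0" using M(1)[of 0] norm_ge_zero order_trans by blast
  have C': "C * (1 / real (Suc n)) \<le> C" for n using C(1) by (simp add: divide_le_eq)
  define u where "u n x = cutoff n x * w x" for n x
  have u: "u n \<in> test_functions" for n unfolding u_def by (rule test_mult2[OF cutoff_test w])
  have lu: "lap (u n) x = cutoff n x * lap w x + 2 * (\<Sum>i\<in>UNIV. pdir i (cutoff n) x * pdir i w x) + lap (cutoff n) x * w x" for n x
    unfolding u_def by (rule lap_mult[OF smooth_cutoff w])
  define F where "F n x = yukawa (of_real \<delta>) x * (lap (u n) x - (of_real \<delta>)\<^sup>2 * u n x)" for n x
  have eq: "(\<integral>x. F n x \<partial>lborel) = - of_real Newton_const * u n 0" for n
    unfolding F_def by (rule yukawa_fundamental_solution[OF _ u]) (use d in simp)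
  let ?K = "M + 2 * (3 * (C * M)) + C * M + \<delta>\<^sup>2 * M"
  have "(\<lambda>n. \<integral>x. F n x \<partial>lborel) \<longlonglongrightarrow> (\<integral>x. yukawa (of_real \<delta>) x * (lap w x - (of_real \<delta>)\<^sup>2 * w x) \<partial>lborel)"
  proof (rule integral_dominated_convergence)
    note [measurable] = smooth_measurable[OF w] smooth_measurable[OF smooth_lap[OF w]]
      smooth_measurable[OF test_smooth[OF u]] smooth_measurable[OF smooth_lap[OF test_smooth[OF u]]]
    show "(\<lambda>x. yukawa (of_real \<delta>) x * (lap w x - (of_real \<delta>)\<^sup>2 * w x)) \<in> borel_measurable lborel" by measurable
    show "F n \<in> borel_measurable lborel" for n unfolding F_def by measurable
    show "integrable lborel (\<lambda>x. norm (yukawa (of_real \<delta>) x) * ?K)"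
      by (intro integrable_mult_left integrable_norm yukawa_integrable d)
    show "AE x in lborel. norm (F n x) \<le> norm (yukawa (of_real \<delta>) x) * ?K" for n
    proof (rule AE_I2)
      fix x :: "real^3"
      have 1: "norm (cutoff n x * lap w x) \<le> 1 * M" unfolding norm_mult by (intro mult_mono norm_cutoff_le M) (auto simp: M0)
      have "norm (\<Sum>i\<in>UNIV. pdir i (cutoff n) x * pdir i w x) \<le> (\<Sum>i\<in>(UNIV::3 set). C * M)"
        using C(1) by (intro order_trans[OF norm_sum] sum_mono) (auto simp: norm_mult intro!: mult_mono M order_trans[OF C(2) C'])
      hence 2: "norm (2 * (\<Sum>i\<in>UNIV. pdir i (cutoff n) x * pdir i w x)) \<le> 2 * (3 * (C * M))" by (simp add: norm_mult)
      have 3: "norm (lap (cutoff n) x * w x) \<le> C * M" unfolding norm_mult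
        using C(1) by (intro mult_mono M order_trans[OF C(3) C']) auto
      have "norm (u n x) \<le> 1 * M" unfolding u_def norm_mult by (intro mult_mono norm_cutoff_le M) (auto simp: M0)
      hence 4: "norm ((of_real \<delta>)\<^sup>2 * u n x) \<le> \<delta>\<^sup>2 * M" by (simp add: norm_mult norm_power mult_left_mono)
      have "norm (lap (u n) x - (of_real \<delta>)\<^sup>2 * u n x) \<le> 1 * M + 2 * (3 * (C * M)) + C * M + \<delta>\<^sup>2 * M"
        unfolding lu by (intro norm_triangle_le_diff add_mono norm_triangle_le 1 2 3 4 order_trans[OF norm_triangle_ineq])
      thus "norm (F n x) \<le> norm (yukawa (of_real \<delta>) x) * ?K"
        unfolding F_def norm_mult by (intro mult_left_mono) auto
    qed
    show "AE x in lborel. (\<lambda>n. F n x) \<longlonglongrightarrow> yukawa (of_real \<delta>) x * (lap w x - (of_real \<delta>)\<^sup>2 * w x)"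
    proof (rule AE_I2)
      fix x :: "real^3"
      have 1: "(\<lambda>n. pdir i (cutoff n) x) \<longlonglongrightarrow> 0" for i by (rule LIMSEQ_bounded_by_harmonic[OF C(2)])
      have 2: "(\<lambda>n. lap (cutoff n) x) \<longlonglongrightarrow> 0" by (rule LIMSEQ_bounded_by_harmonic[OF C(3)])
      have "(\<lambda>n. F n x) \<longlonglongrightarrow> yukawa (of_real \<delta>) x * (1 * lap w x + 2 * (\<Sum>i\<in>UNIV. 0 * pdir i w x) + 0 * w x - (of_real \<delta>)\<^sup>2 * (1 * w x))"
        unfolding F_def lu u_def by (intro tendsto_intros 1 2 cutoff_tendsto)
      thus "(\<lambda>n. F n x) \<longlonglongrightarrow> yukawa (of_real \<delta>) x * (lap w x - (of_real \<delta>)\<^sup>2 * w x)" by simp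
    qed
  qed
  moreover have "(\<lambda>n. - of_real Newton_const * u n 0) \<longlonglongrightarrow> - of_real Newton_const * (1 * w 0)"
    unfolding u_def by (intro tendsto_intros cutoff_tendsto)
  ultimately show ?thesis unfolding eq using LIMSEQ_unique by fastforce
qed

lemma reg_kernel_0: "reg_kernel \<epsilon> 0 p x = of_real (reg_norm \<epsilon> x powr p)"
  by (simp add: reg_kernel_def)

lemma reg_norm_ge_eps: "\<epsilon> > 0 \<Longrightarrow> \<epsilon> \<le> reg_norm \<epsilon> x"
  unfolding reg_norm_def by (rule real_le_rsqrt) simp

text \<open>
  With \<open>s = \<bar>x - y\<bar>\<^sup>2 + \<epsilon>\<^sup>2\<close>, the function \<open>s powr (-1/4)\<close> satisfies \<open>-\<Delta> w \<ge> 1/4 * s powr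
  (-5/4)\<close>. Representing \<open>w\<close> by the kernel of mass \<open>\<epsilon>\<close> and dropping nonnegative terms gives the
  bound. The mass makes the kernel integrable, so that boundedness of \<open>w\<close> and its derivatives
  suffices; it tends to zero together with the regularisation.
\<close>

lemma regularized_superharmonic_bound:
  assumes e: "\<epsilon> > 0"
  shows "(\<integral>\<^sup>+y. ennreal (exp (- \<epsilon> * norm y) / norm y * (1/4 * reg_norm \<epsilon> (x - y) powr -(5/2))) \<partial>lborel)
    \<le> ennreal (Newton_const * reg_norm \<epsilon> x powr -(1/2))"
proof -
  define w where "w y = reg_kernel \<epsilon> 0 (-1/2) (x + (-1) *\<^sub>R y)" for y
  have sm: "smooth (reg_kernel \<epsilon> 0 p)" for p by (rule smooth_reg_kernel[OF e])
  have w: "smooth w" unfolding w_def by (rule smooth_affine[OF sm])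
  let ?r = "\<lambda>y. reg_norm \<epsilon> (x - y)"
  have rp: "?r y > 0" for y by (rule reg_norm_pos[OF e])
  have w0: "w y = of_real (?r y powr (-1/2))" for y by (simp add: w_def reg_kernel_0)
  have w2: "lap w y = - of_real (1/4 * ?r y powr -(5/2) + 5/4 * \<epsilon>\<^sup>2 * ?r y powr -(9/2))" for y
  proof -
    have "lap w y = lap (reg_kernel \<epsilon> 0 (-1/2)) (x - y)"
      unfolding lap_def w_def partials_affine[OF sm] by simp
    thus ?thesis by (simp add: lap_reg_kernel[OF e] reg_kernel_0 algebra_simps)
  qed
  have w1: "pdir i w y = of_real (1/2 * (x - y) $ i * ?r y powr -(5/2))" for i y
  proof -
    have "pdir i w y = - pdir i (reg_kernel \<epsilon> 0 (-1/2)) (x - y)"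
      using partials_affine[OF sm, of "[i]" "-1/2" x "-1"] by (simp add: partials_Cons w_def[abs_def])
    thus ?thesis by (simp add: pdir_reg_kernel[OF e] reg_kernel_0)
  qed
  have mono: "?r y powr - p \<le> \<epsilon> powr - p" if "p \<ge> 0" for y p
    using that e by (intro powr_mono2' reg_norm_ge_eps) auto
  define M where "M = \<epsilon> powr -(1/2) + \<epsilon> powr -(3/2) + 1/4 * \<epsilon> powr -(5/2) + 5/4 * \<epsilon>\<^sup>2 * \<epsilon> powr -(9/2)"
  have pos: "\<epsilon> powr p \<ge> 0" "\<epsilon>\<^sup>2 * \<epsilon> powr p \<ge> 0" for p by auto
  have fs: "(\<integral>y. yukawa (of_real \<epsilon>) y * (lap w y - (of_real \<epsilon>)\<^sup>2 * w y) \<partial>lborel) = - of_real Newton_const * w 0"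
  proof (rule yukawa_fundamental_solution_bounded[OF e w, of M])
    show "norm (w y) \<le> M" for y
    proof -
      have "norm (w y) = ?r y powr -(1/2)" by (simp add: w0)
      thus ?thesis unfolding M_def using mono[of "1/2" y] pos(1)[of "-(3/2)"] pos(1)[of "-(5/2)"] pos(2)[of "-(9/2)"] by linarith
    qed
    show "norm (lap w y) \<le> M" for y
    proof -
      have "\<epsilon>\<^sup>2 * ?r y powr -(9/2) \<le> \<epsilon>\<^sup>2 * \<epsilon> powr -(9/2)" by (intro mult_left_mono mono) auto
      moreover have "norm (lap w y) = 1/4 * ?r y powr -(5/2) + 5/4 * \<epsilon>\<^sup>2 * ?r y powr -(9/2)"
        unfolding w2 norm_minus_cancel norm_of_real by (intro abs_of_nonneg add_nonneg_nonneg) auto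
      ultimately show ?thesis
        unfolding M_def using mono[of "5/2" y] pos(1)[of "-(1/2)"] pos(1)[of "-(3/2)"] by linarith
    qed
    show "norm (pdir i w y) \<le> M" for y i
    proof -
      have "\<bar>(x - y) $ i\<bar> \<le> ?r y" using component_le_norm_cart[of "x - y" i] reg_norm_ge_norm[of "x - y" \<epsilon>] by linarith
      hence "\<bar>(x - y) $ i\<bar> * ?r y powr -(5/2) \<le> ?r y * ?r y powr -(5/2)" by (rule mult_right_mono) simp
      also have "?r y * ?r y powr -(5/2) = ?r y powr -(3/2)" using powr_add[of "?r y" 1 "-(5/2)"] rp[of y] by simp
      finally have "\<bar>(x - y) $ i\<bar> * ?r y powr -(5/2) \<le> \<epsilon> powr -(3/2)" using mono[of "3/2" y] by simp
      moreover have "norm (pdir i w y) = 1/2 * (\<bar>(x - y) $ i\<bar> * ?r y powr -(5/2))"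
        unfolding w1 norm_of_real abs_mult by simp
      ultimately show ?thesis unfolding M_def using pos(1)[of "-(1/2)"] pos(1)[of "-(3/2)"] pos(1)[of "-(5/2)"] pos(2)[of "-(9/2)"] by linarith
    qed
  qed
  define G where "G y = exp (- \<epsilon> * norm y) / norm y * (1/4 * ?r y powr -(5/2) + 5/4 * \<epsilon>\<^sup>2 * ?r y powr -(9/2) + \<epsilon>\<^sup>2 * ?r y powr (-1/2))" for y
  have Geq: "yukawa (of_real \<epsilon>) y * (lap w y - (of_real \<epsilon>)\<^sup>2 * w y) = - of_real (G y)" for y
  proof -
    have "yukawa (of_real \<epsilon>) y = of_real (exp (- \<epsilon> * norm y) / norm y)" by (simp add: yukawa_def exp_of_real[symmetric])
    thus ?thesis unfolding w2 w0 G_def by (simp add: algebra_simps)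
  qed
  have G0: "G y \<ge> 0" for y unfolding G_def using pos e by (intro mult_nonneg_nonneg add_nonneg_nonneg) auto
  have Gi: "integrable lborel G"
  proof (rule Bochner_Integration.integrable_bound)
    show "integrable lborel (\<lambda>y. (M + \<epsilon>\<^sup>2 * M) *\<^sub>R yukawa (of_real \<epsilon>) y)" by (intro integrable_scaleR_right yukawa_integrable e)
    have [measurable]: "(\<lambda>y. reg_norm \<epsilon> (x - y)) \<in> borel_measurable borel" by measurable
    show "G \<in> borel_measurable lborel" unfolding G_def by measurable
    show "AE y in lborel. norm (G y) \<le> norm ((M + \<epsilon>\<^sup>2 * M) *\<^sub>R yukawa (of_real \<epsilon>) y)"
    proof (rule AE_I2)
      fix y
      have k: "norm (yukawa (of_real \<epsilon>) y) = exp (- \<epsilon> * norm y) / norm y"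
        by (simp add: yukawa_def norm_divide)
      have "\<epsilon>\<^sup>2 * ?r y powr -(9/2) \<le> \<epsilon>\<^sup>2 * \<epsilon> powr -(9/2)" by (intro mult_left_mono mono) auto
      hence a: "1/4 * ?r y powr -(5/2) + 5/4 * \<epsilon>\<^sup>2 * ?r y powr -(9/2) \<le> M"
        unfolding M_def using mono[of "5/2" y] pos(1)[of "-(1/2)"] pos(1)[of "-(3/2)"] by linarith
      have "?r y powr (-1/2) = ?r y powr -(1/2)" by simp
      hence "?r y powr (-1/2) \<le> M"
        unfolding M_def using mono[of "1/2" y] pos(1)[of "-(3/2)"] pos(1)[of "-(5/2)"] pos(2)[of "-(9/2)"] by linarith
      hence b: "\<epsilon>\<^sup>2 * ?r y powr (-1/2) \<le> \<epsilon>\<^sup>2 * M" by (intro mult_left_mono) auto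
      have M0: "M \<ge> 0" unfolding M_def using e by (intro add_nonneg_nonneg) auto
      have "G y \<le> exp (- \<epsilon> * norm y) / norm y * (M + \<epsilon>\<^sup>2 * M)"
        unfolding G_def by (intro mult_left_mono add_mono[OF a b]) auto
      thus "norm (G y) \<le> norm ((M + \<epsilon>\<^sup>2 * M) *\<^sub>R yukawa (of_real \<epsilon>) y)"
        using G0[of y] M0 unfolding norm_scaleR k by (simp add: mult.commute)
    qed
  qed
  have "- of_real (\<integral>y. G y \<partial>lborel) = - of_real Newton_const * w 0"
    using fs unfolding Geq by (simp add: integral_complex_of_real)
  hence "of_real (\<integral>y. G y \<partial>lborel) = (of_real (Newton_const * reg_norm \<epsilon> x powr (-1/2)) :: complex)"
    by (simp add: w0)
  hence Gint: "(\<integral>y. G y \<partial>lborel) = Newton_const * reg_norm \<epsilon> x powr (-1/2)" by (simp only: of_real_eq_iff)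
  have "(\<integral>\<^sup>+y. ennreal (exp (- \<epsilon> * norm y) / norm y * (1/4 * reg_norm \<epsilon> (x - y) powr -(5/2))) \<partial>lborel) \<le> (\<integral>\<^sup>+y. ennreal (G y) \<partial>lborel)"
    unfolding G_def using e by (intro nn_integral_mono ennreal_leI mult_left_mono) auto
  also have "\<dots> = ennreal (\<integral>y. G y \<partial>lborel)" by (rule nn_integral_eq_integral[OF Gi]) (use G0 in auto)
  finally show ?thesis unfolding Gint by simp
qed

lemma nn_integral_reflect:
  fixes f :: "'a::euclidean_space \<Rightarrow> ennreal"
  assumes "f \<in> borel_measurable borel"
  shows "(\<integral>\<^sup>+y. f (x - y) \<partial>lborel) = (\<integral>\<^sup>+y. f y \<partial>lborel)"
  using nn_integral_lborel_affine[of "-1" f x] assms by simp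

text \<open>
  This expresses that \<open>4 \<bar>x\<bar> powr (-1/2)\<close> solves \<open>-\<Delta> u = \<bar>x\<bar> powr (-5/2)\<close>. Fatou's lemma in
  the regularised bound yields the inequality, which is the direction that is needed.
\<close>

lemma Newton_potential_power:
  assumes x: "x \<noteq> (0::real^3)"
  shows "(\<integral>\<^sup>+y. ennreal (norm y powr -(5/2) / norm (x - y)) \<partial>lborel) \<le> ennreal (4 * Newton_const * norm x powr -(1/2))"
proof -
  define h where "h n = 1 / real (Suc n)" for n
  have h: "h n > 0" for n by (auto simp: h_def)
  have h0: "h \<longlonglongrightarrow> 0" using LIMSEQ_inverse_real_of_nat by (simp add: h_def[abs_def] inverse_eq_divide)
  define F where "F n y = ennreal (exp (- h n * norm y) / norm y * (1/4 * reg_norm (h n) (x - y) powr -(5/2)))" for n y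
  have [measurable]: "(\<lambda>y. reg_norm (h n) (x - y)) \<in> borel_measurable borel" for n by measurable
  have Fm [measurable]: "F n \<in> borel_measurable borel" for n unfolding F_def by measurable
  have "(\<integral>\<^sup>+y. ennreal (1/4 * (norm (x - y) powr -(5/2) / norm y)) \<partial>lborel) = (\<integral>\<^sup>+y. liminf (\<lambda>n. F n y) \<partial>lborel)"
  proof (rule nn_integral_cong_AE)
    show "AE y in lborel. ennreal (1/4 * (norm (x - y) powr -(5/2) / norm y)) = liminf (\<lambda>n. F n y)"
      using AE_lborel_singleton[of "0::real^3"] AE_lborel_singleton[of x]
    proof eventually_elim
      fix y assume y: "y \<noteq> 0" "y \<noteq> x"
      have "(\<lambda>n. F n y) \<longlonglongrightarrow> ennreal (exp (- 0 * norm y) / norm y * (1/4 * norm (x - y) powr -(5/2)))"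
        unfolding F_def h_def using y
        by (intro tendsto_ennrealI tendsto_intros reg_norm_tendsto h0[unfolded h_def]) auto
      hence "liminf (\<lambda>n. F n y) = ennreal (exp (- 0 * norm y) / norm y * (1/4 * norm (x - y) powr -(5/2)))"
        by (intro lim_imp_Liminf) auto
      thus "ennreal (1/4 * (norm (x - y) powr -(5/2) / norm y)) = liminf (\<lambda>n. F n y)" by (simp add: mult_ac)
    qed
  qed
  also have "\<dots> \<le> liminf (\<lambda>n. \<integral>\<^sup>+y. F n y \<partial>lborel)" by (rule nn_integral_liminf) measurable
  also have "\<dots> \<le> liminf (\<lambda>n. ennreal (Newton_const * norm x powr -(1/2)))"
  proof (intro Liminf_mono always_eventually allI)
    fix n
    have "(\<integral>\<^sup>+y. F n y \<partial>lborel) \<le> ennreal (Newton_const * reg_norm (h n) x powr -(1/2))"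
      unfolding F_def by (rule regularized_superharmonic_bound[OF h])
    also have "\<dots> \<le> ennreal (Newton_const * norm x powr -(1/2))"
      using x Newton_const_pos by (intro ennreal_leI mult_left_mono powr_mono2' reg_norm_ge_norm) auto
    finally show "(\<integral>\<^sup>+y. F n y \<partial>lborel) \<le> ennreal (Newton_const * norm x powr -(1/2))" .
  qed
  also have "\<dots> = ennreal (Newton_const * norm x powr -(1/2))" by (simp add: Liminf_const)
  finally have le: "(\<integral>\<^sup>+y. ennreal (1/4 * (norm (x - y) powr -(5/2) / norm y)) \<partial>lborel) \<le> ennreal (Newton_const * norm x powr -(1/2))" .
  have "(\<integral>\<^sup>+y. ennreal (norm y powr -(5/2) / norm (x - y)) \<partial>lborel) = (\<integral>\<^sup>+y. ennreal (norm (x - y) powr -(5/2) / norm (x - (x - y))) \<partial>lborel)"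
    by (rule nn_integral_reflect[symmetric]) measurable
  also have "\<dots> = (\<integral>\<^sup>+y. ennreal 4 * ennreal (1/4 * (norm (x - y) powr -(5/2) / norm y)) \<partial>lborel)"
    by (intro nn_integral_cong, subst ennreal_mult[symmetric]) auto
  also have "\<dots> = ennreal 4 * (\<integral>\<^sup>+y. ennreal (1/4 * (norm (x - y) powr -(5/2) / norm y)) \<partial>lborel)"
    by (rule nn_integral_cmult) measurable
  also have "\<dots> \<le> ennreal 4 * ennreal (Newton_const * norm x powr -(1/2))" by (intro mult_left_mono le) auto
  also have "\<dots> = ennreal (4 * Newton_const * norm x powr -(1/2))"
    using Newton_const_pos by (subst ennreal_mult[symmetric]) (auto simp: mult_ac)
  finally show ?thesis .
qed

text \<open>
  The inequality of arithmetic and geometric means with ratio \<open>q = (a/b) powr (5/2)\<close>, the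
  Schur weight for the kernel \<open>1/(\<bar>x\<bar> \<bar>x-y\<bar> \<bar>y\<bar>)\<close>.
\<close>

lemma Schur_pointwise:
  assumes "a > 0" "b > 0" "d \<ge> 0"
  shows "s * t / d \<le> 1/2 * (s\<^sup>2 * a powr (5/2)) * (b powr -(5/2) / d) + 1/2 * (t\<^sup>2 * b powr (5/2)) * (a powr -(5/2) / (d::real))"
proof -
  define q where "q = a powr (5/2) * b powr -(5/2)"
  have q: "q > 0" using assms by (simp add: q_def)
  have iq: "1 / q = b powr (5/2) * a powr -(5/2)" using assms by (simp add: q_def powr_minus field_simps)
  have "0 \<le> (s * sqrt q - t / sqrt q)\<^sup>2" by simp
  also have "\<dots> = s\<^sup>2 * q + t\<^sup>2 * (1 / q) - 2 * (s * t)" using q by (simp add: power2_diff power_mult_distrib power_divide)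
  finally have "s * t \<le> 1/2 * (s\<^sup>2 * q) + 1/2 * (t\<^sup>2 * (1 / q))" by simp
  hence "s * t / d \<le> (1/2 * (s\<^sup>2 * q) + 1/2 * (t\<^sup>2 * (1 / q))) / d" using assms(3) by (rule divide_right_mono)
  also have "\<dots> = 1/2 * (s\<^sup>2 * a powr (5/2)) * (b powr -(5/2) / d) + 1/2 * (t\<^sup>2 * b powr (5/2)) * (a powr -(5/2) / d)"
    unfolding iq by (simp add: q_def add_divide_distrib mult_ac)
  finally show ?thesis .
qed

lemma Schur_test_one_sided:
  fixes f :: "real^3 \<Rightarrow> real"
  assumes [measurable]: "f \<in> borel_measurable borel"
  shows "(\<integral>\<^sup>+x. \<integral>\<^sup>+y. ennreal (1/2 * ((f x)\<^sup>2 * norm x powr (5/2)) * (norm y powr -(5/2) / norm (x - y))) \<partial>lborel \<partial>lborel)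
     \<le> ennreal (2 * Newton_const) * (\<integral>\<^sup>+x. ennreal ((f x)\<^sup>2 * (norm x)\<^sup>2) \<partial>lborel)"
proof -
  have "(\<integral>\<^sup>+x. \<integral>\<^sup>+y. ennreal (1/2 * ((f x)\<^sup>2 * norm x powr (5/2)) * (norm y powr -(5/2) / norm (x - y))) \<partial>lborel \<partial>lborel)
     \<le> (\<integral>\<^sup>+x. ennreal (2 * Newton_const) * ennreal ((f x)\<^sup>2 * (norm x)\<^sup>2) \<partial>lborel)"
  proof (rule nn_integral_mono_AE)
    show "AE x in lborel. (\<integral>\<^sup>+y. ennreal (1/2 * ((f x)\<^sup>2 * norm x powr (5/2)) * (norm y powr -(5/2) / norm (x - y))) \<partial>lborel)
        \<le> ennreal (2 * Newton_const) * ennreal ((f x)\<^sup>2 * (norm x)\<^sup>2)"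
      using AE_lborel_singleton[of "0::real^3"]
    proof eventually_elim
      fix x :: "real^3" assume x: "x \<noteq> 0"
      have "(\<integral>\<^sup>+y. ennreal (1/2 * ((f x)\<^sup>2 * norm x powr (5/2)) * (norm y powr -(5/2) / norm (x - y))) \<partial>lborel)
        = (\<integral>\<^sup>+y. ennreal (1/2 * ((f x)\<^sup>2 * norm x powr (5/2))) * ennreal (norm y powr -(5/2) / norm (x - y)) \<partial>lborel)"
        by (intro nn_integral_cong ennreal_mult) auto
      also have "\<dots> = ennreal (1/2 * ((f x)\<^sup>2 * norm x powr (5/2))) * (\<integral>\<^sup>+y. ennreal (norm y powr -(5/2) / norm (x - y)) \<partial>lborel)"
        by (rule nn_integral_cmult) measurable
      also have "\<dots> \<le> ennreal (1/2 * ((f x)\<^sup>2 * norm x powr (5/2))) * ennreal (4 * Newton_const * norm x powr -(1/2))"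
        by (intro mult_left_mono Newton_potential_power x) auto
      also have "\<dots> = ennreal (1/2 * ((f x)\<^sup>2 * norm x powr (5/2)) * (4 * Newton_const * norm x powr -(1/2)))"
        using Newton_const_pos by (intro ennreal_mult[symmetric]) auto
      also have "1/2 * ((f x)\<^sup>2 * norm x powr (5/2)) * (4 * Newton_const * norm x powr -(1/2)) = 2 * Newton_const * ((f x)\<^sup>2 * (norm x powr (5/2) * norm x powr -(1/2)))"
        by simp
      also have "norm x powr (5/2) * norm x powr -(1/2) = (norm x)\<^sup>2"
        using x by (subst powr_add[symmetric]) (simp add: powr_numeral)
      also have "ennreal (2 * Newton_const * ((f x)\<^sup>2 * (norm x)\<^sup>2)) = ennreal (2 * Newton_const) * ennreal ((f x)\<^sup>2 * (norm x)\<^sup>2)"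
        using Newton_const_pos by (intro ennreal_mult) auto
      finally show "(\<integral>\<^sup>+y. ennreal (1/2 * ((f x)\<^sup>2 * norm x powr (5/2)) * (norm y powr -(5/2) / norm (x - y))) \<partial>lborel)
        \<le> ennreal (2 * Newton_const) * ennreal ((f x)\<^sup>2 * (norm x)\<^sup>2)" .
    qed
  qed
  also have "\<dots> = ennreal (2 * Newton_const) * (\<integral>\<^sup>+x. ennreal ((f x)\<^sup>2 * (norm x)\<^sup>2) \<partial>lborel)"
    by (rule nn_integral_cmult) measurable
  finally show ?thesis .
qed

text \<open>
  Hardy's inequality in dual form: the kernel \<open>1/(\<bar>x\<bar> \<bar>x-y\<bar> \<bar>y\<bar>)\<close> is bounded on \<open>L\<^sup>2\<close> by \<open>4\<close>
  times \<open>Newton_const\<close>. By \<open>Newton_potential_power\<close> it maps the positive function \<open>\<bar>x\<bar> powr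
  (-3/2)\<close> to at most that constant times itself, which is the hypothesis of the Schur test.
  The constant \<open>2\<close> is \<open>4 * 1/2\<close>, the half coming from the two squares.
\<close>

lemma Hardy_bilinear:
  fixes f g :: "real^3 \<Rightarrow> real"
  assumes [measurable]: "f \<in> borel_measurable borel" "g \<in> borel_measurable borel"
  shows "(\<integral>\<^sup>+x. \<integral>\<^sup>+y. ennreal (f x * g y / norm (x - y)) \<partial>lborel \<partial>lborel)
     \<le> ennreal (2 * Newton_const) * ((\<integral>\<^sup>+x. ennreal ((f x)\<^sup>2 * (norm x)\<^sup>2) \<partial>lborel) + (\<integral>\<^sup>+y. ennreal ((g y)\<^sup>2 * (norm y)\<^sup>2) \<partial>lborel))"
proof -
  define P where "P h x y = ennreal (1/2 * ((h x)\<^sup>2 * norm x powr (5/2)) * (norm y powr -(5/2) / norm (x - y)))" for h :: "real^3 \<Rightarrow> real" and x y :: "real^3"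
  have [measurable]: "(\<lambda>z. P h (fst z) (snd z)) \<in> borel_measurable (lborel \<Otimes>\<^sub>M lborel)" if [measurable]: "h \<in> borel_measurable borel" for h
    unfolding P_def by measurable
  have Pm [measurable]: "(\<lambda>(x, y). P g y x) \<in> borel_measurable (lborel \<Otimes>\<^sub>M lborel)"  "(\<lambda>y. P f x y) \<in> borel_measurable lborel"
     "(\<lambda>y. P g y x) \<in> borel_measurable lborel" "(\<lambda>(x, y). P f x y) \<in> borel_measurable (lborel \<Otimes>\<^sub>M lborel)" for x
    unfolding P_def by measurable
  have "(\<integral>\<^sup>+x. \<integral>\<^sup>+y. ennreal (f x * g y / norm (x - y)) \<partial>lborel \<partial>lborel) \<le> (\<integral>\<^sup>+x. \<integral>\<^sup>+y. P f x y + P g y x \<partial>lborel \<partial>lborel)"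
  proof (rule nn_integral_mono_AE)
    show "AE x in lborel. (\<integral>\<^sup>+y. ennreal (f x * g y / norm (x - y)) \<partial>lborel) \<le> (\<integral>\<^sup>+y. P f x y + P g y x \<partial>lborel)"
      using AE_lborel_singleton[of "0::real^3"]
    proof eventually_elim
      fix x :: "real^3" assume x: "x \<noteq> 0"
      show "(\<integral>\<^sup>+y. ennreal (f x * g y / norm (x - y)) \<partial>lborel) \<le> (\<integral>\<^sup>+y. P f x y + P g y x \<partial>lborel)"
      proof (rule nn_integral_mono_AE)
        show "AE y in lborel. ennreal (f x * g y / norm (x - y)) \<le> P f x y + P g y x"
          using AE_lborel_singleton[of "0::real^3"]
        proof eventually_elim
          fix y :: "real^3" assume y: "y \<noteq> 0"
          show "ennreal (f x * g y / norm (x - y)) \<le> P f x y + P g y x"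
            using Schur_pointwise[of "norm x" "norm y" "norm (x - y)" "f x" "g y"] x y
            by (simp add: P_def norm_minus_commute[of y x] flip: ennreal_plus)
        qed
      qed
    qed
  qed
  also have "\<dots> = (\<integral>\<^sup>+x. \<integral>\<^sup>+y. P f x y \<partial>lborel \<partial>lborel) + (\<integral>\<^sup>+x. \<integral>\<^sup>+y. P g y x \<partial>lborel \<partial>lborel)"
    using lborel.borel_measurable_nn_integral[OF Pm(1)] lborel.borel_measurable_nn_integral[OF Pm(4)] Pm(2,3)
    by (simp add: nn_integral_add)
  also have "(\<integral>\<^sup>+x. \<integral>\<^sup>+y. P g y x \<partial>lborel \<partial>lborel) = (\<integral>\<^sup>+x. \<integral>\<^sup>+y. P g x y \<partial>lborel \<partial>lborel)"
    using lborel_pair.Fubini'[OF Pm(1)] by simp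
  also have "(\<integral>\<^sup>+x. \<integral>\<^sup>+y. P f x y \<partial>lborel \<partial>lborel) + (\<integral>\<^sup>+x. \<integral>\<^sup>+y. P g x y \<partial>lborel \<partial>lborel) \<le>
     ennreal (2 * Newton_const) * (\<integral>\<^sup>+x. ennreal ((f x)\<^sup>2 * (norm x)\<^sup>2) \<partial>lborel) + ennreal (2 * Newton_const) * (\<integral>\<^sup>+x. ennreal ((g x)\<^sup>2 * (norm x)\<^sup>2) \<partial>lborel)"
    unfolding P_def by (intro add_mono Schur_test_one_sided) auto
  finally show ?thesis by (simp add: distrib_left)
qed

section \<open>Decay of Yukawa potentials and truncation errors\<close>

lemma norm_conv_yukawa_le:
  assumes z: "Re z \<ge> 0" and u: "u \<in> test_functions"
  shows "ennreal (norm (conv (yukawa z) u x)) \<le> (\<integral>\<^sup>+y. ennreal (norm (yukawa z (x - y)) * norm (u y)) \<partial>lborel)"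
proof -
  have [measurable]: "u \<in> borel_measurable borel" by (rule smooth_measurable[OF test_smooth[OF u]])
  have "ennreal (norm (conv (yukawa z) u x)) \<le> (\<integral>\<^sup>+y. ennreal (norm (yukawa z y * u (x - y))) \<partial>lborel)"
    unfolding conv_def by (rule integral_norm_bound_ennreal[OF conv_integrable[OF yukawa_locally_integrable[OF z] u]])
  also have "\<dots> = (\<integral>\<^sup>+y. ennreal (norm (yukawa z (x - (x - y))) * norm (u (x - y))) \<partial>lborel)"
    by (simp add: norm_mult)
  also have "\<dots> = (\<integral>\<^sup>+y. ennreal (norm (yukawa z (x - y)) * norm (u y)) \<partial>lborel)"
    by (rule nn_integral_reflect) measurable
  finally show ?thesis .
qed

lemma norm_conv_yukawa_le_Newton_potential:
  assumes z: "Re z \<ge> 0" and u: "u \<in> test_functions"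
  shows "ennreal (norm (conv (yukawa z) u x)) \<le> (\<integral>\<^sup>+y. ennreal (norm (u y) / norm (x - y)) \<partial>lborel)"
proof -
  have "norm (yukawa z (x - y)) * norm (u y) \<le> norm (u y) / norm (x - y)" for y
    using mult_right_mono[OF norm_yukawa_le[OF z], of "norm (u y)" "x - y"] by simp
  thus ?thesis by (intro order_trans[OF norm_conv_yukawa_le[OF z u]] nn_integral_mono ennreal_leI)
qed

text \<open>
  Split the weight by \<open>1 + \<bar>x\<bar> \<le> (1 + \<bar>x-y\<bar>) + \<bar>y\<bar>\<close>: the first part is absorbed by the decay
  of \<open>u\<close>, the second cancels the singularity \<open>1/\<bar>y\<bar>\<close> of the kernel.
\<close>

lemma conv_yukawa_decay:
  assumes z: "Re z \<ge> 0" and u: "u \<in> test_functions"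
  obtains C where "C > 0" "\<And>x. norm (conv (yukawa z) u x) \<le> C / (1 + norm x)"
proof -
  have [measurable]: "u \<in> borel_measurable borel" by (rule smooth_measurable[OF test_smooth[OF u]])
  obtain C where C: "C > 0" "\<And>x. norm (u x) \<le> C * (1 + norm x) powr -5" by (rule test_decay[OF u, of 5]) auto
  define I where "I = (\<integral>y. (1 + norm (y::real^3)) powr -4 \<partial>lborel)"
  define K where "K = (\<integral>y. norm (y::real^3) powr -1 * (1 + norm y) powr -3 \<partial>lborel)"
  have Ii: "integrable lborel (\<lambda>y::real^3. (1 + norm (x - y)) powr -4)" "(\<integral>y. (1 + norm (x - y)) powr -4 \<partial>lborel) = I" for x
    using lborel_integral_affine[of "-1" "\<lambda>y::real^3. (1 + norm y) powr -4" x] integrable_japanese[of 4] by (auto simp: I_def)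
  have Ki: "integrable lborel (\<lambda>y::real^3. norm (y::real^3) powr -1 * (1 + norm y) powr -3)" by (rule powr_integrable) auto
  have I0: "I \<ge> 0" "K \<ge> 0" unfolding I_def K_def by (auto intro!: integral_nonneg_AE)
  define D where "D = 2 * C * I + 8 * C * K + 1"
  show ?thesis
  proof (rule that)
    show "D > 0" using I0 C(1) by (simp add: D_def add_nonneg_pos)
    fix x :: "real^3"
    have px: "1 + norm x > 0" by (simp add: add_pos_nonneg)
    have "(1 + norm x) * norm (conv (yukawa z) u x) = norm (\<integral>y. of_real (1 + norm x) * (yukawa z y * u (x - y)) \<partial>lborel)"
      unfolding conv_def integral_mult_right_zero norm_mult using px by (simp only: norm_of_real abs_of_pos)
    also have "\<dots> \<le> (\<integral>y. norm (of_real (1 + norm x) * (yukawa z y * u (x - y))) \<partial>lborel)" by (rule integral_norm_bound)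
    also have "\<dots> \<le> (\<integral>y. 2 * C * (1 + norm (x - y)) powr -4 + 8 * C * (norm y powr -1 * (1 + norm y) powr -3) \<partial>lborel)"
    proof (rule integral_mono_AE)
      show "integrable lborel (\<lambda>y. norm (of_real (1 + norm x) * (yukawa z y * u (x - y))))"
        by (intro integrable_norm integrable_mult_right conv_integrable[OF yukawa_locally_integrable[OF z] u])
      show "integrable lborel (\<lambda>y. 2 * C * (1 + norm (x - y)) powr -4 + 8 * C * (norm y powr -1 * (1 + norm y) powr -3))"
        by (intro Bochner_Integration.integrable_add integrable_mult_right Ii Ki)
      show "AE y in lborel. norm (of_real (1 + norm x) * (yukawa z y * u (x - y))) \<le> 2 * C * (1 + norm (x - y)) powr -4 + 8 * C * (norm y powr -1 * (1 + norm y) powr -3)"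
        using AE_lborel_singleton[of "0::real^3"]
      proof eventually_elim
        fix y :: "real^3" assume y: "y \<noteq> 0"
        let ?a = "norm y" and ?b = "norm (x - y)"
        let ?q = "(1 + ?b) powr -4"
        have a: "?a > 0" using y by simp
        have b1: "1 + ?b > 0" by (simp add: add_pos_nonneg)
        have q: "0 \<le> ?q" "?q \<le> 1" using powr_mono[of "-4" 0 "1 + ?b"] b1 by (auto split: if_splits)
        have u5: "(1 + ?b) * norm (u (x - y)) \<le> C * ?q"
        proof -
          have "(1 + ?b) * norm (u (x - y)) \<le> (1 + ?b) * (C * (1 + ?b) powr -5)" using b1 by (intro mult_left_mono C(2)) auto
          also have "\<dots> = C * ((1 + ?b) powr 1 * (1 + ?b) powr -5)" using b1 by simp
          also have "(1 + ?b) powr 1 * (1 + ?b) powr -5 = ?q" by (subst powr_add[symmetric]) simp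
          finally show ?thesis .
        qed
        have u4: "norm (u (x - y)) \<le> C * ?q"
          using u5 mult_right_mono[of 1 "1 + ?b" "norm (u (x - y))"] by simp
        \<comment> \<open>Near the origin \<open>1/\<bar>y\<bar>\<close> is integrable, away from it \<open>1/\<bar>y\<bar> \<le> 1\<close>.\<close>
        have inv: "1 / ?a \<le> 8 * (?a powr -1 * (1 + ?a) powr -3) + 1"
        proof (cases "?a \<le> 1")
          case True
          have "(1 + ?a) ^ 3 \<le> 2 ^ 3" using True by (intro power_mono) auto
          moreover have "1 + ?a > 0" using a by linarith
          ultimately have "1 \<le> 8 * (1 + ?a) powr -3" by (simp add: powr_minus powr_numeral divide_simps)
          hence "1 / ?a * 1 \<le> 1 / ?a * (8 * (1 + ?a) powr -3)" by (rule mult_left_mono) simp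
          moreover have "1 / ?a * (8 * (1 + ?a) powr -3) = 8 * (?a powr -1 * (1 + ?a) powr -3)"
            using a by (simp add: powr_minus divide_inverse mult_ac)
          ultimately show ?thesis by linarith
        next
          case False
          hence "1 / ?a \<le> 1" using a by (simp add: divide_le_eq)
          moreover have "0 \<le> 8 * (?a powr -1 * (1 + ?a) powr -3)" by simp
          ultimately show ?thesis by linarith
        qed
        have "norm (of_real (1 + norm x) * (yukawa z y * u (x - y))) = (1 + norm x) * norm (u (x - y)) * norm (yukawa z y)"
          unfolding norm_mult norm_of_real using px by simp
        also have "\<dots> \<le> (?a + (1 + ?b)) * norm (u (x - y)) * (1 / ?a)"
          using norm_triangle_ineq[of y "x - y"] by (intro mult_mono norm_yukawa_le z) auto
        also have "\<dots> = norm (u (x - y)) + (1 + ?b) * norm (u (x - y)) * (1 / ?a)" using a by (simp add: field_simps)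
        also have "\<dots> \<le> C * ?q + C * ?q * (8 * (?a powr -1 * (1 + ?a) powr -3) + 1)"
        proof (intro add_mono)
          have "0 \<le> C * ?q" using C(1) by simp
          thus "(1 + ?b) * norm (u (x - y)) * (1 / ?a) \<le> C * ?q * (8 * (?a powr -1 * (1 + ?a) powr -3) + 1)"
            using u5 inv by (intro mult_mono[OF u5 inv]) auto
        qed (rule u4)
        also have "\<dots> = 2 * C * ?q + ?q * (8 * C * (?a powr -1 * (1 + ?a) powr -3))" by (simp add: algebra_simps)
        also have "\<dots> \<le> 2 * C * ?q + 1 * (8 * C * (?a powr -1 * (1 + ?a) powr -3))"
          using q C(1) by (intro add_left_mono mult_right_mono) auto
        finally show "norm (of_real (1 + norm x) * (yukawa z y * u (x - y))) \<le> 2 * C * ?q + 8 * C * (?a powr -1 * (1 + ?a) powr -3)" by simp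
      qed
    qed
    also have "\<dots> = 2 * C * I + 8 * C * K"
      unfolding K_def
      by (subst Bochner_Integration.integral_add) (intro integrable_mult_right Ii Ki, intro integrable_mult_right Ii Ki, simp only: integral_mult_right_zero Ii)
    finally have "(1 + norm x) * norm (conv (yukawa z) u x) \<le> D" by (simp add: D_def)
    thus "norm (conv (yukawa z) u x) \<le> D / (1 + norm x)" using px by (simp add: le_divide_eq mult.commute)
  qed
qed

text \<open>
  The commutator terms that arise when a differential operator meets \<open>cutoff n * \<phi>\<close>: sums of
  products in which at least one derivative has fallen on the cut-off. Closed under further
  derivatives, so operators of any order are covered at once; only the size of such a term
  will matter, not its coefficients.
\<close>

inductive_set cutoff_errors :: "(real^'n \<Rightarrow> complex) \<Rightarrow> (nat \<Rightarrow> real^'n \<Rightarrow> complex) set" for \<phi> where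
  zero: "(\<lambda>n x. 0) \<in> cutoff_errors \<phi>"
| base: "is \<noteq> [] \<Longrightarrow> (\<lambda>n x. partials is (cutoff n) x * partials js \<phi> x) \<in> cutoff_errors \<phi>"
| add: "F \<in> cutoff_errors \<phi> \<Longrightarrow> G \<in> cutoff_errors \<phi> \<Longrightarrow> (\<lambda>n x. F n x + G n x) \<in> cutoff_errors \<phi>"

lemma cutoff_errors_smooth: "F \<in> cutoff_errors \<phi> \<Longrightarrow> smooth \<phi> \<Longrightarrow> smooth (F n)"
  by (induction rule: cutoff_errors.induct)
     (auto intro: smooth_const smooth_add smooth_mult smooth_partials smooth_cutoff)

lemma cutoff_errors_pdir:
  assumes "F \<in> cutoff_errors \<phi>" "smooth \<phi>"
  shows "(\<lambda>n. pdir i (F n)) \<in> cutoff_errors \<phi>"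
  using assms(1)
proof induction
  case (base "is" js)
  have "pdir i (\<lambda>x. partials is (cutoff n) x * partials js \<phi> x) =
      (\<lambda>x. partials (i # is) (cutoff n) x * partials js \<phi> x + partials is (cutoff n) x * partials (i # js) \<phi> x)" for n
    unfolding partials_Cons by (intro pdir_smooth_mult smooth_partials smooth_cutoff assms(2))
  thus ?case using base by (auto intro!: cutoff_errors.intros)
next
  case (add F G)
  have "pdir i (\<lambda>x. F n x + G n x) = (\<lambda>x. pdir i (F n) x + pdir i (G n) x)" for n
    by (rule pdir_smooth_add[OF cutoff_errors_smooth[OF add.hyps(1) assms(2)] cutoff_errors_smooth[OF add.hyps(2) assms(2)]])
  thus ?case using add.IH by (auto intro: cutoff_errors.add)
qed (auto intro: cutoff_errors.zero)

lemma partials_cutoff_mult: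
  assumes "smooth \<phi>"
  shows "(\<lambda>n x. partials is (\<lambda>x. cutoff n x * \<phi> x) x - cutoff n x * partials is \<phi> x) \<in> cutoff_errors \<phi>"
proof (induction "is")
  case (Cons i "is")
  define E where "E n x = partials is (\<lambda>x. cutoff n x * \<phi> x) x - cutoff n x * partials is \<phi> x" for n x
  have E: "E \<in> cutoff_errors \<phi>" using Cons unfolding E_def .
  have "pdir i (partials is (\<lambda>x. cutoff n x * \<phi> x)) x - cutoff n x * pdir i (partials is \<phi>) x
      = partials [i] (cutoff n) x * partials is \<phi> x + pdir i (E n) x" for n x
  proof -
    have "partials is (\<lambda>x. cutoff n x * \<phi> x) = (\<lambda>x. cutoff n x * partials is \<phi> x + E n x)"
      by (auto simp: E_def)
    thus ?thesis
      by (simp add: partials_Cons pdir_smooth_add pdir_smooth_mult smooth_mult smooth_cutoff smooth_partials assms cutoff_errors_smooth[OF E assms])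
  qed
  moreover have "(\<lambda>n x. partials [i] (cutoff n) x * partials is \<phi> x) \<in> cutoff_errors \<phi>"
    by (rule cutoff_errors.base) simp
  ultimately show ?case unfolding partials_Cons
    using cutoff_errors.add[OF _ cutoff_errors_pdir[OF E assms, of i]] by simp
qed (use cutoff_errors.zero in simp)

lemma cutoff_errors_sum:
  "finite I \<Longrightarrow> (\<And>i. i \<in> I \<Longrightarrow> F i \<in> cutoff_errors \<phi>) \<Longrightarrow> (\<lambda>n x. \<Sum>i\<in>I. F i n x) \<in> cutoff_errors \<phi>"
  by (induction I rule: finite_induct) (auto intro: cutoff_errors.intros)

lemma lap_lap:
  assumes "smooth f" shows "lap (lap f) x = (\<Sum>i\<in>UNIV. \<Sum>j\<in>UNIV. partials [i,i,j,j] f x)"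
proof -
  have "partials [i,i] (lap f) = (\<lambda>x. \<Sum>j\<in>UNIV. partials [i,i,j,j] f x)" for i
    unfolding lap_def using partials_sum[of UNIV "\<lambda>j. partials [j,j] f" "[i,i]"] assms
    by (simp add: smooth_partials flip: partials_append)
  thus ?thesis by (simp add: lap_def[of "lap f"])
qed

lemma lap_cutoff_mult:
  assumes "smooth \<phi>"
  shows "(\<lambda>n x. lap (\<lambda>x. cutoff n x * \<phi> x) x - cutoff n x * lap \<phi> x) \<in> cutoff_errors \<phi>"
proof -
  have "(\<lambda>n x. \<Sum>i\<in>UNIV. partials [i,i] (\<lambda>x. cutoff n x * \<phi> x) x - cutoff n x * partials [i,i] \<phi> x) \<in> cutoff_errors \<phi>"
    by (rule cutoff_errors_sum) (auto intro: partials_cutoff_mult assms)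
  thus ?thesis by (simp add: lap_def sum_subtractf sum_distrib_left)
qed

lemma lap_lap_cutoff_mult:
  assumes "smooth \<phi>"
  shows "(\<lambda>n x. lap (lap (\<lambda>x. cutoff n x * \<phi> x)) x - cutoff n x * lap (lap \<phi>) x) \<in> cutoff_errors \<phi>"
proof -
  have "(\<lambda>n x. \<Sum>i\<in>UNIV. \<Sum>j\<in>UNIV. partials [i,i,j,j] (\<lambda>x. cutoff n x * \<phi> x) x - cutoff n x * partials [i,i,j,j] \<phi> x) \<in> cutoff_errors \<phi>"
    by (intro cutoff_errors_sum) (auto intro: partials_cutoff_mult assms)
  thus ?thesis by (simp add: lap_lap assms smooth_mult smooth_cutoff sum_subtractf sum_distrib_left)
qed

lemma cutoff_errors_bound:
  assumes "F \<in> cutoff_errors \<phi>" and \<phi>: "\<And>is. \<exists>C. \<forall>x. norm (partials is \<phi> x) \<le> C / (1 + norm x)"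
  shows "\<exists>C\<ge>0. \<forall>n x. norm (F n x) \<le> C * (1 / real (Suc n)) / (1 + norm x)"
  using assms(1)
proof induction
  case (base "is" js)
  obtain C where C: "C > 0" "\<And>n x. norm (partials is (cutoff n) x) \<le> C * (1 / real (Suc n)) ^ length is"
    by (rule partials_cutoff_bound[of "is"]) blast
  obtain D where D: "\<And>x. norm (partials js \<phi> x) \<le> D / (1 + norm x)" using \<phi> by blast
  have p: "1 + norm x > 0" for x :: "real^'a" by (simp add: add_pos_nonneg)
  have D0: "D \<ge> 0" using order_trans[OF norm_ge_zero D[of 0]] by simp
  have "norm (partials is (cutoff n) x * partials js \<phi> x) \<le> C * D * (1 / real (Suc n)) / (1 + norm x)" for n x
  proof -
    have "(1 / real (Suc n)) ^ length is \<le> (1 / real (Suc n)) ^ 1"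
      using base by (intro power_decreasing) (auto simp: Suc_le_eq)
    hence "C * (1 / real (Suc n)) ^ length is \<le> C * (1 / real (Suc n))" using C(1) by (intro mult_left_mono) auto
    hence "norm (partials is (cutoff n) x) \<le> C * (1 / real (Suc n))" using C(2)[of n x] by linarith
    hence "norm (partials is (cutoff n) x * partials js \<phi> x) \<le> (C * (1 / real (Suc n))) * (D / (1 + norm x))"
      unfolding norm_mult using C(1) by (intro mult_mono D) auto
    thus ?thesis by (simp add: mult_ac)
  qed
  thus ?case using C(1) D0 by (intro exI[of _ "C * D"]) auto
next
  case (add F G)
  then obtain C D where CD: "C \<ge> 0" "\<And>n x. norm (F n x) \<le> C * (1 / real (Suc n)) / (1 + norm x)"
    "D \<ge> 0" "\<And>n x. norm (G n x) \<le> D * (1 / real (Suc n)) / (1 + norm x)" by blast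
  have "norm (F n x + G n x) \<le> (C + D) * (1 / real (Suc n)) / (1 + norm x)" for n x
    using norm_triangle_ineq[of "F n x" "G n x"] CD(2)[of n x] CD(4)[of n x]
    unfolding distrib_right add_divide_distrib by linarith
  thus ?case using CD by (intro exI[of _ "C + D"]) auto
qed (auto intro!: exI[of _ 0])

text \<open>
  One unit beyond the radius \<open>n + 1\<close> of the cut-off, for the strict inequality in
  \<open>partials_zero_outside\<close>.
\<close>

lemma cutoff_errors_outside:
  assumes "F \<in> cutoff_errors \<phi>"
  shows "norm x \<ge> real n + 2 \<Longrightarrow> F n x = 0"
  using assms
proof (induction arbitrary: x)
  case (base "is" js)
  have "partials is (cutoff n) x = 0"
    by (rule partials_zero_outside[where R = "real n + 1" and R' = "real n + 2"]) (use base in \<open>auto intro: cutoff_outside\<close>)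
  thus ?case by simp
qed auto

lemma mult_le_half_squares: "a * b \<le> (a\<^sup>2 + b\<^sup>2) / (2::real)"
  using sum_squares_bound[of a b] by simp

lemma mult_le_sum_squares: "a * b \<le> a\<^sup>2 + (b::real)\<^sup>2"
  by (rule order_trans[OF mult_le_half_squares]) simp

text \<open>
  The factor \<open>1/(n+1)\<close> alone would not give an integrable majorant, as \<open>1/(1+\<bar>x\<bar>)\<close> is not in
  \<open>L\<^sup>2\<close>. But on the support of \<open>F n\<close> it is at most \<open>3/(1+\<bar>x\<bar>)\<close>, so the integrands are
  dominated by \<open>\<bar>\<psi>\<bar> (1+\<bar>x\<bar>)\<^sup>-\<^sup>2\<close>, a product of two functions in \<open>L\<^sup>2(\<real>\<^sup>3)\<close>.
\<close>

lemma cutoff_errors_integral: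
  fixes \<phi> \<psi> :: "real^3 \<Rightarrow> complex"
  assumes F: "F \<in> cutoff_errors \<phi>" and sm: "smooth \<phi>"
    and \<phi>: "\<And>is. \<exists>C. \<forall>x. norm (partials is \<phi> x) \<le> C / (1 + norm x)"
    and [measurable]: "\<psi> \<in> borel_measurable borel" and \<psi>: "integrable lborel (\<lambda>x. (norm (\<psi> x))\<^sup>2)"
  shows "(\<lambda>n. \<integral>x. \<psi> x * F n x \<partial>lborel) \<longlonglongrightarrow> 0" "integrable lborel (\<lambda>x. \<psi> x * F n x)"
proof -
  obtain C where C: "C \<ge> 0" "\<And>n x. norm (F n x) \<le> C * (1 / real (Suc n)) / (1 + norm x)"
    using cutoff_errors_bound[OF F \<phi>] by blast
  have [measurable]: "F n \<in> borel_measurable borel" for n by (rule smooth_measurable[OF cutoff_errors_smooth[OF F sm]])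
  define w where "w x = 3 * C * ((norm (\<psi> x))\<^sup>2 + (1 + norm x) powr -4)" for x :: "real^3"
  have w: "integrable lborel w" unfolding w_def by (intro integrable_mult_right Bochner_Integration.integrable_add \<psi> integrable_japanese) auto
  have b: "norm (\<psi> x * F n x) \<le> w x" for n x
  proof (cases "norm x \<ge> real n + 2")
    case True
    thus ?thesis using cutoff_errors_outside[OF F] C by (simp add: w_def)
  next
    case False
    have p: "1 + norm x > 0" by (simp add: add_pos_nonneg)
    have "1 / real (Suc n) \<le> 3 / (1 + norm x)" using False p by (simp add: field_simps)
    hence "C * (1 / real (Suc n)) / (1 + norm x) \<le> C * (3 / (1 + norm x)) / (1 + norm x)"
      using C p by (intro divide_right_mono mult_left_mono) auto
    hence "norm (F n x) \<le> C * (3 / (1 + norm x)) / (1 + norm x)" using C(2)[of n x] by linarith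
    also have "\<dots> = 3 * C * (1 + norm x) powr -2" using p by (simp add: powr_minus powr_numeral power2_eq_square divide_inverse)
    finally have "norm (\<psi> x) * norm (F n x) \<le> norm (\<psi> x) * (3 * C * (1 + norm x) powr -2)" by (rule mult_left_mono) simp
    also have "\<dots> = 3 * C * (norm (\<psi> x) * (1 + norm x) powr -2)" by simp
    also have "\<dots> \<le> 3 * C * ((norm (\<psi> x))\<^sup>2 + ((1 + norm x) powr -2)\<^sup>2)"
    proof (intro mult_left_mono)
      show "norm (\<psi> x) * (1 + norm x) powr -2 \<le> (norm (\<psi> x))\<^sup>2 + ((1 + norm x) powr -2)\<^sup>2"
        by (rule mult_le_sum_squares)
    qed (use C in auto)
    also have "((1 + norm x) powr -2)\<^sup>2 = (1 + norm x) powr -4" using p by (simp add: powr_power)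
    finally show ?thesis by (simp add: norm_mult w_def)
  qed
  show "integrable lborel (\<lambda>x. \<psi> x * F n x)"
    by (rule Bochner_Integration.integrable_bound[OF w]) (use b in \<open>auto intro: order_trans[OF _ abs_ge_self]\<close>)
  have "(\<lambda>n. \<integral>x. \<psi> x * F n x \<partial>lborel) \<longlonglongrightarrow> (\<integral>x. \<psi> x * 0 \<partial>(lborel :: (real^3) measure))"
  proof (rule integral_dominated_convergence[OF _ _ w])
    show "AE x in lborel. (\<lambda>n. \<psi> x * F n x) \<longlonglongrightarrow> \<psi> x * 0"
    proof (intro AE_I2 tendsto_mult tendsto_const)
      fix x :: "real^3"
      have "norm (F n x) \<le> (C / (1 + norm x)) * (1 / real (Suc n))" for n using C(2)[of n x] by (simp add: mult.commute)
      thus "(\<lambda>n. F n x) \<longlonglongrightarrow> 0" by (rule LIMSEQ_bounded_by_harmonic)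
    qed
  qed (use b in auto)
  thus "(\<lambda>n. \<integral>x. \<psi> x * F n x \<partial>lborel) \<longlonglongrightarrow> 0" by simp
qed

section \<open>Density of test functions\<close>

lemma bump_at:
  fixes a :: "real^'n"
  assumes r: "r > 0"
  obtains b where "(\<lambda>y. complex_of_real (b y)) \<in> test_functions" "\<And>y. 0 \<le> b y" "\<And>y. b y \<le> 1"
    "\<And>y. y \<in> ball a r \<Longrightarrow> b y > 0" "\<And>y. y \<notin> ball a r \<Longrightarrow> b y = 0"
proof -
  let ?T = "\<lambda>y. - (1 / r) *\<^sub>R a + (1 / r) *\<^sub>R y"
  have T: "?T y = (1 / r) *\<^sub>R (y - a)" for y by (simp add: scaleR_diff_right)
  have nT: "norm (?T y) = dist a y / r" for y unfolding T using r by (simp add: dist_norm norm_minus_commute)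
  define b where "b y = exp 1 * flat 0 (1 - (norm (?T y))\<^sup>2)" for y
  have eq: "complex_of_real (b y) = bump (?T y)" for y by (simp only: b_def bump_real)
  show ?thesis
  proof (rule that[of b])
    show "(\<lambda>y. complex_of_real (b y)) \<in> test_functions"
      unfolding eq using test_affine[OF bump_test, of "1 / r" "- (1 / r) *\<^sub>R a"] r by simp
    show "0 \<le> b y" "b y \<le> 1" for y unfolding b_def by (rule flat_le_1)+
    show "b y > 0" if "y \<in> ball a r" for y
      unfolding b_def by (rule bump_pos) (use that r nT in simp)
    show "b y = 0" if "y \<notin> ball a r" for y
    proof -
      have "bump (?T y) = 0" by (rule bump_outside) (use that r nT in simp)
      thus ?thesis using eq[of y] by simp
    qed
  qed
qed

text \<open>
  Cover \<open>K\<close> by finitely many bumps \<open>b\<close> supported in \<open>U\<close>. The product \<open>q\<close> of the functions \<open>1 -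
  b\<close> is \<open>1\<close> off \<open>U\<close> and bounded away from \<open>1\<close> on \<open>K\<close>, so a high power of \<open>q\<close> is small on \<open>K\<close>.
  Values close to \<open>1\<close> on \<open>K\<close> are all that the limit arguments need.
\<close>

lemma smooth_Urysohn:
  fixes K U :: "(real^'n) set"
  assumes K: "compact K" and U: "open U" "K \<subseteq> U" and d: "\<delta> > 0"
  obtains e where "(\<lambda>y. complex_of_real (e y)) \<in> test_functions" "\<And>y. 0 \<le> e y" "\<And>y. e y \<le> 1"
    "\<And>y. y \<notin> U \<Longrightarrow> e y = 0" "\<And>y. y \<in> K \<Longrightarrow> e y \<ge> 1 - \<delta>"
proof -
  have "\<forall>a\<in>K. \<exists>r. r > 0 \<and> ball a r \<subseteq> U" using U open_contains_ball[of U] by auto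
  from bchoice[OF this] obtain r where r: "\<And>a. a \<in> K \<Longrightarrow> r a > 0" "\<And>a. a \<in> K \<Longrightarrow> ball a (r a) \<subseteq> U" by blast
  have "K \<subseteq> (\<Union>a\<in>K. ball a (r a))" using r(1) by auto
  from compactE_image[OF K open_ball this] obtain D where D: "D \<subseteq> K" "finite D" "K \<subseteq> (\<Union>a\<in>D. ball a (r a))" by blast
  have "\<forall>a\<in>D. \<exists>b. (\<lambda>y. complex_of_real (b y)) \<in> test_functions \<and> (\<forall>y. 0 \<le> b y \<and> b y \<le> 1) \<and>
     (\<forall>y\<in>ball a (r a). b y > 0) \<and> (\<forall>y. y \<notin> ball a (r a) \<longrightarrow> b y = 0)"
  proof
    fix a assume "a \<in> D"
    hence "r a > 0" using D(1) r(1) by auto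
    then obtain b where "(\<lambda>y. complex_of_real (b y)) \<in> test_functions" "\<And>y. 0 \<le> b y" "\<And>y. b y \<le> 1"
      "\<And>y. y \<in> ball a (r a) \<Longrightarrow> b y > 0" "\<And>y. y \<notin> ball a (r a) \<Longrightarrow> b y = 0" by (rule bump_at[of "r a" a]) blast
    thus "\<exists>b. (\<lambda>y. complex_of_real (b y)) \<in> test_functions \<and> (\<forall>y. 0 \<le> b y \<and> b y \<le> 1) \<and>
     (\<forall>y\<in>ball a (r a). b y > 0) \<and> (\<forall>y. y \<notin> ball a (r a) \<longrightarrow> b y = 0)" by (intro exI[of _ b]) blast
  qed
  from bchoice[OF this] obtain b where b: "\<And>a. a \<in> D \<Longrightarrow> (\<lambda>y. complex_of_real (b a y)) \<in> test_functions" "\<And>a y. a \<in> D \<Longrightarrow> 0 \<le> b a y" "\<And>a y. a \<in> D \<Longrightarrow> b a y \<le> 1"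
     "\<And>a y. a \<in> D \<Longrightarrow> y \<in> ball a (r a) \<Longrightarrow> b a y > 0" "\<And>a y. a \<in> D \<Longrightarrow> y \<notin> ball a (r a) \<Longrightarrow> b a y = 0" by blast
  define q where "q y = (\<Prod>a\<in>D. 1 - b a y)" for y
  have q01: "0 \<le> q y" "q y \<le> 1" for y unfolding q_def using b by (auto intro!: prod_nonneg prod_le_1)
  have sq: "smooth (\<lambda>y. complex_of_real (q y))"
    unfolding q_def of_real_prod of_real_diff of_real_1
    by (intro smooth_prod smooth_diff smooth_const test_smooth b)
  have cq: "continuous_on UNIV q"
  proof -
    have "continuous_on UNIV (\<lambda>y. Re (complex_of_real (q y)))" by (intro continuous_on_Re smooth_continuous sq)
    thus ?thesis by simp
  qed
  have qK: "q y < 1" if yK: "y \<in> K" for y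
  proof -
    obtain a where a: "a \<in> D" "y \<in> ball a (r a)" using subsetD[OF D(3) yK] by blast
    have "q y = (1 - b a y) * (\<Prod>a\<in>D - {a}. 1 - b a y)" unfolding q_def by (rule prod.remove[OF D(2) a(1)])
    also have "\<dots> \<le> (1 - b a y) * 1" using b a by (intro mult_left_mono prod_le_1) auto
    also have "\<dots> < 1" using b(4)[OF a] by simp
    finally show ?thesis .
  qed
  obtain m where m: "0 \<le> m" "m < 1" "\<And>y. y \<in> K \<Longrightarrow> q y \<le> m"
  proof (cases "K = {}")
    case False
    then obtain y0 where "y0 \<in> K" "\<forall>y\<in>K. q y \<le> q y0"
      using continuous_attains_sup[OF K False continuous_on_subset[OF cq]] by blast
    thus ?thesis using that[of "q y0"] q01 qK by auto
  qed (use that[of 0] in auto)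
  obtain N where N: "m ^ N < \<delta>" using real_arch_pow_inv[OF d m(2)] by blast
  define e where "e y = 1 - q y ^ (Suc N)" for y
  have out: "q y = 1" if "y \<notin> (\<Union>a\<in>D. ball a (r a))" for y
    unfolding q_def using that b(5) by (intro prod.neutral) auto
  show ?thesis
  proof (rule that[of e])
    have "bounded (\<Union>a\<in>D. ball a (r a))" using D(2) by auto
    then obtain R where R: "\<And>y. y \<in> (\<Union>a\<in>D. ball a (r a)) \<Longrightarrow> norm y < R" unfolding bounded_pos_less by blast
    have z: "e y = 0" if "y \<notin> (\<Union>a\<in>D. ball a (r a))" for y using out[OF that] by (simp add: e_def)
    show "(\<lambda>y. complex_of_real (e y)) \<in> test_functions"
    proof (rule test_functionsI'[where R = R])
      show "smooth (\<lambda>y. complex_of_real (e y))" unfolding e_def of_real_diff of_real_1 of_real_power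
        by (intro smooth_diff smooth_const smooth_power sq)
      show "complex_of_real (e y) = 0" if "norm y \<ge> R" for y using z[of y] R[of y] that by force
    qed
    show "0 \<le> e y" "e y \<le> 1" for y unfolding e_def using q01[of y] by (auto simp: power_le_one simp del: power_Suc)
    show "e y = 0" if "y \<notin> U" for y using z[of y] that r(2) D(1) by blast
    show "e y \<ge> 1 - \<delta>" if "y \<in> K" for y
    proof -
      have "q y ^ Suc N \<le> q y ^ N" using q01[of y] by (intro power_decreasing) auto
      also have "\<dots> \<le> m ^ N" using m(3)[OF that] q01[of y] by (intro power_mono) auto
      finally show ?thesis using N by (simp add: e_def)
    qed
  qed
qed

lemma compact_indicator_limit:
  fixes K :: "(real^'n) set"
  assumes K: "compact K" "K \<subseteq> cball 0 R"
  obtains e where "\<And>n. (\<lambda>y. complex_of_real (e n y)) \<in> test_functions" "\<And>n y. 0 \<le> e n y" "\<And>n y. e n y \<le> 1"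
    "\<And>n y. norm y \<ge> R + 1 \<Longrightarrow> e n y = 0" "\<And>y. (\<lambda>n. e n y) \<longlonglongrightarrow> indicator K y"
proof -
  define U where "U n = (\<Union>a\<in>K. ball a (1 / real (Suc n)))" for n
  have "\<exists>e. (\<lambda>y. complex_of_real (e y)) \<in> test_functions \<and> (\<forall>y. 0 \<le> e y) \<and> (\<forall>y. e y \<le> 1) \<and> (\<forall>y. y \<notin> U n \<longrightarrow> e y = 0) \<and> (\<forall>y\<in>K. e y \<ge> 1 - 1 / real (Suc n))" for n
  proof -
    have o: "open (U n)" and p: "1 / real (Suc n) > 0" unfolding U_def by auto
    have k: "K \<subseteq> U n"
    proof
      fix y assume "y \<in> K"
      moreover have "y \<in> ball y (1 / real (Suc n))" by simp
      ultimately show "y \<in> U n" unfolding U_def by (rule UN_I)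
    qed
    obtain e where "(\<lambda>y. complex_of_real (e y)) \<in> test_functions" "\<And>y. 0 \<le> e y" "\<And>y. e y \<le> 1"
      "\<And>y. y \<notin> U n \<Longrightarrow> e y = 0" "\<And>y. y \<in> K \<Longrightarrow> e y \<ge> 1 - 1 / real (Suc n)" by (rule smooth_Urysohn[OF K(1) o k p]) blast
    thus ?thesis by (intro exI[of _ e]) blast
  qed
  hence "\<forall>n. \<exists>e. (\<lambda>y. complex_of_real (e y)) \<in> test_functions \<and> (\<forall>y. 0 \<le> e y) \<and> (\<forall>y. e y \<le> 1) \<and> (\<forall>y. y \<notin> U n \<longrightarrow> e y = 0) \<and> (\<forall>y\<in>K. e y \<ge> 1 - 1 / real (Suc n))" by (rule allI)
  from choice[OF this] obtain e where e: "\<And>n. (\<lambda>y. complex_of_real (e n y)) \<in> test_functions" "\<And>n y. 0 \<le> e n y" "\<And>n y. e n y \<le> 1"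
    "\<And>n y. y \<notin> U n \<Longrightarrow> e n y = 0" "\<And>n y. y \<in> K \<Longrightarrow> e n y \<ge> 1 - 1 / real (Suc n)" by blast
  have h0: "(\<lambda>n. 1 / real (Suc n)) \<longlonglongrightarrow> 0" using LIMSEQ_inverse_real_of_nat by (simp add: inverse_eq_divide)
  show ?thesis
  proof (rule that[of e])
    show "e n y = 0" if "norm y \<ge> R + 1" for n y
    proof (rule e(4))
      show "y \<notin> U n"
      proof
        assume "y \<in> U n"
        then obtain a where a: "a \<in> K" "dist a y < 1 / real (Suc n)" by (auto simp: U_def)
        have "1 / real (Suc n) \<le> 1" by simp
        moreover have "norm a \<le> R" using a K by auto
        moreover have "norm y \<le> norm a + dist a y" using norm_triangle_ineq2[of y a] by (simp add: dist_norm norm_minus_commute)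
        ultimately show False using a that by linarith
      qed
    qed
    show "(\<lambda>n. e n y) \<longlonglongrightarrow> indicator K y" for y
    proof (cases "y \<in> K")
      case True
      have "(\<lambda>n. 1 - 1 / real (Suc n)) \<longlonglongrightarrow> 1 - 0" by (intro tendsto_intros h0)
      hence l: "(\<lambda>n. 1 - 1 / real (Suc n)) \<longlonglongrightarrow> 1" by simp
      have "(\<lambda>n. e n y) \<longlonglongrightarrow> 1"
      proof (rule tendsto_sandwich[OF _ _ l tendsto_const])
        show "\<forall>\<^sub>F n in sequentially. 1 - 1 / real (Suc n) \<le> e n y" by (intro always_eventually allI e(5) True)
        show "\<forall>\<^sub>F n in sequentially. e n y \<le> 1" by (intro always_eventually allI e(3))
      qed
      thus ?thesis using True by simp
    next
      case False
      hence "y \<in> - K" by simp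
      with open_Compl[OF compact_imp_closed[OF K(1)]] obtain d where d: "d > 0" "ball y d \<subseteq> - K" by (rule openE)
      have "\<forall>\<^sub>F n in sequentially. 1 / real (Suc n) < d" using h0 d(1) by (auto dest: order_tendstoD(2))
      hence "\<forall>\<^sub>F n in sequentially. e n y = 0"
      proof eventually_elim
        case (elim n)
        have "y \<notin> U n"
        proof
          assume "y \<in> U n"
          then obtain a where a: "a \<in> K" "dist a y < 1 / real (Suc n)" by (auto simp: U_def)
          hence "a \<in> ball y d" using elim by (simp add: dist_commute)
          thus False using a(1) d(2) by blast
        qed
        thus ?case by (rule e(4))
      qed
      thus ?thesis using False by (simp add: tendsto_eventually)
    qed
  qed (use e in auto)
qed

text \<open>
  If \<open>h > 0\<close> on a set of positive measure, inner regularity gives a compact subset of positive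
  measure, over which the integral of \<open>h\<close> would be positive.
\<close>

lemma AE_nonpos_if_compact_integrals_zero:
  fixes h :: "real^'n \<Rightarrow> real"
  assumes h[measurable]: "h \<in> borel_measurable borel" and loc: "\<And>R. integrable lborel (\<lambda>y. indicator (cball 0 R) y *\<^sub>R h y)"
    and zero: "\<And>K. compact K \<Longrightarrow> (\<integral>y. indicator K y *\<^sub>R h y \<partial>lborel) = 0"
  shows "AE y in lborel. h y \<le> 0"
proof -
  define S where "S m = {y. h y > 0} \<inter> cball 0 (real m)" for m :: nat
  have Sb [measurable]: "S m \<in> sets borel" for m unfolding S_def by measurable
  have "emeasure lborel (S m) = 0" for m
  proof (rule ccontr)
    assume n0: "emeasure lborel (S m) \<noteq> 0"
    have "emeasure lborel (S m) < \<infinity>" by (rule emeasure_bounded_finite) (auto simp: S_def intro: bounded_subset[OF bounded_cball])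
    then obtain e where e: "e \<ge> 0" "emeasure lborel (S m) = ennreal e" by (cases "emeasure lborel (S m)") auto
    have e0: "e > 0" using n0 e by (cases "e = 0") auto
    have Sl: "S m \<in> sets lebesgue" using Sb by simp
    obtain T where T: "closed T" "T \<subseteq> S m" "S m - T \<in> lmeasurable" "emeasure lebesgue (S m - T) < ennreal e"
      by (rule sets_lebesgue_inner_closed[OF Sl e0])
    have [measurable]: "T \<in> sets borel" using T(1) by simp
    have cT: "compact T" unfolding compact_eq_bounded_closed
      using T bounded_subset[OF bounded_cball[of 0 "real m"], of T] by (auto simp: S_def)
    have "(\<lambda>y. indicator T y *\<^sub>R (indicator (cball 0 (real m)) y *\<^sub>R h y)) = (\<lambda>y. indicator T y *\<^sub>R h y)"
    proof
      fix y
      show "indicator T y *\<^sub>R (indicator (cball 0 (real m)) y *\<^sub>R h y) = indicator T y *\<^sub>R h y"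
        using T(2) by (cases "y \<in> T") (auto simp: S_def)
    qed
    moreover have "integrable lborel (\<lambda>y. indicator T y *\<^sub>R (indicator (cball 0 (real m)) y *\<^sub>R h y))"
      by (rule integrable_mult_indicator[OF _ loc]) simp
    ultimately have int: "integrable lborel (\<lambda>y. indicator T y *\<^sub>R h y)" by (simp only:)
    have nn: "AE y in lborel. 0 \<le> indicator T y *\<^sub>R h y"
      using T(2) by (intro AE_I2) (auto simp: S_def indicator_def)
    have "AE y in lborel. indicator T y *\<^sub>R h y = 0"
      using integral_nonneg_eq_0_iff_AE[OF int nn] zero[OF cT] by blast
    hence "AE y in lborel. y \<notin> T"
      by eventually_elim (use T(2) in \<open>auto simp: S_def indicator_def split: if_splits\<close>)
    hence T0: "emeasure lborel T = 0" using AE_iff_measurable[of T lborel "\<lambda>y. y \<notin> T"] by simp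
    have "emeasure lborel (S m) \<le> emeasure lborel ((S m - T) \<union> T)" by (intro emeasure_mono) auto
    also have "\<dots> \<le> emeasure lborel (S m - T) + emeasure lborel T" by (intro emeasure_subadditive) auto
    also have "\<dots> < ennreal e" using T(4) T0 by simp
    finally show False using e by simp
  qed
  hence "AE y in lborel. y \<notin> S m" for m
    using AE_iff_measurable[of "S m" lborel "\<lambda>y. y \<notin> S m"] by simp
  hence "AE y in lborel. \<forall>m. y \<notin> S m" by (simp add: AE_all_countable)
  thus ?thesis
  proof eventually_elim
    fix y assume y: "\<forall>m. y \<notin> S m"
    obtain m where "norm y \<le> real m" using real_arch_simple by blast
    with y show "h y \<le> 0" unfolding S_def by (auto simp: not_less)
  qed
qed

text \<open>
  Test functions converge boundedly to the indicator of any compact set, so all integrals of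
  \<open>g\<close> over compact sets vanish.
\<close>

lemma du_Bois_Reymond:
  fixes g :: "real^'n \<Rightarrow> complex"
  assumes g[measurable]: "g \<in> borel_measurable borel" and loc: "\<And>R. integrable lborel (\<lambda>y. indicator (cball 0 R) y *\<^sub>R g y)"
    and zero: "\<And>\<eta>. \<eta> \<in> test_functions \<Longrightarrow> (\<integral>y. g y * \<eta> y \<partial>lborel) = 0"
  shows "AE y in lborel. g y = 0"
proof -
  have K: "(\<integral>y. indicator K y *\<^sub>R g y \<partial>lborel) = 0" "integrable lborel (\<lambda>y. indicator K y *\<^sub>R g y)" if K: "compact K" for K
  proof -
    obtain R where "\<forall>y\<in>K. norm y \<le> R" using compact_imp_bounded[OF K] unfolding bounded_iff by blast
    hence R: "K \<subseteq> cball 0 R" by auto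
    have [measurable]: "K \<in> sets borel" using K by (simp add: borel_compact)
    obtain e where e: "\<And>n. (\<lambda>y. complex_of_real (e n y)) \<in> test_functions" "\<And>n y. 0 \<le> e n y" "\<And>n y. e n y \<le> 1"
      "\<And>n y. norm y \<ge> R + 1 \<Longrightarrow> e n y = 0" "\<And>y. (\<lambda>n. e n y) \<longlonglongrightarrow> indicator K y" by (rule compact_indicator_limit[OF K R]) blast
    have em [measurable]: "(\<lambda>y. complex_of_real (e n y)) \<in> borel_measurable borel" for n by (rule smooth_measurable[OF test_smooth[OF e(1)]])
    have w: "integrable lborel (\<lambda>y. norm (indicator (cball 0 (R + 1)) y *\<^sub>R g y))" by (rule integrable_norm[OF loc])
    have b: "norm (g y * of_real (e n y)) \<le> norm (indicator (cball 0 (R + 1)) y *\<^sub>R g y)" for n y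
      using e(2)[of n y] e(3)[of n y] e(4)[of y n] by (cases "norm y \<ge> R + 1") (auto simp: norm_mult mult_left_le)
    have l: "(\<lambda>n. g y * of_real (e n y)) \<longlonglongrightarrow> indicator K y *\<^sub>R g y" for y
      using tendsto_mult[OF tendsto_const[of "g y"] tendsto_of_real[OF e(5)[of y]]] by (simp add: scaleR_conv_of_real mult.commute)
    have "(\<lambda>n. \<integral>y. g y * of_real (e n y) \<partial>lborel) \<longlonglongrightarrow> (\<integral>y. indicator K y *\<^sub>R g y \<partial>lborel)"
      by (rule integral_dominated_convergence[OF _ _ w]) (use b l in auto)
    hence "(\<lambda>n. 0) \<longlonglongrightarrow> (\<integral>y. indicator K y *\<^sub>R g y \<partial>lborel)" by (simp only: zero[OF e(1)])
    thus "(\<integral>y. indicator K y *\<^sub>R g y \<partial>lborel) = 0" using LIMSEQ_unique tendsto_const by blast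
    show "integrable lborel (\<lambda>y. indicator K y *\<^sub>R g y)"
      by (rule integrable_dominated_convergence[OF _ _ w, where s = "\<lambda>n y. g y * of_real (e n y)"]) (use b l in auto)
  qed
  have re: "(\<integral>y. indicator K y *\<^sub>R Re (g y) \<partial>lborel) = 0" "(\<integral>y. indicator K y *\<^sub>R Im (g y) \<partial>lborel) = 0" if "compact K" for K
    using K[OF that] integral_Re[OF K(2)[OF that]] integral_Im[OF K(2)[OF that]] by simp_all
  have lre: "integrable lborel (\<lambda>y. indicator (cball 0 R) y *\<^sub>R Re (g y))" "integrable lborel (\<lambda>y. indicator (cball 0 R) y *\<^sub>R Im (g y))" for R
    using integrable_Re[OF loc[of R]] integrable_Im[OF loc[of R]] by simp_all
  have "AE y in lborel. Re (g y) \<le> 0" by (rule AE_nonpos_if_compact_integrals_zero) (use re lre in auto)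
  moreover have "AE y in lborel. - Re (g y) \<le> 0" by (rule AE_nonpos_if_compact_integrals_zero) (use re lre in auto)
  moreover have "AE y in lborel. Im (g y) \<le> 0" by (rule AE_nonpos_if_compact_integrals_zero) (use re lre in auto)
  moreover have "AE y in lborel. - Im (g y) \<le> 0" by (rule AE_nonpos_if_compact_integrals_zero) (use re lre in auto)
  ultimately show ?thesis by eventually_elim (auto simp: complex_eq_iff)
qed

text \<open>
  The squared \<open>L\<^sup>2\<close> distance, with values in the extended nonnegative reals so that no
  integrability has to be tracked.
\<close>

definition sqdist :: "(real^'n \<Rightarrow> complex) \<Rightarrow> (real^'n \<Rightarrow> complex) \<Rightarrow> ennreal" where
  "sqdist f g = (\<integral>\<^sup>+y. ennreal ((norm (f y - g y))\<^sup>2) \<partial>lborel)"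

lemma sqdist_triangle:
  assumes [measurable]: "f \<in> borel_measurable borel" "g \<in> borel_measurable borel" "h \<in> borel_measurable borel"
  shows "sqdist f h \<le> 2 * sqdist f g + 2 * sqdist g h"
proof -
  have "sqdist f h \<le> (\<integral>\<^sup>+y. 2 * ennreal ((norm (f y - g y))\<^sup>2) + 2 * ennreal ((norm (g y - h y))\<^sup>2) \<partial>lborel)"
    unfolding sqdist_def
  proof (rule nn_integral_mono)
    fix y
    have "norm (f y - h y) \<le> norm (f y - g y) + norm (g y - h y)" using norm_triangle_ineq[of "f y - g y" "g y - h y"] by simp
    hence "(norm (f y - h y))\<^sup>2 \<le> (norm (f y - g y) + norm (g y - h y))\<^sup>2" by (rule power_mono) simp
    also have "\<dots> \<le> 2 * (norm (f y - g y))\<^sup>2 + 2 * (norm (g y - h y))\<^sup>2"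
      using sum_squares_bound[of "norm (f y - g y)" "norm (g y - h y)"] by (simp add: power2_sum)
    finally have "ennreal ((norm (f y - h y))\<^sup>2) \<le> ennreal (2 * (norm (f y - g y))\<^sup>2 + 2 * (norm (g y - h y))\<^sup>2)" by (rule ennreal_leI)
    thus "ennreal ((norm (f y - h y))\<^sup>2) \<le> 2 * ennreal ((norm (f y - g y))\<^sup>2) + 2 * ennreal ((norm (g y - h y))\<^sup>2)"
      by (simp add: ennreal_mult)
  qed
  also have "\<dots> = (\<integral>\<^sup>+y. 2 * ennreal ((norm (f y - g y))\<^sup>2) \<partial>lborel) + (\<integral>\<^sup>+y. 2 * ennreal ((norm (g y - h y))\<^sup>2) \<partial>lborel)"
    by (rule nn_integral_add) auto
  also have "\<dots> = 2 * sqdist f g + 2 * sqdist g h" unfolding sqdist_def by (subst (1 2) nn_integral_cmult) auto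
  finally show ?thesis .
qed

text \<open>
  Approximation in \<open>L\<^sup>2\<close> by test functions supported in one ball of radius \<open>R + 1\<close>. The common
  support is what later controls the \<open>L\<^sup>1\<close> norm and the norm with weight \<open>\<bar>y\<bar>\<^sup>2\<close> by the \<open>L\<^sup>2\<close>
  distance.
\<close>

definition approximable :: "real \<Rightarrow> (real^'n \<Rightarrow> complex) \<Rightarrow> bool" where
  "approximable R f \<longleftrightarrow> f \<in> borel_measurable borel \<and>
     (\<forall>\<epsilon>>0. \<exists>\<eta>\<in>test_functions. (\<forall>y. norm y \<ge> R + 1 \<longrightarrow> \<eta> y = 0) \<and> sqdist f \<eta> < ennreal \<epsilon>)"

lemma test_measurable: "\<eta> \<in> test_functions \<Longrightarrow> \<eta> \<in> borel_measurable borel"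
  by (rule smooth_measurable[OF test_smooth])

lemma approximable_limit:
  fixes f :: "real^'n \<Rightarrow> complex"
  assumes f: "f \<in> borel_measurable borel" and g: "\<And>\<epsilon>. \<epsilon> > 0 \<Longrightarrow> \<exists>g. approximable R g \<and> sqdist f g < ennreal \<epsilon>"
  shows "approximable R f"
  unfolding approximable_def
proof (intro conjI f allI impI)
  fix \<epsilon> :: real assume e: "\<epsilon> > 0"
  then obtain g where g: "approximable R g" "sqdist f g < ennreal (\<epsilon> / 4)" using g[of "\<epsilon> / 4"] by auto
  have "\<epsilon> / 4 > 0" using e by simp
  with g(1) obtain \<eta> where \<eta>: "\<eta> \<in> test_functions" "\<And>y. norm y \<ge> R + 1 \<Longrightarrow> \<eta> y = 0" "sqdist g \<eta> < ennreal (\<epsilon> / 4)"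
    unfolding approximable_def by blast
  have "sqdist f \<eta> \<le> 2 * sqdist f g + 2 * sqdist g \<eta>"
    using g(1) unfolding approximable_def by (intro sqdist_triangle[OF f _ test_measurable[OF \<eta>(1)]]) blast
  also have "\<dots> < 2 * ennreal (\<epsilon> / 4) + 2 * ennreal (\<epsilon> / 4)"
    by (intro add_strict_mono ennreal_mult_strict_left_mono g(2) \<eta>(3)) auto
  also have "\<dots> = ennreal \<epsilon>" using e by (simp flip: ennreal_numeral ennreal_mult ennreal_plus)
  finally show "\<exists>\<eta>\<in>test_functions. (\<forall>y. norm y \<ge> R + 1 \<longrightarrow> \<eta> y = 0) \<and> sqdist f \<eta> < ennreal \<epsilon>"
    using \<eta> by blast
qed

lemma approximable_add:
  fixes f g :: "real^'n \<Rightarrow> complex"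
  assumes f: "approximable R f" and g: "approximable R g"
  shows "approximable R (\<lambda>y. f y + g y)"
  unfolding approximable_def
proof (intro conjI allI impI)
  have fm[measurable]: "f \<in> borel_measurable borel" and gm[measurable]: "g \<in> borel_measurable borel" using assms by (auto simp: approximable_def)
  show m[measurable]: "(\<lambda>y. f y + g y) \<in> borel_measurable borel" by measurable
  fix \<epsilon> :: real assume e: "\<epsilon> > 0"
  hence e4: "\<epsilon> / 4 > 0" by simp
  obtain \<eta> where \<eta>: "\<eta> \<in> test_functions" "\<And>y. norm y \<ge> R + 1 \<Longrightarrow> \<eta> y = 0" "sqdist f \<eta> < ennreal (\<epsilon> / 4)"
    using f e4 unfolding approximable_def by blast
  obtain \<theta> where \<theta>: "\<theta> \<in> test_functions" "\<And>y. norm y \<ge> R + 1 \<Longrightarrow> \<theta> y = 0" "sqdist g \<theta> < ennreal (\<epsilon> / 4)"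
    using g e4 unfolding approximable_def by blast
  note [measurable] = test_measurable[OF \<eta>(1)] test_measurable[OF \<theta>(1)]
  have "sqdist (\<lambda>y. f y + g y) (\<lambda>y. \<eta> y + \<theta> y) \<le> 2 * sqdist (\<lambda>y. f y + g y) (\<lambda>y. \<eta> y + g y) + 2 * sqdist (\<lambda>y. \<eta> y + g y) (\<lambda>y. \<eta> y + \<theta> y)"
    by (rule sqdist_triangle) measurable
  also have "\<dots> = 2 * sqdist f \<eta> + 2 * sqdist g \<theta>" by (simp add: sqdist_def)
  also have "\<dots> < 2 * ennreal (\<epsilon> / 4) + 2 * ennreal (\<epsilon> / 4)"
    by (intro add_strict_mono ennreal_mult_strict_left_mono \<theta>(3) \<eta>(3)) auto
  also have "\<dots> = ennreal \<epsilon>" using e by (simp flip: ennreal_numeral ennreal_mult ennreal_plus)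
  finally show "\<exists>\<eta>\<in>test_functions. (\<forall>y. norm y \<ge> R + 1 \<longrightarrow> \<eta> y = 0) \<and> sqdist (\<lambda>y. f y + g y) \<eta> < ennreal \<epsilon>"
    using \<eta>(2) \<theta>(2) by (intro bexI[of _ "\<lambda>y. \<eta> y + \<theta> y"] conjI test_add \<eta>(1) \<theta>(1)) auto
qed

lemma approximable_cmult:
  fixes f :: "real^'n \<Rightarrow> complex"
  assumes f: "approximable R f"
  shows "approximable R (\<lambda>y. c * f y)"
  unfolding approximable_def
proof (intro conjI allI impI)
  have fm[measurable]: "f \<in> borel_measurable borel" using assms by (auto simp: approximable_def)
  show m[measurable]: "(\<lambda>y. c * f y) \<in> borel_measurable borel" by measurable
  fix \<epsilon> :: real assume e: "\<epsilon> > 0"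
  let ?k = "(norm c)\<^sup>2 + 1"
  have k: "?k > 0" by (simp add: add_nonneg_pos)
  have ek: "\<epsilon> / ?k > 0" using e k by (rule divide_pos_pos)
  obtain \<eta> where \<eta>: "\<eta> \<in> test_functions" "\<And>y. norm y \<ge> R + 1 \<Longrightarrow> \<eta> y = 0" "sqdist f \<eta> < ennreal (\<epsilon> / ?k)"
    using f ek unfolding approximable_def by blast
  note [measurable] = test_measurable[OF \<eta>(1)]
  have "sqdist (\<lambda>y. c * f y) (\<lambda>y. c * \<eta> y) = (\<integral>\<^sup>+y. ennreal ((norm c)\<^sup>2) * ennreal ((norm (f y - \<eta> y))\<^sup>2) \<partial>lborel)"
    unfolding sqdist_def
    by (intro nn_integral_cong) (simp add: norm_mult power_mult_distrib flip: right_diff_distrib ennreal_mult)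
  also have "\<dots> = ennreal ((norm c)\<^sup>2) * sqdist f \<eta>" unfolding sqdist_def by (rule nn_integral_cmult) measurable
  also have "\<dots> \<le> ennreal ?k * sqdist f \<eta>" by (intro mult_right_mono ennreal_leI) auto
  also have "\<dots> < ennreal ?k * ennreal (\<epsilon> / ?k)"
  proof (rule ennreal_mult_strict_left_mono[OF \<eta>(3)])
    show "0 < ennreal ?k" using k by (simp only: ennreal_less_zero_iff)
  qed (rule ennreal_less_top)
  also have "\<dots> = ennreal (?k * (\<epsilon> / ?k))" using k ek by (intro ennreal_mult[symmetric]) auto
  also have "?k * (\<epsilon> / ?k) = \<epsilon>" using k by simp
  finally show "\<exists>\<eta>\<in>test_functions. (\<forall>y. norm y \<ge> R + 1 \<longrightarrow> \<eta> y = 0) \<and> sqdist (\<lambda>y. c * f y) \<eta> < ennreal \<epsilon>"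
    using \<eta>(2) by (intro bexI[of _ "\<lambda>y. c * \<eta> y"] conjI test_cmult \<eta>(1)) auto
qed

lemma approximable_0: "approximable R (\<lambda>y. 0)"
  unfolding approximable_def by (auto simp: sqdist_def intro!: bexI[OF _ test_0])

lemma approximable_sum: "finite I \<Longrightarrow> (\<And>i. i \<in> I \<Longrightarrow> approximable R (f i)) \<Longrightarrow> approximable R (\<lambda>y. \<Sum>i\<in>I. f i y)"
  by (induction I rule: finite_induct) (auto intro: approximable_0 approximable_add)

lemma approximable_compact:
  fixes K :: "(real^'n) set"
  assumes K: "compact K" "K \<subseteq> cball 0 R"
  shows "approximable R (indicator K)"
  unfolding approximable_def
proof (intro conjI allI impI)
  have [measurable]: "K \<in> sets borel" using K(1) by (rule borel_compact)
  show "indicator K \<in> borel_measurable borel" by measurable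
  fix \<epsilon> :: real assume e: "\<epsilon> > 0"
  obtain e where e: "\<And>n. (\<lambda>y. complex_of_real (e n y)) \<in> test_functions" "\<And>n y. 0 \<le> e n y" "\<And>n y. e n y \<le> 1"
    "\<And>n y. norm y \<ge> R + 1 \<Longrightarrow> e n y = 0" "\<And>y. (\<lambda>n. e n y) \<longlonglongrightarrow> indicator K y" by (rule compact_indicator_limit[OF K]) blast
  have em [measurable]: "(\<lambda>y. complex_of_real (e n y)) \<in> borel_measurable borel" for n by (rule test_measurable[OF e(1)])
  have [measurable]: "e n \<in> borel_measurable borel" for n
    using measurable_compose[OF em[of n] borel_measurable_Re] by simp
  have "(\<lambda>n. sqdist (indicator K) (\<lambda>y. of_real (e n y))) \<longlonglongrightarrow> (\<integral>\<^sup>+y. 0 \<partial>(lborel :: (real^'n) measure))"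
    unfolding sqdist_def
  proof (rule nn_integral_dominated_convergence[where w = "indicator (cball 0 (R + 1))"])
    show "(\<integral>\<^sup>+ x. indicator (cball 0 (R + 1)) x \<partial>(lborel :: (real^'n) measure)) < \<infinity>"
      using emeasure_bounded_finite[OF bounded_cball, of "0::real^'n" "R + 1"] by simp
    show "AE x in lborel. ennreal ((norm (indicator K x - complex_of_real (e j x)))\<^sup>2) \<le> indicator (cball 0 (R + 1)) x" for j
    proof (rule AE_I2)
      fix x
      have eq: "norm (indicator K x - complex_of_real (e j x)) = \<bar>indicator K x - e j x\<bar>"
      proof -
        have "(indicator K x :: complex) = of_real (indicator K x)" by (simp add: indicator_def)
        thus ?thesis by (metis norm_of_real of_real_diff)
      qed
      have "\<bar>indicator K x - e j x\<bar> \<le> indicator (cball 0 (R + 1)) x"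
        using K(2) e(2)[of j x] e(3)[of j x] e(4)[of x j] by (cases "norm x \<le> R + 1") (auto simp: indicator_def)
      hence "\<bar>indicator K x - e j x\<bar>\<^sup>2 \<le> (indicator (cball 0 (R + 1)) x)\<^sup>2" by (rule power_mono) simp
      hence "ennreal (\<bar>indicator K x - e j x\<bar>\<^sup>2) \<le> ennreal ((indicator (cball 0 (R + 1)) x)\<^sup>2)" by (rule ennreal_leI)
      also have "ennreal ((indicator (cball 0 (R + 1)) x)\<^sup>2) = indicator (cball 0 (R + 1)) x"
        by (cases "x \<in> cball 0 (R + 1)") auto
      finally show "ennreal ((norm (indicator K x - complex_of_real (e j x)))\<^sup>2) \<le> indicator (cball 0 (R + 1)) x"
        unfolding eq .
    qed
    show "AE x in lborel. (\<lambda>n. ennreal ((norm (indicator K x - complex_of_real (e n x)))\<^sup>2)) \<longlonglongrightarrow> 0"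
    proof (rule AE_I2)
      fix x
      have "(\<lambda>n. ennreal ((norm (indicator K x - complex_of_real (e n x)))\<^sup>2)) \<longlonglongrightarrow> ennreal ((norm (indicator K x - complex_of_real (indicator K x)))\<^sup>2)"
        by (intro tendsto_ennrealI tendsto_intros e(5))
      moreover have "indicator K x - complex_of_real (indicator K x) = 0" by (simp add: indicator_def)
      ultimately show "(\<lambda>n. ennreal ((norm (indicator K x - complex_of_real (e n x)))\<^sup>2)) \<longlonglongrightarrow> 0"
        by (simp only: norm_zero power_zero_numeral ennreal_0)
    qed
    show "(\<lambda>y. ennreal ((norm (indicator K y - complex_of_real (e i y)))\<^sup>2)) \<in> borel_measurable lborel" for i
      by measurable
    show "(indicator (cball 0 (R + 1)) :: real^'n \<Rightarrow> ennreal) \<in> borel_measurable lborel"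
      by (intro borel_measurable_indicator) simp
  qed simp
  hence "(\<lambda>n. sqdist (indicator K) (\<lambda>y. of_real (e n y))) \<longlonglongrightarrow> 0" by simp
  moreover have "0 < ennreal \<epsilon>" using \<open>\<epsilon> > 0\<close> by simp
  ultimately have "\<forall>\<^sub>F n in sequentially. sqdist (indicator K) (\<lambda>y. of_real (e n y)) < ennreal \<epsilon>" by (rule order_tendstoD(2))
  then obtain n where "sqdist (indicator K) (\<lambda>y. of_real (e n y)) < ennreal \<epsilon>" by (auto simp: eventually_sequentially)
  thus "\<exists>\<eta>\<in>test_functions. (\<forall>y. norm y \<ge> R + 1 \<longrightarrow> \<eta> y = 0) \<and> sqdist (indicator K) \<eta> < ennreal \<epsilon>"
    using e(4) by (intro bexI[OF _ e(1)[of n]]) auto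
qed

lemma approximable_indicator:
  fixes A :: "(real^'n) set"
  assumes A [measurable]: "A \<in> sets borel" and AR: "A \<subseteq> cball 0 R"
  shows "approximable R (indicator A)"
proof (rule approximable_limit)
  show "indicator A \<in> borel_measurable borel" by measurable
  fix \<epsilon> :: real assume e: "\<epsilon> > 0"
  have Al: "A \<in> sets lebesgue" using A by simp
  obtain T where T: "closed T" "T \<subseteq> A" "A - T \<in> lmeasurable" "emeasure lebesgue (A - T) < ennreal \<epsilon>"
    by (rule sets_lebesgue_inner_closed[OF Al e])
  have Tm [measurable]: "T \<in> sets borel" using T(1) by simp
  have "bounded T" using T(2) AR bounded_cball by (meson bounded_subset)
  hence "compact T" using T(1) by (simp add: compact_eq_bounded_closed)
  hence "approximable R (indicator T :: _ \<Rightarrow> complex)" using T(2) AR by (intro approximable_compact) auto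
  moreover have "sqdist (indicator A) (indicator T) = (\<integral>\<^sup>+y. indicator (A - T) y \<partial>lborel)"
    unfolding sqdist_def using T(2) by (intro nn_integral_cong) (auto simp: indicator_def)
  hence "sqdist (indicator A) (indicator T) < ennreal \<epsilon>" using T(4) by simp
  ultimately show "\<exists>g. approximable R g \<and> sqdist (indicator A) g < ennreal \<epsilon>" by blast
qed

text \<open>
  The usual ladder: compact sets, bounded Borel sets by inner regularity, simple functions,
  and their limits.
\<close>

theorem approximable_square_integrable:
  fixes f :: "real^'n \<Rightarrow> complex"
  assumes f [measurable]: "f \<in> borel_measurable borel" and fR: "\<And>y. norm y > R \<Longrightarrow> f y = 0"
    and fin: "(\<integral>\<^sup>+y. ennreal ((norm (f y))\<^sup>2) \<partial>lborel) < \<infinity>"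
  shows "approximable R f"
proof (rule approximable_limit[OF f])
  fix \<epsilon> :: real assume e: "\<epsilon> > 0"
  have "f \<in> borel_measurable lborel" by measurable
  from borel_measurable_implies_sequence_metric[OF this, of 0] obtain s where
    s: "\<And>i. simple_function lborel (s i)" "\<And>x. (\<lambda>i. s i x) \<longlonglongrightarrow> f x" "\<And>i x. norm (s i x) \<le> 2 * norm (f x)"
    unfolding space_lborel dist_0_norm norm_conv_dist[symmetric] by auto
  have sm [measurable]: "s i \<in> borel_measurable borel" for i using borel_measurable_simple_function[OF s(1)[of i]] by simp
  have "approximable R (s i)" for i
  proof -
    have fin: "finite (range (s i))" using s(1)[of i] by (simp add: simple_function_def)
    have "approximable R (\<lambda>y. c * indicator (s i -` {c}) y)" for c
    proof (cases "c = 0")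
      case False
      have "s i -` {c} \<in> sets borel" using measurable_sets[OF sm[of i], of "{c}"] by simp
      moreover have "s i -` {c} \<subseteq> cball 0 R"
      proof
        fix y assume "y \<in> s i -` {c}"
        hence "f y \<noteq> 0" using s(3)[of i y] False by auto
        thus "y \<in> cball 0 R" using fR[of y] by (cases "norm y > R") auto
      qed
      ultimately show ?thesis by (intro approximable_cmult approximable_indicator)
    qed (simp add: approximable_0)
    hence "approximable R (\<lambda>y. \<Sum>c\<in>range (s i). c * indicator (s i -` {c}) y)" by (intro approximable_sum fin)
    moreover have "(\<Sum>c\<in>range (s i). c * indicator (s i -` {c}) y) = s i y" for y
    proof -
      have "(\<Sum>c\<in>range (s i). c * indicator (s i -` {c}) y) = (\<Sum>c\<in>range (s i). if c = s i y then c else 0)"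
        by (intro sum.cong) (auto simp: indicator_def)
      also have "\<dots> = s i y" using fin by (subst sum.delta) auto
      finally show ?thesis .
    qed
    ultimately show ?thesis by simp
  qed
  moreover have "(\<lambda>i. sqdist f (s i)) \<longlonglongrightarrow> (\<integral>\<^sup>+y. 0 \<partial>(lborel :: (real^'n) measure))"
    unfolding sqdist_def
  proof (rule nn_integral_dominated_convergence[where w = "\<lambda>y. 9 * ennreal ((norm (f y))\<^sup>2)"])
    show "(\<integral>\<^sup>+ y. 9 * ennreal ((norm (f y))\<^sup>2) \<partial>lborel) < \<infinity>"
      using fin by (subst nn_integral_cmult) (auto simp: ennreal_mult_less_top)
    show "AE y in lborel. ennreal ((norm (f y - s j y))\<^sup>2) \<le> 9 * ennreal ((norm (f y))\<^sup>2)" for j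
    proof (rule AE_I2)
      fix y
      have "norm (f y - s j y) \<le> 3 * norm (f y)" using s(3)[of j y] norm_triangle_ineq4[of "f y" "s j y"] by simp
      hence "(norm (f y - s j y))\<^sup>2 \<le> (3 * norm (f y))\<^sup>2" by (rule power_mono) simp
      hence "ennreal ((norm (f y - s j y))\<^sup>2) \<le> ennreal (9 * (norm (f y))\<^sup>2)" by (intro ennreal_leI) (simp add: power_mult_distrib)
      thus "ennreal ((norm (f y - s j y))\<^sup>2) \<le> 9 * ennreal ((norm (f y))\<^sup>2)" by (simp add: ennreal_mult)
    qed
    show "AE y in lborel. (\<lambda>i. ennreal ((norm (f y - s i y))\<^sup>2)) \<longlonglongrightarrow> 0"
    proof (rule AE_I2)
      fix y
      have "(\<lambda>i. ennreal ((norm (f y - s i y))\<^sup>2)) \<longlonglongrightarrow> ennreal ((norm (f y - f y))\<^sup>2)"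
        by (intro tendsto_ennrealI tendsto_intros s(2))
      thus "(\<lambda>i. ennreal ((norm (f y - s i y))\<^sup>2)) \<longlonglongrightarrow> 0" by simp
    qed
  qed measurable
  hence "(\<lambda>i. sqdist f (s i)) \<longlonglongrightarrow> 0" by simp
  moreover have "0 < ennreal \<epsilon>" using e by simp
  ultimately have "\<forall>\<^sub>F i in sequentially. approximable R (s i) \<and> sqdist f (s i) < ennreal \<epsilon>"
    using order_tendstoD(2)[of "\<lambda>i. sqdist f (s i)" 0 sequentially "ennreal \<epsilon>"] by simp
  then obtain i where "approximable R (s i) \<and> sqdist f (s i) < ennreal \<epsilon>" by (auto simp: eventually_sequentially)
  thus "\<exists>g. approximable R g \<and> sqdist f g < ennreal \<epsilon>" by blast
qed

lemma square_integrable_mult: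
  fixes f g :: "'a \<Rightarrow> complex"
  assumes [measurable]: "f \<in> borel_measurable M" "g \<in> borel_measurable M"
    and "integrable M (\<lambda>x. (norm (f x))\<^sup>2)" "integrable M (\<lambda>x. (norm (g x))\<^sup>2)"
  shows "integrable M (\<lambda>x. f x * g x)"
proof (rule Bochner_Integration.integrable_bound)
  show "integrable M (\<lambda>x. (norm (f x))\<^sup>2 + (norm (g x))\<^sup>2)" by (intro Bochner_Integration.integrable_add assms)
  show "AE x in M. norm (f x * g x) \<le> norm ((norm (f x))\<^sup>2 + (norm (g x))\<^sup>2)"
    using mult_le_sum_squares by (intro AE_I2) (simp add: norm_mult)
qed measurable

lemma test_square_integrable: "\<eta> \<in> test_functions \<Longrightarrow> integrable lborel (\<lambda>x. (norm (\<eta> x))\<^sup>2)"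
proof -
  assume \<eta>: "\<eta> \<in> test_functions"
  obtain R where R: "\<And>x. norm x \<ge> R \<Longrightarrow> \<eta> x = 0" by (rule test_functionsE[OF \<eta>]) auto
  have "integrable lborel (\<lambda>x. complex_of_real ((norm (\<eta> x))\<^sup>2))"
  proof (rule vanishing_integrable[where R = R])
    show "continuous_on UNIV (\<lambda>x. complex_of_real ((norm (\<eta> x))\<^sup>2))"
      by (intro continuous_intros smooth_continuous test_smooth[OF \<eta>])
  qed (simp add: R)
  thus ?thesis by (simp only: complex_of_real_integrable_eq)
qed

lemma sq_integrable_nn: "integrable M (\<lambda>x. (norm (f x))\<^sup>2) \<Longrightarrow> (\<integral>\<^sup>+x. ennreal ((norm (f x))\<^sup>2) \<partial>M) = ennreal (\<integral>x. (norm (f x))\<^sup>2 \<partial>M)"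
  by (rule nn_integral_eq_integral) auto

lemma scaled_AMGM: "t > 0 \<Longrightarrow> a * b \<le> 1/2 * (t * a\<^sup>2) + 1/2 * (b\<^sup>2 / (t::real))"
proof -
  assume t: "t > 0"
  have "0 \<le> (sqrt t * a - b / sqrt t)\<^sup>2" by simp
  also have "\<dots> = t * a\<^sup>2 + b\<^sup>2 / t - 2 * (a * b)" using t by (simp add: power2_diff power_mult_distrib power_divide)
  finally show ?thesis by simp
qed

lemma scaled_square_sum: "t > 0 \<Longrightarrow> (a + b)\<^sup>2 \<le> (1 + t) * a\<^sup>2 + (1 + 1 / t) * (b::real)\<^sup>2"
  using scaled_AMGM[of t a b] by (simp add: power2_sum algebra_simps)

text \<open>
  A sequence with one common rate for the three quantities to which duality is applied: the
  pairing with \<open>\<psi>\<close>, the \<open>L\<^sup>1\<close> norm (for the boundedness of eigenfunctions) and the weighted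
  \<open>L\<^sup>2\<close> norm (for the resolvent estimate).
\<close>

lemma approximating_test_functions:
  fixes f \<psi> :: "real^'n \<Rightarrow> complex"
  assumes f [measurable]: "f \<in> borel_measurable borel" and fR: "\<And>y. norm y > R \<Longrightarrow> f y = 0"
    and f2: "integrable lborel (\<lambda>y. (norm (f y))\<^sup>2)"
    and \<psi> [measurable]: "\<psi> \<in> borel_measurable borel" and \<psi>2: "integrable lborel (\<lambda>y. (norm (\<psi> y))\<^sup>2)"
  obtains \<eta> C where "\<And>k. \<eta> k \<in> test_functions" "C \<ge> 0"
    "\<And>k. norm ((\<integral>y. \<psi> y * \<eta> k y \<partial>lborel) - (\<integral>y. \<psi> y * f y \<partial>lborel)) \<le> C * (1 / real (Suc k))"
    "\<And>k. (\<integral>\<^sup>+y. ennreal (norm (\<eta> k y)) \<partial>lborel) \<le> (\<integral>\<^sup>+y. ennreal (norm (f y)) \<partial>lborel) + ennreal (C * (1 / real (Suc k)))"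
    "\<And>k. (\<integral>\<^sup>+y. ennreal ((norm (\<eta> k y))\<^sup>2 * (norm y)\<^sup>2) \<partial>lborel) \<le>
        ennreal (1 + 1 / real (Suc k)) * (\<integral>\<^sup>+y. ennreal ((norm (f y))\<^sup>2 * (norm y)\<^sup>2) \<partial>lborel) + ennreal (C * (1 / real (Suc k)))"
proof -
  have [measurable]: "cball (0::real^'n) (R + 1) \<in> sets borel" by simp
  define t where "t k = 1 / real (Suc k)" for k
  have t: "t k > 0" "t k \<le> 1" for k by (auto simp: t_def)
  define S where "S = (\<integral>y. (norm (\<psi> y))\<^sup>2 \<partial>lborel)"
  have S: "(\<integral>\<^sup>+y. ennreal ((norm (\<psi> y))\<^sup>2) \<partial>lborel) = ennreal S" "S \<ge> 0"
    unfolding S_def using sq_integrable_nn[OF \<psi>2] by auto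
  have "emeasure lborel (cball (0::real^'n) (R + 1)) < \<infinity>" by (rule emeasure_bounded_finite) simp
  then obtain v where v: "v \<ge> 0" "emeasure lborel (cball (0::real^'n) (R + 1)) = ennreal v"
    by (cases "emeasure lborel (cball (0::real^'n) (R + 1))") auto
  have "approximable R f"
    by (rule approximable_square_integrable[OF f fR]) (simp_all add: sq_integrable_nn[OF f2])
  \<comment> \<open>The distance is \<open>(t k)\<^sup>2\<close> because the weighted means below cost a factor \<open>1 / t k\<close>.\<close>
  hence "\<forall>k. \<exists>\<eta>. \<eta> \<in> test_functions \<and> (\<forall>y. norm y \<ge> R + 1 \<longrightarrow> \<eta> y = 0) \<and> sqdist f \<eta> < ennreal ((t k)\<^sup>2)"
    unfolding approximable_def using t(1) by (metis zero_less_power)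
  from choice[OF this] obtain \<eta> where \<eta>: "\<And>k. \<eta> k \<in> test_functions" "\<And>k y. norm y \<ge> R + 1 \<Longrightarrow> \<eta> k y = 0"
    "\<And>k. sqdist f (\<eta> k) < ennreal ((t k)\<^sup>2)" by blast
  have \<eta>m [measurable]: "\<eta> k \<in> borel_measurable borel" for k by (rule test_measurable[OF \<eta>(1)])
  define C where "C = (S + v + 1) + 2 * (R + 1)\<^sup>2"
  have C: "C \<ge> 0" using S v by (simp add: C_def)
  show ?thesis
  proof (rule that[OF \<eta>(1) C])
    fix k
    let ?d = "\<lambda>y. norm (f y - \<eta> k y)"
    have sq: "(\<integral>\<^sup>+y. ennreal ((?d y)\<^sup>2) \<partial>lborel) \<le> ennreal ((t k)\<^sup>2)" using \<eta>(3)[of k] by (simp add: sqdist_def)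
    \<comment> \<open>Cauchy-Schwarz in the form \<open>2 a b \<le> t a\<^sup>2 + b\<^sup>2 / t\<close>, so that integrals may stay extended
      real valued.\<close>
    have pair: "(\<integral>\<^sup>+y. ennreal (g y * ?d y) \<partial>lborel) \<le> ennreal (1/2 * (t k * (G + 1)))"
      if g [measurable]: "g \<in> borel_measurable borel" and G: "(\<integral>\<^sup>+y. ennreal ((g y)\<^sup>2) \<partial>lborel) = ennreal G" "G \<ge> 0" for g :: "real^'n \<Rightarrow> real" and G
    proof -
      have "(\<integral>\<^sup>+y. ennreal (g y * ?d y) \<partial>lborel) \<le> (\<integral>\<^sup>+y. ennreal (1/2 * t k) * ennreal ((g y)\<^sup>2) + ennreal (1/2 / t k) * ennreal ((?d y)\<^sup>2) \<partial>lborel)"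
      proof (rule nn_integral_mono)
        fix y
        have "ennreal (g y * ?d y) \<le> ennreal (1/2 * t k * (g y)\<^sup>2 + 1/2 / t k * (?d y)\<^sup>2)"
          using scaled_AMGM[OF t(1), of "g y" "?d y" k] by (intro ennreal_leI) (simp add: mult_ac)
        also have "\<dots> = ennreal (1/2 * t k * (g y)\<^sup>2) + ennreal (1/2 / t k * (?d y)\<^sup>2)"
          using t(1)[of k] by (intro ennreal_plus) (auto intro!: mult_nonneg_nonneg)
        also have "\<dots> = ennreal (1/2 * t k) * ennreal ((g y)\<^sup>2) + ennreal (1/2 / t k) * ennreal ((?d y)\<^sup>2)"
          using t(1)[of k] by (intro arg_cong2[of _ _ _ _ "(+)"] ennreal_mult) auto
        finally show "ennreal (g y * ?d y) \<le> ennreal (1/2 * t k) * ennreal ((g y)\<^sup>2) + ennreal (1/2 / t k) * ennreal ((?d y)\<^sup>2)" .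
      qed
      also have "\<dots> = (\<integral>\<^sup>+y. ennreal (1/2 * t k) * ennreal ((g y)\<^sup>2) \<partial>lborel) + (\<integral>\<^sup>+y. ennreal (1/2 / t k) * ennreal ((?d y)\<^sup>2) \<partial>lborel)"
        by (rule nn_integral_add) auto
      also have "(\<integral>\<^sup>+y. ennreal (1/2 * t k) * ennreal ((g y)\<^sup>2) \<partial>lborel) = ennreal (1/2 * t k) * ennreal G"
        unfolding G(1)[symmetric] by (rule nn_integral_cmult) auto
      also have "(\<integral>\<^sup>+y. ennreal (1/2 / t k) * ennreal ((?d y)\<^sup>2) \<partial>lborel) = ennreal (1/2 / t k) * (\<integral>\<^sup>+y. ennreal ((?d y)\<^sup>2) \<partial>lborel)"
        by (rule nn_integral_cmult) auto
      also have "ennreal (1/2 * t k) * ennreal G + ennreal (1/2 / t k) * (\<integral>\<^sup>+y. ennreal ((?d y)\<^sup>2) \<partial>lborel)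
          \<le> ennreal (1/2 * t k) * ennreal G + ennreal (1/2 / t k) * ennreal ((t k)\<^sup>2)"
        by (intro add_left_mono mult_left_mono sq) auto
      also have "\<dots> = ennreal (1/2 * t k * G) + ennreal (1/2 / t k * (t k)\<^sup>2)"
        using t(1)[of k] G(2) by (intro arg_cong2[of _ _ _ _ "(+)"] ennreal_mult[symmetric]) auto
      also have "\<dots> = ennreal (1/2 * t k * G + 1/2 / t k * (t k)\<^sup>2)"
        using t(1)[of k] G(2) by (intro ennreal_plus[symmetric]) auto
      also have "1/2 * t k * G + 1/2 / t k * (t k)\<^sup>2 = 1/2 * (t k * (G + 1))"
        using t(1)[of k] by (simp add: power2_eq_square algebra_simps)
      finally show ?thesis .
    qed
    have i1: "integrable lborel (\<lambda>y. \<psi> y * \<eta> k y)"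
      by (rule square_integrable_mult) (auto intro: \<psi>2 test_square_integrable \<eta>)
    have i2: "integrable lborel (\<lambda>y. \<psi> y * f y)"
      by (rule square_integrable_mult) (auto intro: \<psi>2 f2)
    have "ennreal (norm ((\<integral>y. \<psi> y * \<eta> k y \<partial>lborel) - (\<integral>y. \<psi> y * f y \<partial>lborel))) = ennreal (norm (\<integral>y. \<psi> y * \<eta> k y - \<psi> y * f y \<partial>lborel))"
      by (simp only: Bochner_Integration.integral_diff[OF i1 i2])
    also have "\<dots> \<le> (\<integral>\<^sup>+y. ennreal (norm (\<psi> y * \<eta> k y - \<psi> y * f y)) \<partial>lborel)"
      by (rule integral_norm_bound_ennreal) (intro Bochner_Integration.integrable_diff i1 i2)
    also have "\<dots> = (\<integral>\<^sup>+y. ennreal (norm (\<psi> y) * ?d y) \<partial>lborel)"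
      by (intro nn_integral_cong) (simp add: norm_mult norm_minus_commute flip: right_diff_distrib)
    also have "\<dots> \<le> ennreal (1/2 * (t k * (S + 1)))" by (rule pair) (auto simp: S)
    also have "\<dots> \<le> ennreal (C * t k)"
      using S v t(1)[of k] by (intro ennreal_leI) (simp add: C_def field_simps mult_right_mono add_nonneg_nonneg)
    finally show "norm ((\<integral>y. \<psi> y * \<eta> k y \<partial>lborel) - (\<integral>y. \<psi> y * f y \<partial>lborel)) \<le> C * (1 / real (Suc k))"
      using C t(1)[of k] by (simp add: t_def ennreal_le_iff)
    show "(\<integral>\<^sup>+y. ennreal (norm (\<eta> k y)) \<partial>lborel) \<le> (\<integral>\<^sup>+y. ennreal (norm (f y)) \<partial>lborel) + ennreal (C * (1 / real (Suc k)))"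
    proof -
      have "(\<integral>\<^sup>+y. ennreal (norm (\<eta> k y)) \<partial>lborel) \<le> (\<integral>\<^sup>+y. ennreal (norm (f y)) + ennreal (indicator (cball 0 (R + 1)) y * ?d y) \<partial>lborel)"
      proof (rule nn_integral_mono)
        fix y
        have "norm (\<eta> k y) \<le> norm (f y) + indicator (cball 0 (R + 1)) y * ?d y"
        proof (cases "norm y \<le> R + 1")
          case True
          thus ?thesis using norm_triangle_ineq4[of "f y" "f y - \<eta> k y"] by simp
        next
          case False
          thus ?thesis using \<eta>(2)[of y k] by simp
        qed
        hence "ennreal (norm (\<eta> k y)) \<le> ennreal (norm (f y) + indicator (cball 0 (R + 1)) y * ?d y)" by (rule ennreal_leI)
        also have "\<dots> = ennreal (norm (f y)) + ennreal (indicator (cball 0 (R + 1)) y * ?d y)" by (intro ennreal_plus) auto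
        finally show "ennreal (norm (\<eta> k y)) \<le> ennreal (norm (f y)) + ennreal (indicator (cball 0 (R + 1)) y * ?d y)" .
      qed
      also have "\<dots> = (\<integral>\<^sup>+y. ennreal (norm (f y)) \<partial>lborel) + (\<integral>\<^sup>+y. ennreal (indicator (cball 0 (R + 1)) y * ?d y) \<partial>lborel)"
        by (rule nn_integral_add) auto
      also have "(\<integral>\<^sup>+y. ennreal (indicator (cball 0 (R + 1)) y * ?d y) \<partial>lborel) \<le> ennreal (1/2 * (t k * (v + 1)))"
      proof (rule pair)
        have "ennreal ((indicator (cball (0::real^'n) (R + 1)) y)\<^sup>2) = indicator (cball 0 (R + 1)) y" for y
          by (cases "y \<in> cball 0 (R + 1)") auto
        thus "(\<integral>\<^sup>+y. ennreal ((indicator (cball (0::real^'n) (R + 1)) y)\<^sup>2) \<partial>lborel) = ennreal v" using v by simp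
      qed (use v in auto)
      also have "\<dots> \<le> ennreal (C * t k)"
        using S v t(1)[of k] by (intro ennreal_leI) (simp add: C_def field_simps mult_right_mono add_nonneg_nonneg)
      finally show ?thesis by (simp add: t_def add_left_mono)
    qed
    show "(\<integral>\<^sup>+y. ennreal ((norm (\<eta> k y))\<^sup>2 * (norm y)\<^sup>2) \<partial>lborel) \<le>
        ennreal (1 + 1 / real (Suc k)) * (\<integral>\<^sup>+y. ennreal ((norm (f y))\<^sup>2 * (norm y)\<^sup>2) \<partial>lborel) + ennreal (C * (1 / real (Suc k)))"
    proof -
      let ?W = "(1 + 1 / t k) * (R + 1)\<^sup>2"
      have W: "?W \<ge> 0" using t(1)[of k] by simp
      have "(\<integral>\<^sup>+y. ennreal ((norm (\<eta> k y))\<^sup>2 * (norm y)\<^sup>2) \<partial>lborel) \<le>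
        (\<integral>\<^sup>+y. ennreal (1 + t k) * ennreal ((norm (f y))\<^sup>2 * (norm y)\<^sup>2) + ennreal ?W * ennreal ((?d y)\<^sup>2) \<partial>lborel)"
      proof (rule nn_integral_mono)
        fix y
        have "(norm (\<eta> k y))\<^sup>2 * (norm y)\<^sup>2 \<le> (1 + t k) * ((norm (f y))\<^sup>2 * (norm y)\<^sup>2) + ?W * (?d y)\<^sup>2"
        proof (cases "norm y \<ge> R + 1")
          case True
          have "0 \<le> (1 + t k) * ((norm (f y))\<^sup>2 * (norm y)\<^sup>2) + ?W * (?d y)\<^sup>2"
            using t(1)[of k] W by (intro add_nonneg_nonneg mult_nonneg_nonneg) auto
          thus ?thesis using \<eta>(2)[OF True, of k] by simp
        next
          case False
          have "norm (\<eta> k y) \<le> norm (f y) + ?d y" using norm_triangle_ineq4[of "f y" "f y - \<eta> k y"] by simp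
          hence "(norm (\<eta> k y))\<^sup>2 \<le> (norm (f y) + ?d y)\<^sup>2" by (rule power_mono) simp
          also have "\<dots> \<le> (1 + t k) * (norm (f y))\<^sup>2 + (1 + 1 / t k) * (?d y)\<^sup>2" by (rule scaled_square_sum[OF t(1)])
          finally have "(norm (\<eta> k y))\<^sup>2 * (norm y)\<^sup>2 \<le> ((1 + t k) * (norm (f y))\<^sup>2 + (1 + 1 / t k) * (?d y)\<^sup>2) * (norm y)\<^sup>2"
            by (rule mult_right_mono) simp
          also have "\<dots> = (1 + t k) * ((norm (f y))\<^sup>2 * (norm y)\<^sup>2) + ((1 + 1 / t k) * (?d y)\<^sup>2) * (norm y)\<^sup>2"
            by (simp add: algebra_simps)
          also have "((1 + 1 / t k) * (?d y)\<^sup>2) * (norm y)\<^sup>2 \<le> ((1 + 1 / t k) * (?d y)\<^sup>2) * (R + 1)\<^sup>2"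
            using False t(1)[of k] by (intro mult_left_mono power_mono mult_nonneg_nonneg) auto
          finally show ?thesis by (simp add: mult_ac)
        qed
        hence "ennreal ((norm (\<eta> k y))\<^sup>2 * (norm y)\<^sup>2) \<le> ennreal ((1 + t k) * ((norm (f y))\<^sup>2 * (norm y)\<^sup>2) + ?W * (?d y)\<^sup>2)" by (rule ennreal_leI)
        also have "\<dots> = ennreal ((1 + t k) * ((norm (f y))\<^sup>2 * (norm y)\<^sup>2)) + ennreal (?W * (?d y)\<^sup>2)"
          using t(1)[of k] W by (intro ennreal_plus mult_nonneg_nonneg) auto
        also have "\<dots> = ennreal (1 + t k) * ennreal ((norm (f y))\<^sup>2 * (norm y)\<^sup>2) + ennreal ?W * ennreal ((?d y)\<^sup>2)"
          using t(1)[of k] W by (intro arg_cong2[of _ _ _ _ "(+)"] ennreal_mult) auto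
        finally show "ennreal ((norm (\<eta> k y))\<^sup>2 * (norm y)\<^sup>2) \<le> ennreal (1 + t k) * ennreal ((norm (f y))\<^sup>2 * (norm y)\<^sup>2) + ennreal ?W * ennreal ((?d y)\<^sup>2)" .
      qed
      also have "\<dots> = (\<integral>\<^sup>+y. ennreal (1 + t k) * ennreal ((norm (f y))\<^sup>2 * (norm y)\<^sup>2) \<partial>lborel) + (\<integral>\<^sup>+y. ennreal ?W * ennreal ((?d y)\<^sup>2) \<partial>lborel)"
        by (rule nn_integral_add) auto
      also have "(\<integral>\<^sup>+y. ennreal (1 + t k) * ennreal ((norm (f y))\<^sup>2 * (norm y)\<^sup>2) \<partial>lborel) = ennreal (1 + t k) * (\<integral>\<^sup>+y. ennreal ((norm (f y))\<^sup>2 * (norm y)\<^sup>2) \<partial>lborel)"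
        by (rule nn_integral_cmult) auto
      also have "(\<integral>\<^sup>+y. ennreal ?W * ennreal ((?d y)\<^sup>2) \<partial>lborel) = ennreal ?W * (\<integral>\<^sup>+y. ennreal ((?d y)\<^sup>2) \<partial>lborel)"
        by (rule nn_integral_cmult) auto
      also have "ennreal ?W * (\<integral>\<^sup>+y. ennreal ((?d y)\<^sup>2) \<partial>lborel) \<le> ennreal ?W * ennreal ((t k)\<^sup>2)" by (intro mult_left_mono sq) auto
      also have "ennreal ?W * ennreal ((t k)\<^sup>2) = ennreal (?W * (t k)\<^sup>2)" using W by (intro ennreal_mult[symmetric]) auto
      also have "ennreal (?W * (t k)\<^sup>2) \<le> ennreal (C * t k)"
      proof (rule ennreal_leI)
        have "?W * (t k)\<^sup>2 = (R + 1)\<^sup>2 * (t k + 1) * t k" using t(1)[of k] by (simp add: power2_eq_square field_simps)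
        also have "\<dots> \<le> (R + 1)\<^sup>2 * 2 * t k" using t[of k] by (intro mult_right_mono mult_left_mono) auto
        also have "\<dots> \<le> C * t k" using S v t(1)[of k] by (intro mult_right_mono) (auto simp: C_def)
        finally show "?W * (t k)\<^sup>2 \<le> C * t k" .
      qed
      finally show ?thesis by (simp add: t_def add_left_mono)
    qed
  qed
qed

section \<open>Boundedness from a square-integrable Laplacian\<close>

lemma conv_yukawa_partials_decay:
  assumes z: "Re z \<ge> 0" and u: "u \<in> test_functions"
  shows "\<exists>C. \<forall>x. norm (partials is (conv (yukawa z) u) x) \<le> C / (1 + norm x)"
proof -
  obtain C where "\<And>x. norm (conv (yukawa z) (partials is u) x) \<le> C / (1 + norm x)"
    by (rule conv_yukawa_decay[OF z test_partials[OF u, of "is"]]) blast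
  thus ?thesis unfolding partials_conv[OF yukawa_locally_integrable[OF z] u] by blast
qed

lemma smooth_conv_yukawa: "Re z \<ge> 0 \<Longrightarrow> u \<in> test_functions \<Longrightarrow> smooth (conv (yukawa z) u)"
  by (rule smooth_conv[OF yukawa_locally_integrable])

lemma L2_mult_test_integrable:
  assumes "\<psi> \<in> borel_measurable borel" "integrable lborel (\<lambda>y. (norm (\<psi> y))\<^sup>2)" "\<eta> \<in> test_functions"
  shows "integrable lborel (\<lambda>y. \<psi> y * \<eta> y)"
proof (rule square_integrable_mult)
  show "\<psi> \<in> borel_measurable lborel" using assms(1) by simp
  show "\<eta> \<in> borel_measurable lborel" using test_measurable[OF assms(3)] by simp
qed (rule assms(2), rule test_square_integrable[OF assms(3)])

text \<open>
  How a tested equation survives the removal of the cut-off: the main term converges by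
  domination, the truncation error vanishes.
\<close>

lemma cutoff_pairing_limit:
  fixes \<phi> \<psi> :: "real^3 \<Rightarrow> complex"
  assumes F: "F \<in> cutoff_errors \<phi>" and sm: "smooth \<phi>"
    and \<phi>: "\<And>is. \<exists>C. \<forall>x. norm (partials is \<phi> x) \<le> C / (1 + norm x)"
    and \<psi>m [measurable]: "\<psi> \<in> borel_measurable borel" and \<psi>: "integrable lborel (\<lambda>x. (norm (\<psi> x))\<^sup>2)"
    and \<eta>: "\<eta> \<in> test_functions"
  shows "(\<lambda>n. \<integral>x. \<psi> x * (a * (cutoff n x * \<eta> x) + F n x) \<partial>lborel) \<longlonglongrightarrow> a * (\<integral>x. \<psi> x * \<eta> x \<partial>lborel)"
proof -
  note [measurable] = test_measurable[OF \<eta>] test_measurable[OF cutoff_test]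
  have i: "integrable lborel (\<lambda>x. \<psi> x * (cutoff n x * \<eta> x))" for n
    by (rule L2_mult_test_integrable[OF \<psi>m \<psi> test_mult[OF smooth_cutoff \<eta>]])
  have "(\<lambda>n. \<integral>x. \<psi> x * (cutoff n x * \<eta> x) \<partial>lborel) \<longlonglongrightarrow> (\<integral>x. \<psi> x * \<eta> x \<partial>lborel)"
  proof (rule integral_dominated_convergence[where w = "\<lambda>x. norm (\<psi> x * \<eta> x)"])
    show "integrable lborel (\<lambda>x. norm (\<psi> x * \<eta> x))" by (rule integrable_norm[OF L2_mult_test_integrable[OF \<psi>m \<psi> \<eta>]])
    show "AE x in lborel. norm (\<psi> x * (cutoff n x * \<eta> x)) \<le> norm (\<psi> x * \<eta> x)" for n
    proof (rule AE_I2)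
      fix x
      have "norm (cutoff n x) * norm (\<psi> x * \<eta> x) \<le> 1 * norm (\<psi> x * \<eta> x)" by (intro mult_right_mono norm_cutoff_le) auto
      thus "norm (\<psi> x * (cutoff n x * \<eta> x)) \<le> norm (\<psi> x * \<eta> x)" by (simp add: norm_mult mult_ac)
    qed
    show "AE x in lborel. (\<lambda>n. \<psi> x * (cutoff n x * \<eta> x)) \<longlonglongrightarrow> \<psi> x * \<eta> x"
    proof (rule AE_I2)
      fix x
      have "(\<lambda>n. \<psi> x * (cutoff n x * \<eta> x)) \<longlonglongrightarrow> \<psi> x * (1 * \<eta> x)" by (intro tendsto_intros cutoff_tendsto)
      thus "(\<lambda>n. \<psi> x * (cutoff n x * \<eta> x)) \<longlonglongrightarrow> \<psi> x * \<eta> x" by simp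
    qed
  qed measurable
  hence "(\<lambda>n. a * (\<integral>x. \<psi> x * (cutoff n x * \<eta> x) \<partial>lborel) + (\<integral>x. \<psi> x * F n x \<partial>lborel)) \<longlonglongrightarrow> a * (\<integral>x. \<psi> x * \<eta> x \<partial>lborel) + 0"
    by (intro tendsto_add tendsto_mult tendsto_const cutoff_errors_integral(1)[OF F sm \<phi> \<psi>m \<psi>])
  moreover have "(\<integral>x. \<psi> x * (a * (cutoff n x * \<eta> x) + F n x) \<partial>lborel) = a * (\<integral>x. \<psi> x * (cutoff n x * \<eta> x) \<partial>lborel) + (\<integral>x. \<psi> x * F n x \<partial>lborel)" for n
  proof -
    have "(\<integral>x. \<psi> x * (a * (cutoff n x * \<eta> x) + F n x) \<partial>lborel) = (\<integral>x. a * (\<psi> x * (cutoff n x * \<eta> x)) + \<psi> x * F n x \<partial>lborel)"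
      by (simp add: algebra_simps)
    also have "\<dots> = (\<integral>x. a * (\<psi> x * (cutoff n x * \<eta> x)) \<partial>lborel) + (\<integral>x. \<psi> x * F n x \<partial>lborel)"
      by (intro Bochner_Integration.integral_add integrable_mult_right i cutoff_errors_integral(2)[OF F sm \<phi> \<psi>m \<psi>])
    finally show ?thesis by simp
  qed
  ultimately show ?thesis by simp
qed

text \<open>True in dimension three because \<open>1/\<bar>x\<bar>\<^sup>2\<close> is integrable at the origin.\<close>

lemma yukawa_1_square_integrable: "(\<integral>\<^sup>+x. ennreal ((norm (yukawa 1 x))\<^sup>2) \<partial>lborel) < \<infinity>"
proof -
  have "integrable lborel (\<lambda>x::real^3. 2 * exp 1 * (norm x powr -2 * (1 + norm x) powr -2))"
    by (intro integrable_mult_right powr_integrable) auto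
  hence "integrable lborel (\<lambda>x::real^3. (norm (yukawa 1 x))\<^sup>2)"
  proof (rule Bochner_Integration.integrable_bound)
    show "AE x in lborel. norm ((norm (yukawa 1 x))\<^sup>2) \<le> norm (2 * exp 1 * (norm x powr -2 * (1 + norm x) powr -2))"
      using AE_lborel_singleton[of "0::real^3"]
    proof eventually_elim
      fix x :: "real^3" assume x: "x \<noteq> 0"
      have p: "1 + norm x > 0" by (simp add: add_pos_nonneg)
      have "(1 + norm x) ^ 2 \<le> fact 2 * exp (1 + norm x)" by (rule power_le_fact_exp) simp
      also have "\<dots> \<le> 2 * (exp 1 * exp (norm x))" by (simp add: fact_numeral exp_add)
      also have "\<dots> \<le> 2 * (exp 1 * exp (2 * norm x))" by simp
      finally have "exp (- (2 * norm x)) \<le> 2 * exp 1 * inverse ((1 + norm x)\<^sup>2)"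
        using p by (simp add: exp_minus divide_simps mult_ac)
      hence "exp (- (2 * norm x)) * inverse ((norm x)\<^sup>2) \<le> 2 * exp 1 * inverse ((1 + norm x)\<^sup>2) * inverse ((norm x)\<^sup>2)"
        by (rule mult_right_mono) simp
      moreover have "(norm (yukawa 1 x))\<^sup>2 = exp (- (2 * norm x)) * inverse ((norm x)\<^sup>2)"
      proof -
        have "norm (yukawa 1 x) = exp (- norm x) * inverse (norm x)"
          by (simp add: yukawa_def norm_divide divide_inverse norm_mult norm_inverse)
        moreover have "(exp (- norm x))\<^sup>2 = exp (- (2 * norm x))" using exp_double[of "- norm x"] by simp
        ultimately show ?thesis by (simp only: power_mult_distrib power_inverse)
      qed
      ultimately have "(norm (yukawa 1 x))\<^sup>2 \<le> 2 * exp 1 * (norm x powr -2 * (1 + norm x) powr -2)"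
        using x p by (simp add: powr_minus powr_numeral mult_ac)
      thus "norm ((norm (yukawa 1 x))\<^sup>2) \<le> norm (2 * exp 1 * (norm x powr -2 * (1 + norm x) powr -2))" by simp
    qed
  qed measurable
  from nn_integral_eq_integral[OF this] show ?thesis by simp
qed

text \<open>
  Let \<open>\<phi> = exp (-r)/r * \<eta>\<close>. Up to \<open>Newton_const\<close>, \<open>\<integral>\<psi>\<eta> = \<integral>\<psi>(1-\<Delta>)\<phi> = \<integral>(\<psi>-L)\<phi>\<close>, and since \<open>\<psi> -
  L\<close> and the kernel are square-integrable, the double integral on the right is at most a
  constant times the \<open>L\<^sup>1\<close> norm of \<open>\<eta>\<close>.
\<close>

lemma pairing_le_L1_norm:
  fixes \<psi> L :: "real^3 \<Rightarrow> complex"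
  assumes \<psi>m [measurable]: "\<psi> \<in> borel_measurable borel" and \<psi>2: "integrable lborel (\<lambda>x. (norm (\<psi> x))\<^sup>2)"
    and Lm [measurable]: "L \<in> borel_measurable borel" and L2: "integrable lborel (\<lambda>x. (norm (L x))\<^sup>2)"
    and weak: "\<And>\<eta>. \<eta> \<in> test_functions \<Longrightarrow> (\<integral>x. \<psi> x * lap \<eta> x \<partial>lborel) = (\<integral>x. L x * \<eta> x \<partial>lborel)"
  obtains M where "M \<ge> 0" "\<And>\<eta>. \<eta> \<in> test_functions \<Longrightarrow> ennreal (norm (\<integral>x. \<psi> x * \<eta> x \<partial>lborel)) \<le> ennreal M * (\<integral>\<^sup>+x. ennreal (norm (\<eta> x)) \<partial>lborel)"
proof -
  define f where "f x = L x - \<psi> x" for x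
  have fm [measurable]: "f \<in> borel_measurable borel" unfolding f_def by measurable
  have f2: "integrable lborel (\<lambda>x. (norm (f x))\<^sup>2)"
  proof (rule Bochner_Integration.integrable_bound)
    show "integrable lborel (\<lambda>x. 2 * (norm (L x))\<^sup>2 + 2 * (norm (\<psi> x))\<^sup>2)"
      by (intro Bochner_Integration.integrable_add integrable_mult_right \<psi>2 L2)
    show "AE x in lborel. norm ((norm (f x))\<^sup>2) \<le> norm (2 * (norm (L x))\<^sup>2 + 2 * (norm (\<psi> x))\<^sup>2)"
    proof (rule AE_I2)
      fix x
      have "(norm (f x))\<^sup>2 \<le> (norm (L x) + norm (\<psi> x))\<^sup>2" unfolding f_def by (intro power_mono norm_triangle_ineq4) auto
      also have "\<dots> \<le> 2 * (norm (L x))\<^sup>2 + 2 * (norm (\<psi> x))\<^sup>2" using scaled_square_sum[of 1 "norm (L x)" "norm (\<psi> x)"] by simp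
      finally show "norm ((norm (f x))\<^sup>2) \<le> norm (2 * (norm (L x))\<^sup>2 + 2 * (norm (\<psi> x))\<^sup>2)" by simp
    qed
  qed measurable
  define S where "S = (\<integral>x. (norm (f x))\<^sup>2 \<partial>lborel)"
  have S: "(\<integral>\<^sup>+x. ennreal ((norm (f x))\<^sup>2) \<partial>lborel) = ennreal S" "S \<ge> 0" unfolding S_def using sq_integrable_nn[OF f2] by auto
  obtain Q where Q: "(\<integral>\<^sup>+x. ennreal ((norm (yukawa 1 x))\<^sup>2) \<partial>lborel) = ennreal Q" "Q \<ge> 0"
    using yukawa_1_square_integrable by (cases "\<integral>\<^sup>+x. ennreal ((norm (yukawa 1 x))\<^sup>2) \<partial>lborel") auto
  let ?c = Newton_const
  have c: "?c > 0" by (rule Newton_const_pos)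
  show ?thesis
  proof (rule that)
    show "(S + Q) / ?c \<ge> 0" using S Q c by simp
    fix \<eta> :: "real^3 \<Rightarrow> complex" assume \<eta>: "\<eta> \<in> test_functions"
    note [measurable] = test_measurable[OF \<eta>]
    have I: "(\<integral>\<^sup>+x. ennreal (norm (\<eta> x)) \<partial>lborel) = ennreal (\<integral>x. norm (\<eta> x) \<partial>lborel)"
      by (rule nn_integral_eq_integral[OF integrable_norm[OF test_integrable[OF \<eta>]]]) simp
    define I where "I = (\<integral>x. norm (\<eta> x) \<partial>lborel)"
    have I0: "I \<ge> 0" unfolding I_def by simp
    define \<phi> where "\<phi> = conv (yukawa 1) \<eta>"
    have sm: "smooth \<phi>" unfolding \<phi>_def by (rule smooth_conv_yukawa[OF _ \<eta>]) simp
    note [measurable] = smooth_measurable[OF sm]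
    have dec: "\<exists>C. \<forall>x. norm (partials is \<phi> x) \<le> C / (1 + norm x)" for "is"
      unfolding \<phi>_def by (rule conv_yukawa_partials_decay[OF _ \<eta>]) simp
    have eqn: "lap \<phi> x = \<phi> x - of_real ?c * \<eta> x" for x
      unfolding \<phi>_def using conv_yukawa_equation[OF _ \<eta>, of 1 x] by simp
    define \<phi>n where "\<phi>n n x = cutoff n x * \<phi> x" for n x
    have \<phi>n: "\<phi>n n \<in> test_functions" for n unfolding \<phi>n_def by (rule test_mult2[OF cutoff_test sm])
    define E where "E n x = lap (\<phi>n n) x - cutoff n x * lap \<phi> x" for n x
    have E: "E \<in> cutoff_errors \<phi>" unfolding E_def[abs_def] \<phi>n_def using lap_cutoff_mult[OF sm] by simp
    have dual: "(\<integral>x. \<psi> x * ((- of_real ?c) * (cutoff n x * \<eta> x) + E n x) \<partial>lborel) = (\<integral>x. f x * \<phi>n n x \<partial>lborel)" for n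
    proof -
      have "(- of_real ?c) * (cutoff n x * \<eta> x) + E n x = lap (\<phi>n n) x - \<phi>n n x" for x
        unfolding E_def eqn \<phi>n_def by (simp add: algebra_simps)
      hence "(\<integral>x. \<psi> x * ((- of_real ?c) * (cutoff n x * \<eta> x) + E n x) \<partial>lborel) = (\<integral>x. \<psi> x * lap (\<phi>n n) x - \<psi> x * \<phi>n n x \<partial>lborel)"
        by (simp add: right_diff_distrib)
      also have "\<dots> = (\<integral>x. \<psi> x * lap (\<phi>n n) x \<partial>lborel) - (\<integral>x. \<psi> x * \<phi>n n x \<partial>lborel)"
        by (intro Bochner_Integration.integral_diff L2_mult_test_integrable \<psi>m \<psi>2 test_lap \<phi>n)
      also have "\<dots> = (\<integral>x. L x * \<phi>n n x \<partial>lborel) - (\<integral>x. \<psi> x * \<phi>n n x \<partial>lborel)" by (simp add: weak[OF \<phi>n])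
      also have "\<dots> = (\<integral>x. L x * \<phi>n n x - \<psi> x * \<phi>n n x \<partial>lborel)"
        by (intro Bochner_Integration.integral_diff[symmetric] L2_mult_test_integrable Lm L2 \<psi>m \<psi>2 \<phi>n)
      finally show ?thesis by (simp add: f_def left_diff_distrib)
    qed
    have bound: "norm (\<integral>x. f x * \<phi>n n x \<partial>lborel) \<le> (S + Q) * I" for n
    proof -
      have "ennreal (norm (\<integral>x. f x * \<phi>n n x \<partial>lborel)) \<le> (\<integral>\<^sup>+x. ennreal (norm (f x * \<phi>n n x)) \<partial>lborel)"
        by (rule integral_norm_bound_ennreal[OF L2_mult_test_integrable[OF fm f2 \<phi>n]])
      also have "\<dots> \<le> (\<integral>\<^sup>+x. ennreal (norm (f x)) * ennreal (norm (\<phi> x)) \<partial>lborel)"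
      proof (rule nn_integral_mono)
        fix x
        have "norm (f x * \<phi>n n x) \<le> norm (f x) * (1 * norm (\<phi> x))"
          unfolding norm_mult \<phi>n_def by (intro mult_left_mono mult_right_mono norm_cutoff_le) auto
        thus "ennreal (norm (f x * \<phi>n n x)) \<le> ennreal (norm (f x)) * ennreal (norm (\<phi> x))"
          by (simp add: ennreal_mult[symmetric] ennreal_leI)
      qed
      also have "\<dots> \<le> (\<integral>\<^sup>+x. ennreal (norm (f x)) * (\<integral>\<^sup>+y. ennreal (norm (yukawa 1 (x - y)) * norm (\<eta> y)) \<partial>lborel) \<partial>lborel)"
        unfolding \<phi>_def by (intro nn_integral_mono mult_left_mono norm_conv_yukawa_le \<eta>) auto
      also have "\<dots> = (\<integral>\<^sup>+x. (\<integral>\<^sup>+y. ennreal (norm (f x)) * ennreal (norm (yukawa 1 (x - y)) * norm (\<eta> y)) \<partial>lborel) \<partial>lborel)"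
        by (intro nn_integral_cong nn_integral_cmult[symmetric]) measurable
      also have "\<dots> \<le> (\<integral>\<^sup>+x. (\<integral>\<^sup>+y. ennreal (norm (\<eta> y)) * (ennreal ((norm (f x))\<^sup>2) + ennreal ((norm (yukawa 1 (x - y)))\<^sup>2)) \<partial>lborel) \<partial>lborel)"
      proof (intro nn_integral_mono)
        fix x y
        have "norm (f x) * (norm (yukawa 1 (x - y)) * norm (\<eta> y)) \<le> norm (\<eta> y) * ((norm (f x))\<^sup>2 + (norm (yukawa 1 (x - y)))\<^sup>2)"
          using mult_left_mono[OF mult_le_sum_squares[of "norm (f x)" "norm (yukawa 1 (x - y))"], of "norm (\<eta> y)"] by (simp add: mult_ac)
        hence "ennreal (norm (f x) * (norm (yukawa 1 (x - y)) * norm (\<eta> y))) \<le> ennreal (norm (\<eta> y) * ((norm (f x))\<^sup>2 + (norm (yukawa 1 (x - y)))\<^sup>2))" by (rule ennreal_leI)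
        thus "ennreal (norm (f x)) * ennreal (norm (yukawa 1 (x - y)) * norm (\<eta> y)) \<le> ennreal (norm (\<eta> y)) * (ennreal ((norm (f x))\<^sup>2) + ennreal ((norm (yukawa 1 (x - y)))\<^sup>2))"
          by (simp add: ennreal_mult ennreal_plus)
      qed
      also have "\<dots> = (\<integral>\<^sup>+y. (\<integral>\<^sup>+x. ennreal (norm (\<eta> y)) * (ennreal ((norm (f x))\<^sup>2) + ennreal ((norm (yukawa 1 (x - y)))\<^sup>2)) \<partial>lborel) \<partial>lborel)"
        by (rule lborel_pair.Fubini') measurable
      also have "\<dots> = (\<integral>\<^sup>+y. ennreal (norm (\<eta> y)) * ennreal (S + Q) \<partial>lborel)"
      proof (rule nn_integral_cong)
        fix y
        have "(\<integral>\<^sup>+x. ennreal ((norm (yukawa 1 (x - y)))\<^sup>2) \<partial>lborel) = ennreal Q"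
          using nn_integral_lborel_affine[of 1 "\<lambda>x. ennreal ((norm (yukawa 1 x))\<^sup>2)" "-y"] Q by simp
        moreover have "(\<integral>\<^sup>+x. ennreal (norm (\<eta> y)) * (ennreal ((norm (f x))\<^sup>2) + ennreal ((norm (yukawa 1 (x - y)))\<^sup>2)) \<partial>lborel)
           = ennreal (norm (\<eta> y)) * ((\<integral>\<^sup>+x. ennreal ((norm (f x))\<^sup>2) \<partial>lborel) + (\<integral>\<^sup>+x. ennreal ((norm (yukawa 1 (x - y)))\<^sup>2) \<partial>lborel))"
          by (subst nn_integral_cmult, measurable, subst nn_integral_add) auto
        ultimately show "(\<integral>\<^sup>+x. ennreal (norm (\<eta> y)) * (ennreal ((norm (f x))\<^sup>2) + ennreal ((norm (yukawa 1 (x - y)))\<^sup>2)) \<partial>lborel) = ennreal (norm (\<eta> y)) * ennreal (S + Q)"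
          using S Q by simp
      qed
      also have "\<dots> = ennreal I * ennreal (S + Q)" unfolding I_def I[symmetric] by (rule nn_integral_multc) measurable
      also have "\<dots> = ennreal ((S + Q) * I)" using S Q I0 by (subst ennreal_mult[symmetric]) (auto simp: mult.commute)
      finally show ?thesis using S Q I0 by (simp add: ennreal_le_iff)
    qed
    have "(\<lambda>n. norm (\<integral>x. \<psi> x * ((- of_real ?c) * (cutoff n x * \<eta> x) + E n x) \<partial>lborel)) \<longlonglongrightarrow> norm (- of_real ?c * (\<integral>x. \<psi> x * \<eta> x \<partial>lborel))"
      by (intro tendsto_norm cutoff_pairing_limit[OF E sm dec \<psi>m \<psi>2 \<eta>])
    hence "norm (- of_real ?c * (\<integral>x. \<psi> x * \<eta> x \<partial>lborel)) \<le> (S + Q) * I"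
      unfolding dual by (rule LIMSEQ_le_const2) (use bound in blast)
    hence "?c * norm (\<integral>x. \<psi> x * \<eta> x \<partial>lborel) \<le> (S + Q) * I" using c by (simp add: norm_mult)
    hence "norm (\<integral>x. \<psi> x * \<eta> x \<partial>lborel) \<le> (S + Q) / ?c * I" using c by (simp add: field_simps)
    hence "ennreal (norm (\<integral>x. \<psi> x * \<eta> x \<partial>lborel)) \<le> ennreal ((S + Q) / ?c * I)" by (rule ennreal_leI)
    also have "\<dots> = ennreal ((S + Q) / ?c) * (\<integral>\<^sup>+x. ennreal (norm (\<eta> x)) \<partial>lborel)"
      unfolding I I_def[symmetric] using S Q c I0 by (intro ennreal_mult) auto
    finally show "ennreal (norm (\<integral>x. \<psi> x * \<eta> x \<partial>lborel)) \<le> ennreal ((S + Q) / ?c) * (\<integral>\<^sup>+x. ennreal (norm (\<eta> x)) \<partial>lborel)" .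
  qed
qed

text \<open>
  The converse of Hoelder's inequality, at first for test functions only: apply it to
  approximations of the sign function \<open>cnj \<psi> / \<bar>\<psi>\<bar>\<close> on \<open>{\<bar>\<psi>\<bar> > M}\<close>.
\<close>

lemma AE_bounded_if_pairing_le_L1_norm:
  fixes \<psi> :: "real^'n \<Rightarrow> complex"
  assumes \<psi>m [measurable]: "\<psi> \<in> borel_measurable borel" and \<psi>2: "integrable lborel (\<lambda>x. (norm (\<psi> x))\<^sup>2)" and M: "M \<ge> 0"
    and le: "\<And>\<eta>. \<eta> \<in> test_functions \<Longrightarrow> ennreal (norm (\<integral>x. \<psi> x * \<eta> x \<partial>lborel)) \<le> ennreal M * (\<integral>\<^sup>+x. ennreal (norm (\<eta> x)) \<partial>lborel)"
  shows "AE x in lborel. norm (\<psi> x) \<le> M"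
proof -
  define A where "A m = {x. norm (\<psi> x) > M} \<inter> cball 0 (real m)" for m :: nat
  have [measurable]: "A m \<in> sets borel" for m unfolding A_def by measurable
  have "AE x in lborel. x \<notin> A m" for m
  proof -
    have "emeasure lborel (A m) < \<infinity>" by (rule emeasure_bounded_finite) (auto simp: A_def intro: bounded_subset[OF bounded_cball])
    then obtain v where v: "v \<ge> 0" "emeasure lborel (A m) = ennreal v" by (cases "emeasure lborel (A m)") auto
    \<comment> \<open>The pairing of \<open>\<psi>\<close> with this function is the integral of \<open>\<bar>\<psi>\<bar>\<close> over \<open>A m\<close>, where \<open>\<bar>\<psi>\<bar> >
      M\<close>; it exceeds \<open>M\<close> times the measure of \<open>A m\<close> unless that measure is zero.\<close>
    define f where "f y = indicator (A m) y * (cnj (\<psi> y) / of_real (norm (\<psi> y)))" for y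
    have [measurable]: "(\<lambda>x. cnj (\<psi> x)) \<in> borel_measurable borel" "(\<lambda>x. complex_of_real (norm (\<psi> x))) \<in> borel_measurable borel"
      by (rule measurable_compose[OF \<psi>m borel_measurable_continuous_onI], intro continuous_intros)+
    have fm [measurable]: "f \<in> borel_measurable borel" unfolding f_def by measurable
    have nf: "norm (f y) = indicator (A m) y" for y
      using M by (cases "y \<in> A m") (auto simp: f_def A_def norm_divide norm_mult)
    have pf: "\<psi> y * f y = of_real (indicator (A m) y * norm (\<psi> y))" for y
      using M by (cases "y \<in> A m") (auto simp: f_def A_def complex_norm_square[symmetric] power2_eq_square field_simps)
    have Ai: "integrable lborel (indicator (A m) :: _ \<Rightarrow> real)" using v by (intro integrable_real_indicator) auto
    have sqi: "(norm (f y))\<^sup>2 = indicator (A m) y" for y by (simp add: nf indicator_def)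
    have f2: "integrable lborel (\<lambda>y. (norm (f y))\<^sup>2)" unfolding sqi by (rule Ai)
    have f0: "f y = 0" if "norm y > real m" for y using that by (simp add: f_def A_def)
    obtain \<eta> C where \<eta>: "\<And>k. \<eta> k \<in> test_functions" "C \<ge> 0"
      "\<And>k. norm ((\<integral>y. \<psi> y * \<eta> k y \<partial>lborel) - (\<integral>y. \<psi> y * f y \<partial>lborel)) \<le> C * (1 / real (Suc k))"
      "\<And>k. (\<integral>\<^sup>+y. ennreal (norm (\<eta> k y)) \<partial>lborel) \<le> (\<integral>\<^sup>+y. ennreal (norm (f y)) \<partial>lborel) + ennreal (C * (1 / real (Suc k)))"
      "\<And>k. (\<integral>\<^sup>+y. ennreal ((norm (\<eta> k y))\<^sup>2 * (norm y)\<^sup>2) \<partial>lborel) \<le>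
        ennreal (1 + 1 / real (Suc k)) * (\<integral>\<^sup>+y. ennreal ((norm (f y))\<^sup>2 * (norm y)\<^sup>2) \<partial>lborel) + ennreal (C * (1 / real (Suc k)))"
      by (rule approximating_test_functions[where R = "real m", OF fm _ f2 \<psi>m \<psi>2]) (erule f0, rule that)
    have nnf: "(\<integral>\<^sup>+y. ennreal (norm (f y)) \<partial>lborel) = ennreal v" unfolding nf ennreal_indicator using v(2) by (subst nn_integral_indicator) auto
    have pi: "integrable lborel (\<lambda>y. \<psi> y * f y)"
      by (rule square_integrable_mult) (use \<psi>2 f2 in auto)
    have I: "integrable lborel (\<lambda>y. indicator (A m) y * norm (\<psi> y))" using pi unfolding pf by (simp only: complex_of_real_integrable_eq)
    let ?I = "\<integral>y. indicator (A m) y * norm (\<psi> y) \<partial>lborel"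
    have I0: "?I \<ge> 0" by (intro integral_nonneg_AE AE_I2) auto
    have pI: "(\<integral>y. \<psi> y * f y \<partial>lborel) = of_real ?I" unfolding pf by (rule integral_complex_of_real)
    have bnd: "?I \<le> M * v + (M * C + C) * (1 / real (Suc k))" for k
    proof -
      have t0: "C * (1 / real (Suc k)) \<ge> 0" using \<eta>(2) by simp
      have "ennreal (norm (\<integral>y. \<psi> y * \<eta> k y \<partial>lborel)) \<le> ennreal M * (ennreal v + ennreal (C * (1 / real (Suc k))))"
        using \<eta>(4)[of k] unfolding nnf by (intro order_trans[OF le[OF \<eta>(1)]] mult_left_mono) auto
      also have "\<dots> = ennreal (M * (v + C * (1 / real (Suc k))))"
        using M v t0 by (simp add: ennreal_mult ennreal_plus)
      finally have "norm (\<integral>y. \<psi> y * \<eta> k y \<partial>lborel) \<le> M * (v + C * (1 / real (Suc k)))"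
        using M v t0 by (simp add: ennreal_le_iff)
      moreover have "norm (of_real ?I :: complex) \<le> norm (\<integral>y. \<psi> y * \<eta> k y \<partial>lborel) + C * (1 / real (Suc k))"
        using \<eta>(3)[of k] norm_triangle_ineq2[of "of_real ?I :: complex" "\<integral>y. \<psi> y * \<eta> k y \<partial>lborel"] unfolding pI
        by (simp add: norm_minus_commute)
      moreover have "norm (of_real ?I :: complex) = ?I" using I0 by (simp only: norm_of_real abs_of_nonneg)
      ultimately have "?I \<le> M * (v + C * (1 / real (Suc k))) + C * (1 / real (Suc k))" by linarith
      also have "\<dots> = M * v + (M * C + C) * (1 / real (Suc k))" by (simp only: distrib_left distrib_right mult.assoc add.assoc)
      finally show ?thesis .
    qed
    have "(\<lambda>k. M * v + (M * C + C) * (1 / real (Suc k))) \<longlonglongrightarrow> M * v + (M * C + C) * 0"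
      using LIMSEQ_inverse_real_of_nat by (intro tendsto_intros) (simp add: inverse_eq_divide)
    hence "(\<lambda>k. M * v + (M * C + C) * (1 / real (Suc k))) \<longlonglongrightarrow> M * v" by simp
    hence Ile: "?I \<le> M * v" by (rule LIMSEQ_le_const) (use bnd in blast)
    have d: "integrable lborel (\<lambda>y. indicator (A m) y * norm (\<psi> y) - M * indicator (A m) y)"
      by (intro Bochner_Integration.integrable_diff I integrable_mult_right Ai)
    have nn: "AE y in lborel. 0 \<le> indicator (A m) y * norm (\<psi> y) - M * indicator (A m) y"
      by (rule AE_I2) (auto simp: A_def indicator_def)
    have "(\<integral>y. indicator (A m) y * norm (\<psi> y) - M * indicator (A m) y \<partial>lborel) = ?I - M * (\<integral>y. indicator (A m) y \<partial>lborel)"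
      using Bochner_Integration.integral_diff[OF I integrable_mult_right[OF Ai, of M]] by simp
    also have "(\<integral>y. indicator (A m) y \<partial>lborel) = v" using v by (simp add: measure_def)
    finally have "(\<integral>y. indicator (A m) y * norm (\<psi> y) - M * indicator (A m) y \<partial>lborel) = 0"
      using Ile integral_nonneg_AE[OF nn] by linarith
    hence "AE y in lborel. indicator (A m) y * norm (\<psi> y) - M * indicator (A m) y = 0"
      using integral_nonneg_eq_0_iff_AE[OF d nn] by blast
    thus ?thesis
    proof eventually_elim
      fix x assume "indicator (A m) x * norm (\<psi> x) - M * indicator (A m) x = 0"
      thus "x \<notin> A m" by (cases "x \<in> A m") (auto simp: A_def)
    qed
  qed
  hence "AE x in lborel. \<forall>m. x \<notin> A m" by (simp add: AE_all_countable)
  thus ?thesis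
  proof eventually_elim
    fix x assume x: "\<forall>m. x \<notin> A m"
    obtain m where "norm x \<le> real m" using real_arch_simple by blast
    with x show "norm (\<psi> x) \<le> M" unfolding A_def by (auto simp: not_less)
  qed
qed

text \<open>Boundedness controls the weight \<open>1/\<bar>x\<bar>\<^sup>2\<close> in the unit ball, square-integrability outside.\<close>

lemma Hardy_weight_finite:
  fixes \<psi> :: "real^3 \<Rightarrow> complex"
  assumes \<psi>m [measurable]: "\<psi> \<in> borel_measurable borel" and \<psi>2: "integrable lborel (\<lambda>x. (norm (\<psi> x))\<^sup>2)"
    and M: "AE x in lborel. norm (\<psi> x) \<le> M"
  shows "integrable lborel (\<lambda>x. (norm (\<psi> x))\<^sup>2 / (norm x)\<^sup>2)"
proof (rule Bochner_Integration.integrable_bound)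
  show "integrable lborel (\<lambda>x::real^3. 4 * M\<^sup>2 * (norm x powr -2 * (1 + norm x) powr -2) + (norm (\<psi> x))\<^sup>2)"
    by (intro Bochner_Integration.integrable_add integrable_mult_right powr_integrable \<psi>2) auto
  show "AE x in lborel. norm ((norm (\<psi> x))\<^sup>2 / (norm x)\<^sup>2) \<le> norm (4 * M\<^sup>2 * (norm x powr -2 * (1 + norm x) powr -2) + (norm (\<psi> x))\<^sup>2)"
    using M AE_lborel_singleton[of "0::real^3"]
  proof eventually_elim
    fix x :: "real^3" assume M: "norm (\<psi> x) \<le> M" and x: "x \<noteq> 0"
    have M2: "(norm (\<psi> x))\<^sup>2 \<le> M\<^sup>2" using M by (rule power_mono) simp
    have p: "1 + norm x > 0" by (simp add: add_pos_nonneg)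
    have nn: "0 \<le> 4 * M\<^sup>2 * (norm x powr -2 * (1 + norm x) powr -2)" by simp
    have "(norm (\<psi> x))\<^sup>2 / (norm x)\<^sup>2 \<le> 4 * M\<^sup>2 * (norm x powr -2 * (1 + norm x) powr -2) + (norm (\<psi> x))\<^sup>2"
    proof (cases "norm x \<le> 1")
      case True
      have "(1 + norm x)\<^sup>2 \<le> 2\<^sup>2" using True by (intro power_mono) auto
      hence "1 \<le> 4 * (1 + norm x) powr -2" using p by (simp add: powr_minus powr_numeral divide_simps)
      hence "1 / (norm x)\<^sup>2 * 1 \<le> 1 / (norm x)\<^sup>2 * (4 * (1 + norm x) powr -2)" by (rule mult_left_mono) simp
      hence "M\<^sup>2 * (1 / (norm x)\<^sup>2 * 1) \<le> M\<^sup>2 * (1 / (norm x)\<^sup>2 * (4 * (1 + norm x) powr -2))" by (rule mult_left_mono) simp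
      also have "\<dots> = 4 * M\<^sup>2 * (norm x powr -2 * (1 + norm x) powr -2)" using x by (simp add: powr_minus powr_numeral divide_inverse mult_ac)
      finally have "M\<^sup>2 / (norm x)\<^sup>2 \<le> 4 * M\<^sup>2 * (norm x powr -2 * (1 + norm x) powr -2)" by simp
      moreover have "(norm (\<psi> x))\<^sup>2 / (norm x)\<^sup>2 \<le> M\<^sup>2 / (norm x)\<^sup>2" by (intro divide_right_mono M2) simp
      moreover have "0 \<le> (norm (\<psi> x))\<^sup>2" by simp
      ultimately show ?thesis by linarith
    next
      case False
      hence "1 \<le> (norm x)\<^sup>2" by (intro one_le_power) simp
      hence "(norm (\<psi> x))\<^sup>2 / (norm x)\<^sup>2 \<le> (norm (\<psi> x))\<^sup>2 / 1" by (intro divide_left_mono) auto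
      hence "(norm (\<psi> x))\<^sup>2 / (norm x)\<^sup>2 \<le> (norm (\<psi> x))\<^sup>2" by simp
      thus ?thesis using nn by linarith
    qed
    thus "norm ((norm (\<psi> x))\<^sup>2 / (norm x)\<^sup>2) \<le> norm (4 * M\<^sup>2 * (norm x powr -2 * (1 + norm x) powr -2) + (norm (\<psi> x))\<^sup>2)" by simp
  qed
qed measurable

section \<open>The resolvent estimate\<close>

text \<open>
  The first quadrant is chosen because both \<open>-\<i>k\<close> and \<open>k\<close> then have nonnegative real part, so
  that \<open>exp (\<i>kr)/r\<close> and \<open>exp (-kr)/r\<close> are bounded by \<open>1/r\<close>.
\<close>

lemma fourth_root_first_quadrant:
  obtains k :: complex where "k ^ 4 = z" "Re k \<ge> 0" "Im k \<ge> 0"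
proof -
  define q where "q = csqrt (csqrt z)"
  have "q ^ 4 = (q\<^sup>2)\<^sup>2" by simp
  also have "\<dots> = z" by (simp add: q_def)
  finally have q: "q ^ 4 = z" .
  have re: "Re q \<ge> 0" unfolding q_def using csqrt_principal[of "csqrt z"] by auto
  show ?thesis
  proof (cases "Im q \<ge> 0")
    case True thus ?thesis using that[of q] q re by simp
  next
    case False
    have "(\<i> * q) ^ 4 = z" using q by (simp add: power_mult_distrib)
    thus ?thesis using that[of "\<i> * q"] False re by simp
  qed
qed

text \<open>
  The estimate of the resolvent kernel by \<open>\<bar>k\<bar>\<^sup>-\<^sup>2\<close> times the Newton kernel, in dual form.
  Testing the equation with \<open>\<phi>\<close>, which solves \<open>(\<Delta>\<^sup>2 - k\<^sup>4) \<phi> = 2 k\<^sup>2 c \<eta>\<close> where \<open>c =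
  Newton_const\<close>, gives \<open>2 k\<^sup>2 c \<integral>\<psi>\<eta> = - \<integral>V\<phi>\<psi>\<close>; here \<open>\<bar>\<phi>\<bar>\<close> is at most twice the Newtonian
  potential of \<open>\<bar>\<eta>\<bar>\<close>, and \<open>\<bar>V\<psi>\<bar> \<le> N \<bar>\<psi>\<bar>/\<bar>x\<bar>\<^sup>2\<close>, so that \<open>Hardy_bilinear\<close> applies to
  \<open>\<bar>\<psi>\<bar>/\<bar>x\<bar>\<^sup>2\<close> and \<open>\<bar>\<eta>\<bar>\<close>.
\<close>

lemma resolvent_pairing_bound:
  fixes \<psi> V :: "real^3 \<Rightarrow> complex"
  assumes \<psi>m [measurable]: "\<psi> \<in> borel_measurable borel" and \<psi>2: "integrable lborel (\<lambda>x. (norm (\<psi> x))\<^sup>2)"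
    and Vm [measurable]: "V \<in> borel_measurable borel" and N: "N \<ge> 0" "AE x in lborel. (norm x)\<^sup>2 * norm (V x) \<le> N"
    and A: "integrable lborel (\<lambda>x. (norm (\<psi> x))\<^sup>2 / (norm x)\<^sup>2)"
    and eqn: "\<And>\<phi>. \<phi> \<in> test_functions \<Longrightarrow>
       (\<integral>x. \<psi> x * lap (lap \<phi>) x \<partial>lborel) + (\<integral>x. V x * \<phi> x * \<psi> x \<partial>lborel) = k ^ 4 * (\<integral>x. \<psi> x * \<phi> x \<partial>lborel)"
    and k: "Re k \<ge> 0" "Im k \<ge> 0" and \<eta>: "\<eta> \<in> test_functions"
  shows "ennreal ((norm k)\<^sup>2 * norm (\<integral>x. \<psi> x * \<eta> x \<partial>lborel)) \<le>
    ennreal (2 * N) * (ennreal (\<integral>x. (norm (\<psi> x))\<^sup>2 / (norm x)\<^sup>2 \<partial>lborel) + (\<integral>\<^sup>+x. ennreal ((norm (\<eta> x))\<^sup>2 * (norm x)\<^sup>2) \<partial>lborel))"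
proof -
  let ?c = Newton_const
  have c: "?c > 0" by (rule Newton_const_pos)
  note [measurable] = test_measurable[OF \<eta>]
  define \<phi>1 where "\<phi>1 = conv (yukawa (- \<i> * k)) \<eta>"
  define \<phi>2 where "\<phi>2 = conv (yukawa k) \<eta>"
  have r1: "Re (- \<i> * k) \<ge> 0" using k by simp
  have sm1: "smooth \<phi>1" and sm2: "smooth \<phi>2" unfolding \<phi>1_def \<phi>2_def by (intro smooth_conv_yukawa r1 k \<eta>)+
  have l1: "lap \<phi>1 = (\<lambda>x. - k\<^sup>2 * \<phi>1 x - of_real ?c * \<eta> x)"
    unfolding \<phi>1_def by (rule ext, subst conv_yukawa_equation[OF r1 \<eta>]) (simp add: power_mult_distrib)
  have l2: "lap \<phi>2 = (\<lambda>x. k\<^sup>2 * \<phi>2 x - of_real ?c * \<eta> x)"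
    unfolding \<phi>2_def by (rule ext, subst conv_yukawa_equation[OF k(1) \<eta>]) simp
  have lap_lin: "lap (\<lambda>x. a * f x - b * g x) x = a * lap f x - b * lap g x" if "smooth f" "smooth g" for a b f g and x :: "real^3"
    using that by (simp add: lap_def partials_diff partials_cmult smooth_mult smooth_const sum_subtractf sum_distrib_left)
  define \<phi> where "\<phi> x = \<phi>1 x - \<phi>2 x" for x
  have sm: "smooth \<phi>" unfolding \<phi>_def by (intro smooth_diff sm1 sm2)
  note [measurable] = smooth_measurable[OF sm]
  have ll1: "lap (lap \<phi>1) x = k ^ 4 * \<phi>1 x + k\<^sup>2 * (of_real ?c * \<eta> x) - of_real ?c * lap \<eta> x" for x
  proof -
    have "lap (lap \<phi>1) x = - k\<^sup>2 * lap \<phi>1 x - of_real ?c * lap \<eta> x"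
      unfolding l1 by (subst lap_lin[OF sm1 test_smooth[OF \<eta>]]) (simp add: l1)
    thus ?thesis by (simp add: l1 algebra_simps power4_eq_xxxx power2_eq_square)
  qed
  have ll2: "lap (lap \<phi>2) x = k ^ 4 * \<phi>2 x - k\<^sup>2 * (of_real ?c * \<eta> x) - of_real ?c * lap \<eta> x" for x
  proof -
    have "lap (lap \<phi>2) x = k\<^sup>2 * lap \<phi>2 x - of_real ?c * lap \<eta> x"
      unfolding l2 by (subst lap_lin[OF sm2 test_smooth[OF \<eta>]]) (simp add: l2)
    thus ?thesis by (simp add: l2 algebra_simps power4_eq_xxxx power2_eq_square)
  qed
  have ll: "lap (lap \<phi>) x = k ^ 4 * \<phi> x + 2 * k\<^sup>2 * of_real ?c * \<eta> x" for x
  proof -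
    have e: "lap \<phi> = (\<lambda>x. 1 * lap \<phi>1 x - 1 * lap \<phi>2 x)"
      using lap_lin[OF sm1 sm2, of 1 1] by (auto simp: \<phi>_def[abs_def])
    have "lap (lap \<phi>) x = lap (lap \<phi>1) x - lap (lap \<phi>2) x"
      unfolding e by (subst lap_lin) (simp_all add: smooth_lap sm1 sm2)
    thus ?thesis by (simp add: ll1 ll2 \<phi>_def algebra_simps)
  qed
  have dec: "\<exists>C. \<forall>x. norm (partials is \<phi> x) \<le> C / (1 + norm x)" for "is"
  proof -
    obtain C1 where C1: "\<And>x. norm (partials is \<phi>1 x) \<le> C1 / (1 + norm x)" using conv_yukawa_partials_decay[OF r1 \<eta>] unfolding \<phi>1_def by blast
    obtain C2 where C2: "\<And>x. norm (partials is \<phi>2 x) \<le> C2 / (1 + norm x)" using conv_yukawa_partials_decay[OF k(1) \<eta>] unfolding \<phi>2_def by blast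
    have "norm (partials is \<phi> x) \<le> (C1 + C2) / (1 + norm x)" for x
      unfolding \<phi>_def[abs_def] partials_diff[OF sm1 sm2] add_divide_distrib
      by (rule order_trans[OF norm_triangle_ineq4 add_mono[OF C1 C2]])
    thus ?thesis by blast
  qed
  define J where "J x = (\<integral>\<^sup>+y. ennreal (norm (\<eta> y) / norm (x - y)) \<partial>lborel)" for x
  have Jm [measurable]: "J \<in> borel_measurable borel"
    unfolding J_def by measurable
  have \<phi>J: "ennreal (norm (\<phi> x)) \<le> 2 * J x" for x
  proof -
    have "ennreal (norm (\<phi> x)) \<le> ennreal (norm (\<phi>1 x) + norm (\<phi>2 x))" unfolding \<phi>_def by (intro ennreal_leI norm_triangle_ineq4)
    also have "\<dots> = ennreal (norm (\<phi>1 x)) + ennreal (norm (\<phi>2 x))" by (intro ennreal_plus) auto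
    also have "\<dots> \<le> J x + J x" unfolding J_def \<phi>1_def \<phi>2_def by (intro add_mono norm_conv_yukawa_le_Newton_potential r1 k \<eta>)
    also have "\<dots> = 2 * J x" by (simp add: mult_2)
    finally show ?thesis .
  qed
  define \<phi>n where "\<phi>n n x = cutoff n x * \<phi> x" for n x
  have \<phi>n: "\<phi>n n \<in> test_functions" for n unfolding \<phi>n_def by (rule test_mult2[OF cutoff_test sm])
  note [measurable] = test_measurable[OF \<phi>n]
  define E where "E n x = lap (lap (\<phi>n n)) x - cutoff n x * lap (lap \<phi>) x" for n x
  have E: "E \<in> cutoff_errors \<phi>" unfolding E_def[abs_def] \<phi>n_def using lap_lap_cutoff_mult[OF sm] by simp
  have dual: "(\<integral>x. \<psi> x * ((2 * k\<^sup>2 * of_real ?c) * (cutoff n x * \<eta> x) + E n x) \<partial>lborel) = - (\<integral>x. V x * \<phi>n n x * \<psi> x \<partial>lborel)" for n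
  proof -
    have "(2 * k\<^sup>2 * of_real ?c) * (cutoff n x * \<eta> x) + E n x = lap (lap (\<phi>n n)) x - k ^ 4 * \<phi>n n x" for x
      unfolding E_def ll \<phi>n_def by (simp add: algebra_simps)
    hence "(\<lambda>x. \<psi> x * ((2 * k\<^sup>2 * of_real ?c) * (cutoff n x * \<eta> x) + E n x)) = (\<lambda>x. \<psi> x * lap (lap (\<phi>n n)) x - k ^ 4 * (\<psi> x * \<phi>n n x))"
      by (intro ext) (simp only: right_diff_distrib mult.left_commute)
    hence "(\<integral>x. \<psi> x * ((2 * k\<^sup>2 * of_real ?c) * (cutoff n x * \<eta> x) + E n x) \<partial>lborel) = (\<integral>x. \<psi> x * lap (lap (\<phi>n n)) x - k ^ 4 * (\<psi> x * \<phi>n n x) \<partial>lborel)"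
      by (simp only:)
    also have "\<dots> = (\<integral>x. \<psi> x * lap (lap (\<phi>n n)) x \<partial>lborel) - (\<integral>x. k ^ 4 * (\<psi> x * \<phi>n n x) \<partial>lborel)"
      by (intro Bochner_Integration.integral_diff integrable_mult_right L2_mult_test_integrable \<psi>m \<psi>2 test_lap \<phi>n)
    also have "\<dots> = (\<integral>x. \<psi> x * lap (lap (\<phi>n n)) x \<partial>lborel) - k ^ 4 * (\<integral>x. \<psi> x * \<phi>n n x \<partial>lborel)" by simp
    also have "\<dots> = - (\<integral>x. V x * \<phi>n n x * \<psi> x \<partial>lborel)" using eqn[OF \<phi>n[of n]] by (simp add: algebra_simps eq_neg_iff_add_eq_0)
    finally show ?thesis .
  qed
  define X where "X = (\<integral>x. (norm (\<psi> x))\<^sup>2 / (norm x)\<^sup>2 \<partial>lborel)"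
  define B where "B = (\<integral>\<^sup>+x. ennreal ((norm (\<eta> x))\<^sup>2 * (norm x)\<^sup>2) \<partial>lborel)"
  have Xnn: "(\<integral>\<^sup>+x. ennreal ((norm (\<psi> x))\<^sup>2 / (norm x)\<^sup>2) \<partial>lborel) = ennreal X"
    unfolding X_def by (rule nn_integral_eq_integral[OF A]) auto
  have bound: "ennreal (norm (\<integral>x. V x * \<phi>n n x * \<psi> x \<partial>lborel)) \<le> ennreal (4 * N * ?c) * (ennreal X + B)" for n
  \<comment> \<open>A non-integrable function has integral \<open>0\<close> by convention, so that case is trivial.\<close>
  proof (cases "integrable lborel (\<lambda>x. V x * \<phi>n n x * \<psi> x)")
    case True
    have "ennreal (norm (\<integral>x. V x * \<phi>n n x * \<psi> x \<partial>lborel)) \<le> (\<integral>\<^sup>+x. ennreal (norm (V x * \<phi>n n x * \<psi> x)) \<partial>lborel)"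
      by (rule integral_norm_bound_ennreal[OF True])
    also have "\<dots> \<le> (\<integral>\<^sup>+x. ennreal (2 * N) * (\<integral>\<^sup>+y. ennreal (norm (\<psi> x) / (norm x)\<^sup>2 * norm (\<eta> y) / norm (x - y)) \<partial>lborel) \<partial>lborel)"
    proof (rule nn_integral_mono_AE)
      show "AE x in lborel. ennreal (norm (V x * \<phi>n n x * \<psi> x)) \<le> ennreal (2 * N) * (\<integral>\<^sup>+y. ennreal (norm (\<psi> x) / (norm x)\<^sup>2 * norm (\<eta> y) / norm (x - y)) \<partial>lborel)"
        using N(2) AE_lborel_singleton[of "0::real^3"]
      proof eventually_elim
        fix x :: "real^3" assume Nx: "(norm x)\<^sup>2 * norm (V x) \<le> N" and x: "x \<noteq> 0"
        have "norm (V x) \<le> N / (norm x)\<^sup>2" using Nx x by (simp add: field_simps)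
        hence "norm (V x * \<phi>n n x * \<psi> x) \<le> N / (norm x)\<^sup>2 * (1 * norm (\<phi> x)) * norm (\<psi> x)"
          unfolding norm_mult \<phi>n_def by (intro mult_mono norm_cutoff_le) (use N in auto)
        also have "\<dots> = N * (norm (\<psi> x) / (norm x)\<^sup>2) * norm (\<phi> x)" by simp
        finally have "ennreal (norm (V x * \<phi>n n x * \<psi> x)) \<le> ennreal (N * (norm (\<psi> x) / (norm x)\<^sup>2) * norm (\<phi> x))" by (rule ennreal_leI)
        also have "\<dots> = ennreal (N * (norm (\<psi> x) / (norm x)\<^sup>2)) * ennreal (norm (\<phi> x))" using N by (intro ennreal_mult) auto
        also have "\<dots> \<le> ennreal (N * (norm (\<psi> x) / (norm x)\<^sup>2)) * (2 * J x)" by (intro mult_left_mono \<phi>J) auto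
        also have "\<dots> = ennreal (2 * N) * (ennreal (norm (\<psi> x) / (norm x)\<^sup>2) * J x)"
        proof -
          have "ennreal (N * (norm (\<psi> x) / (norm x)\<^sup>2)) = ennreal N * ennreal (norm (\<psi> x) / (norm x)\<^sup>2)"
            using N(1) by (intro ennreal_mult) auto
          moreover have "ennreal (2 * N) = 2 * ennreal N" using N(1) by (simp add: ennreal_mult)
          ultimately show ?thesis by (simp only: mult_ac)
        qed
        also have "ennreal (norm (\<psi> x) / (norm x)\<^sup>2) * J x = (\<integral>\<^sup>+y. ennreal (norm (\<psi> x) / (norm x)\<^sup>2) * ennreal (norm (\<eta> y) / norm (x - y)) \<partial>lborel)"
          unfolding J_def by (rule nn_integral_cmult[symmetric]) measurable
        also have "\<dots> = (\<integral>\<^sup>+y. ennreal (norm (\<psi> x) / (norm x)\<^sup>2 * norm (\<eta> y) / norm (x - y)) \<partial>lborel)"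
          by (intro nn_integral_cong, subst ennreal_mult[symmetric]) auto
        finally show "ennreal (norm (V x * \<phi>n n x * \<psi> x)) \<le> ennreal (2 * N) * (\<integral>\<^sup>+y. ennreal (norm (\<psi> x) / (norm x)\<^sup>2 * norm (\<eta> y) / norm (x - y)) \<partial>lborel)" .
      qed
    qed
    also have "\<dots> = ennreal (2 * N) * (\<integral>\<^sup>+x. (\<integral>\<^sup>+y. ennreal (norm (\<psi> x) / (norm x)\<^sup>2 * norm (\<eta> y) / norm (x - y)) \<partial>lborel) \<partial>lborel)"
      by (rule nn_integral_cmult) measurable
    also have "\<dots> \<le> ennreal (2 * N) * (ennreal (2 * ?c) * ((\<integral>\<^sup>+x. ennreal ((norm (\<psi> x) / (norm x)\<^sup>2)\<^sup>2 * (norm x)\<^sup>2) \<partial>lborel) + B))"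
      unfolding B_def by (intro mult_left_mono Hardy_bilinear) auto
    also have "(\<integral>\<^sup>+x. ennreal ((norm (\<psi> x) / (norm x)\<^sup>2)\<^sup>2 * (norm x)\<^sup>2) \<partial>lborel) = ennreal X"
      unfolding Xnn[symmetric] by (intro nn_integral_cong) (simp add: power_divide power2_eq_square)
    also have "ennreal (2 * N) * (ennreal (2 * ?c) * (ennreal X + B)) = ennreal (4 * N * ?c) * (ennreal X + B)"
      unfolding mult.assoc[symmetric] using N c by (subst ennreal_mult[symmetric]) (auto simp: mult_ac)
    finally show ?thesis .
  qed (simp add: not_integrable_integral_eq)
  show ?thesis
  proof (cases "B = \<infinity>")
    case True
    show ?thesis
    \<comment> \<open>As \<open>0 * \<infinity> = 0\<close>, the claim has content for \<open>N = 0\<close> even when the weighted norm of \<open>\<eta>\<close> is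
      infinite.\<close>
    proof (cases "N = 0")
      case False
      hence "ennreal (2 * N) * (ennreal X + B) = \<infinity>" using N True by (simp add: ennreal_mult_top)
      thus ?thesis unfolding X_def B_def by simp
    next
      case True
      hence "norm (\<integral>x. V x * \<phi>n n x * \<psi> x \<partial>lborel) \<le> 0" for n using bound[of n] by simp
      hence z: "(\<integral>x. \<psi> x * ((2 * k\<^sup>2 * of_real ?c) * (cutoff n x * \<eta> x) + E n x) \<partial>lborel) = 0" for n
        unfolding dual by simp
      have "(\<lambda>n. 0) \<longlonglongrightarrow> (2 * k\<^sup>2 * of_real ?c) * (\<integral>x. \<psi> x * \<eta> x \<partial>lborel)"
        using cutoff_pairing_limit[OF E sm dec \<psi>m \<psi>2 \<eta>, of "2 * k\<^sup>2 * of_real ?c"] unfolding z .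
      hence "(2 * k\<^sup>2 * of_real ?c) * (\<integral>x. \<psi> x * \<eta> x \<partial>lborel) = 0" using LIMSEQ_unique tendsto_const by blast
      hence z0: "(norm k)\<^sup>2 * norm (\<integral>x. \<psi> x * \<eta> x \<partial>lborel) = 0" using c by auto
      show ?thesis unfolding z0 by simp
    qed
  next
    case False
    then obtain b where b: "b \<ge> 0" "B = ennreal b" by (cases B) auto
    have X0: "X \<ge> 0" unfolding X_def by (intro integral_nonneg_AE AE_I2) auto
    have bd: "norm (\<integral>x. V x * \<phi>n n x * \<psi> x \<partial>lborel) \<le> 4 * N * ?c * (X + b)" for n
    proof -
      have "ennreal (norm (\<integral>x. V x * \<phi>n n x * \<psi> x \<partial>lborel)) \<le> ennreal (4 * N * ?c) * ennreal (X + b)"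
        using bound[of n] b X0 by (simp add: ennreal_plus)
      also have "\<dots> = ennreal (4 * N * ?c * (X + b))" using N c b X0 by (intro ennreal_mult[symmetric]) auto
      finally show ?thesis using N c b X0 by (simp add: ennreal_le_iff)
    qed
    have "(\<lambda>n. norm (\<integral>x. \<psi> x * ((2 * k\<^sup>2 * of_real ?c) * (cutoff n x * \<eta> x) + E n x) \<partial>lborel)) \<longlonglongrightarrow> norm ((2 * k\<^sup>2 * of_real ?c) * (\<integral>x. \<psi> x * \<eta> x \<partial>lborel))"
      by (intro tendsto_norm cutoff_pairing_limit[OF E sm dec \<psi>m \<psi>2 \<eta>])
    hence "norm ((2 * k\<^sup>2 * of_real ?c) * (\<integral>x. \<psi> x * \<eta> x \<partial>lborel)) \<le> 4 * N * ?c * (X + b)"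
      unfolding dual norm_minus_cancel by (rule LIMSEQ_le_const2) (use bd in blast)
    hence "(2 * ?c) * ((norm k)\<^sup>2 * norm (\<integral>x. \<psi> x * \<eta> x \<partial>lborel)) \<le> (2 * ?c) * (2 * N * (X + b))"
      using c by (simp add: norm_mult norm_power mult_ac)
    hence "(norm k)\<^sup>2 * norm (\<integral>x. \<psi> x * \<eta> x \<partial>lborel) \<le> 2 * N * (X + b)" using c by simp
    hence "ennreal ((norm k)\<^sup>2 * norm (\<integral>x. \<psi> x * \<eta> x \<partial>lborel)) \<le> ennreal (2 * N * (X + b))" by (rule ennreal_leI)
    also have "\<dots> = ennreal (2 * N) * (ennreal X + B)" using N X0 b by (simp add: ennreal_mult ennreal_plus)
    finally show ?thesis unfolding X_def B_def .
  qed
qed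

text \<open>
  Choose \<open>\<eta>\<close> close to \<open>cnj \<psi> / \<bar>x\<bar>\<^sup>2\<close> in the resolvent estimate: with \<open>X = \<integral>\<bar>\<psi>\<bar>\<^sup>2/\<bar>x\<bar>\<^sup>2\<close> it
  becomes \<open>\<bar>k\<bar>\<^sup>2 X \<le> 2 N (X + X)\<close>, and \<open>X\<close> is positive and finite.
\<close>

theorem eigenvalue_bound_lborel:
  fixes \<psi> L V :: "real^3 \<Rightarrow> complex"
  assumes \<psi>m [measurable]: "\<psi> \<in> borel_measurable borel" and \<psi>2: "integrable lborel (\<lambda>x. (norm (\<psi> x))\<^sup>2)"
    and Lm: "L \<in> borel_measurable borel" and L2: "integrable lborel (\<lambda>x. (norm (L x))\<^sup>2)"
    and weak: "\<And>\<eta>. \<eta> \<in> test_functions \<Longrightarrow> (\<integral>x. \<psi> x * lap \<eta> x \<partial>lborel) = (\<integral>x. L x * \<eta> x \<partial>lborel)"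
    and Vm: "V \<in> borel_measurable borel" and N: "N \<ge> 0" "AE x in lborel. (norm x)\<^sup>2 * norm (V x) \<le> N"
    and eqn: "\<And>\<phi>. \<phi> \<in> test_functions \<Longrightarrow>
       (\<integral>x. \<psi> x * lap (lap \<phi>) x \<partial>lborel) + (\<integral>x. V x * \<phi> x * \<psi> x \<partial>lborel) = z * (\<integral>x. \<psi> x * \<phi> x \<partial>lborel)"
    and nz: "\<not> (AE x in lborel. \<psi> x = 0)"
  shows "norm z \<le> 16 * N\<^sup>2"
proof -
  obtain k where k: "k ^ 4 = z" "Re k \<ge> 0" "Im k \<ge> 0" by (rule fourth_root_first_quadrant)
  obtain M where M: "M \<ge> 0" "\<And>\<eta>. \<eta> \<in> test_functions \<Longrightarrow> ennreal (norm (\<integral>x. \<psi> x * \<eta> x \<partial>lborel)) \<le> ennreal M * (\<integral>\<^sup>+x. ennreal (norm (\<eta> x)) \<partial>lborel)"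
    by (rule pairing_le_L1_norm[OF \<psi>m \<psi>2 Lm L2]) (erule weak, rule that)
  have A: "integrable lborel (\<lambda>x. (norm (\<psi> x))\<^sup>2 / (norm x)\<^sup>2)"
    by (rule Hardy_weight_finite[OF \<psi>m \<psi>2 AE_bounded_if_pairing_le_L1_norm[OF \<psi>m \<psi>2 M]])
  define X where "X = (\<integral>x. (norm (\<psi> x))\<^sup>2 / (norm x)\<^sup>2 \<partial>lborel)"
  have X0: "X \<ge> 0" unfolding X_def by (intro integral_nonneg_AE AE_I2) auto
  have Xpos: "X > 0"
  proof (rule ccontr)
    assume "\<not> X > 0"
    hence "X = 0" using X0 by simp
    have nn: "AE x in lborel. 0 \<le> (norm (\<psi> x))\<^sup>2 / (norm x)\<^sup>2" by (rule AE_I2) simp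
    have "AE x in lborel. (norm (\<psi> x))\<^sup>2 / (norm x)\<^sup>2 = 0"
      using integral_nonneg_eq_0_iff_AE[OF A nn] \<open>X = 0\<close> unfolding X_def by blast
    hence "AE x in lborel. \<psi> x = 0" using AE_lborel_singleton[of "0::real^3"] by eventually_elim auto
    thus False using nz by simp
  qed
  \<comment> \<open>Truncation to annuli makes \<open>cnj \<psi> / \<bar>y\<bar>\<^sup>2\<close> square-integrable with bounded support.\<close>
  define S where "S n = {y::real^3. 1 / real (Suc n) \<le> norm y \<and> norm y \<le> real (Suc n)}" for n
  have Sm [measurable]: "S n \<in> sets borel" for n unfolding S_def by measurable
  define a where "a n = (\<integral>y. indicator (S n) y * ((norm (\<psi> y))\<^sup>2 / (norm y)\<^sup>2) \<partial>lborel)" for n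
  have ai: "integrable lborel (\<lambda>y. indicator (S n) y * ((norm (\<psi> y))\<^sup>2 / (norm y)\<^sup>2))" for n
    using integrable_mult_indicator[OF _ A, of "S n"] Sm by simp
  have a0: "a n \<ge> 0" for n unfolding a_def by (intro integral_nonneg_AE AE_I2) auto
  have step: "(norm k)\<^sup>2 * a n \<le> 2 * N * (X + a n)" for n
  proof -
    define f where "f y = indicator (S n) y * (cnj (\<psi> y) / of_real ((norm y)\<^sup>2))" for y
    have [measurable]: "(\<lambda>x. cnj (\<psi> x)) \<in> borel_measurable borel"
      by (rule measurable_compose[OF \<psi>m borel_measurable_continuous_onI], intro continuous_intros)
    have [measurable]: "(\<lambda>x::real^3. complex_of_real ((norm x)\<^sup>2)) \<in> borel_measurable borel"
      by (intro borel_measurable_continuous_onI continuous_intros)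
    have fm [measurable]: "f \<in> borel_measurable borel" unfolding f_def by measurable
    have nf: "norm (f y) = indicator (S n) y * (norm (\<psi> y) / (norm y)\<^sup>2)" for y
      by (cases "y \<in> S n") (auto simp: f_def norm_divide norm_mult norm_power)
    have nf2: "(norm (f y))\<^sup>2 * (norm y)\<^sup>2 = indicator (S n) y * ((norm (\<psi> y))\<^sup>2 / (norm y)\<^sup>2)" for y
      unfolding nf by (cases "y \<in> S n") (auto simp: power_divide power2_eq_square)
    have pf: "\<psi> y * f y = of_real (indicator (S n) y * ((norm (\<psi> y))\<^sup>2 / (norm y)\<^sup>2))" for y
    proof -
      have "\<psi> y * cnj (\<psi> y) = (of_real (norm (\<psi> y)))\<^sup>2" using complex_norm_square[of "\<psi> y"] by simp
      thus ?thesis by (cases "y \<in> S n") (auto simp: f_def)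
    qed
    have f2: "integrable lborel (\<lambda>y. (norm (f y))\<^sup>2)"
    proof (rule Bochner_Integration.integrable_bound)
      show "integrable lborel (\<lambda>y. (real (Suc n))\<^sup>2 * ((norm (\<psi> y))\<^sup>2 / (norm y)\<^sup>2))" by (intro integrable_mult_right A)
      show "AE y in lborel. norm ((norm (f y))\<^sup>2) \<le> norm ((real (Suc n))\<^sup>2 * ((norm (\<psi> y))\<^sup>2 / (norm y)\<^sup>2))"
      proof (rule AE_I2)
        fix y
        have "(norm (f y))\<^sup>2 \<le> (real (Suc n))\<^sup>2 * ((norm (\<psi> y))\<^sup>2 / (norm y)\<^sup>2)"
        proof (cases "y \<in> S n")
          case True
          hence y: "norm y > 0" "1 / real (Suc n) \<le> norm y" by (auto simp: S_def intro: less_le_trans[of 0 "1 / real (Suc n)"])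
          have "1 / norm y \<le> real (Suc n)" using y by (simp add: field_simps)
          hence "(1 / norm y)\<^sup>2 \<le> (real (Suc n))\<^sup>2" by (rule power_mono) simp
          hence "(1 / norm y)\<^sup>2 * ((norm (\<psi> y))\<^sup>2 / (norm y)\<^sup>2) \<le> (real (Suc n))\<^sup>2 * ((norm (\<psi> y))\<^sup>2 / (norm y)\<^sup>2)" by (rule mult_right_mono) simp
          moreover have "(norm (f y))\<^sup>2 = (1 / norm y)\<^sup>2 * ((norm (\<psi> y))\<^sup>2 / (norm y)\<^sup>2)"
            unfolding nf using True by (simp add: power_divide power2_eq_square)
          ultimately show ?thesis by simp
        next
          case False thus ?thesis by (simp add: nf)
        qed
        thus "norm ((norm (f y))\<^sup>2) \<le> norm ((real (Suc n))\<^sup>2 * ((norm (\<psi> y))\<^sup>2 / (norm y)\<^sup>2))" by simp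
      qed
    qed measurable
    have f0: "f y = 0" if "norm y > real (Suc n)" for y using that by (simp add: f_def S_def)
    obtain \<eta> C where \<eta>: "\<And>j. \<eta> j \<in> test_functions" "C \<ge> 0"
      "\<And>j. norm ((\<integral>y. \<psi> y * \<eta> j y \<partial>lborel) - (\<integral>y. \<psi> y * f y \<partial>lborel)) \<le> C * (1 / real (Suc j))"
      "\<And>j. (\<integral>\<^sup>+y. ennreal (norm (\<eta> j y)) \<partial>lborel) \<le> (\<integral>\<^sup>+y. ennreal (norm (f y)) \<partial>lborel) + ennreal (C * (1 / real (Suc j)))"
      "\<And>j. (\<integral>\<^sup>+y. ennreal ((norm (\<eta> j y))\<^sup>2 * (norm y)\<^sup>2) \<partial>lborel) \<le>
        ennreal (1 + 1 / real (Suc j)) * (\<integral>\<^sup>+y. ennreal ((norm (f y))\<^sup>2 * (norm y)\<^sup>2) \<partial>lborel) + ennreal (C * (1 / real (Suc j)))"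
      by (rule approximating_test_functions[where R = "real (Suc n)", OF fm _ f2 \<psi>m \<psi>2]) (erule f0, rule that)
    have ann: "(\<integral>\<^sup>+y. ennreal ((norm (f y))\<^sup>2 * (norm y)\<^sup>2) \<partial>lborel) = ennreal (a n)"
      unfolding nf2 a_def by (rule nn_integral_eq_integral[OF ai]) auto
    have pI: "(\<integral>y. \<psi> y * f y \<partial>lborel) = of_real (a n)" unfolding pf a_def by (rule integral_complex_of_real)
    have bnd: "(norm k)\<^sup>2 * (a n - C * (1 / real (Suc j))) \<le> 2 * N * (X + ((1 + 1 / real (Suc j)) * a n + C * (1 / real (Suc j))))" for j
    proof -
      let ?t = "1 / real (Suc j)"
      have t0: "C * ?t \<ge> 0" "(1 + ?t) * a n \<ge> 0" using \<eta>(2) a0[of n] by auto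
      have "ennreal ((norm k)\<^sup>2 * norm (\<integral>x. \<psi> x * \<eta> j x \<partial>lborel)) \<le>
        ennreal (2 * N) * (ennreal X + (\<integral>\<^sup>+x. ennreal ((norm (\<eta> j x))\<^sup>2 * (norm x)\<^sup>2) \<partial>lborel))"
        unfolding X_def
        by (rule resolvent_pairing_bound[OF \<psi>m \<psi>2 Vm N A _ k(2,3) \<eta>(1)]) (simp only: k(1) eqn)
      also have "\<dots> \<le> ennreal (2 * N) * (ennreal X + (ennreal (1 + ?t) * ennreal (a n) + ennreal (C * ?t)))"
        using \<eta>(5)[of j] unfolding ann by (intro mult_left_mono add_left_mono) auto
      also have "ennreal (1 + ?t) * ennreal (a n) = ennreal ((1 + ?t) * a n)" using a0[of n] by (intro ennreal_mult[symmetric]) auto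
      also have "ennreal ((1 + ?t) * a n) + ennreal (C * ?t) = ennreal ((1 + ?t) * a n + C * ?t)" by (rule ennreal_plus[symmetric]) (rule t0)+
      also have "ennreal X + ennreal ((1 + ?t) * a n + C * ?t) = ennreal (X + ((1 + ?t) * a n + C * ?t))"
        using t0 X0 by (intro ennreal_plus[symmetric]) auto
      also have "ennreal (2 * N) * ennreal (X + ((1 + ?t) * a n + C * ?t)) = ennreal (2 * N * (X + ((1 + ?t) * a n + C * ?t)))"
        using N(1) t0 X0 by (intro ennreal_mult[symmetric]) auto
      finally have 1: "(norm k)\<^sup>2 * norm (\<integral>x. \<psi> x * \<eta> j x \<partial>lborel) \<le> 2 * N * (X + ((1 + ?t) * a n + C * ?t))"
      proof (subst (asm) ennreal_le_iff)
        have "0 \<le> X + ((1 + ?t) * a n + C * ?t)" using t0 X0 by linarith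
        thus "0 \<le> 2 * N * (X + ((1 + ?t) * a n + C * ?t))" using N(1) by (intro mult_nonneg_nonneg[of "2 * N"]) auto
      qed
      have "norm (of_real (a n) :: complex) \<le> norm (\<integral>y. \<psi> y * \<eta> j y \<partial>lborel) + C * ?t"
        using \<eta>(3)[of j] norm_triangle_ineq2[of "of_real (a n) :: complex" "\<integral>y. \<psi> y * \<eta> j y \<partial>lborel"] unfolding pI
        by (simp add: norm_minus_commute)
      hence "a n - C * ?t \<le> norm (\<integral>y. \<psi> y * \<eta> j y \<partial>lborel)" using a0[of n] by simp
      hence "(norm k)\<^sup>2 * (a n - C * ?t) \<le> (norm k)\<^sup>2 * norm (\<integral>y. \<psi> y * \<eta> j y \<partial>lborel)" by (rule mult_left_mono) simp
      thus ?thesis using 1 by linarith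
    qed
    have t: "(\<lambda>j. 1 / real (Suc j)) \<longlonglongrightarrow> 0" using LIMSEQ_inverse_real_of_nat by (simp add: inverse_eq_divide)
    have "(norm k)\<^sup>2 * (a n - C * 0) \<le> 2 * N * (X + ((1 + 0) * a n + C * 0))"
    proof (rule LIMSEQ_le)
      show "(\<lambda>j. (norm k)\<^sup>2 * (a n - C * (1 / real (Suc j)))) \<longlonglongrightarrow> (norm k)\<^sup>2 * (a n - C * 0)" by (intro tendsto_intros t)
      show "(\<lambda>j. 2 * N * (X + ((1 + 1 / real (Suc j)) * a n + C * (1 / real (Suc j))))) \<longlonglongrightarrow> 2 * N * (X + ((1 + 0) * a n + C * 0))"
        by (intro tendsto_intros t)
      show "\<exists>n0. \<forall>j\<ge>n0. (norm k)\<^sup>2 * (a n - C * (1 / real (Suc j))) \<le> 2 * N * (X + ((1 + 1 / real (Suc j)) * a n + C * (1 / real (Suc j))))"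
        using bnd by blast
    qed
    thus ?thesis by simp
  qed
  have "a \<longlonglongrightarrow> X"
    unfolding a_def X_def
  proof (rule integral_dominated_convergence[OF _ _ A])
    show "AE y in lborel. (\<lambda>n. indicator (S n) y * ((norm (\<psi> y))\<^sup>2 / (norm y)\<^sup>2)) \<longlonglongrightarrow> (norm (\<psi> y))\<^sup>2 / (norm y)\<^sup>2"
      using AE_lborel_singleton[of "0::real^3"]
    proof eventually_elim
      fix y :: "real^3" assume y: "y \<noteq> 0"
      obtain m where m: "norm y \<le> real m" using real_arch_simple by blast
      obtain l where l: "inverse (real (Suc l)) < norm y" using reals_Archimedean[of "norm y"] y by auto
      have "\<forall>\<^sub>F n in sequentially. indicator (S n) y * ((norm (\<psi> y))\<^sup>2 / (norm y)\<^sup>2) = (norm (\<psi> y))\<^sup>2 / (norm y)\<^sup>2"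
        using eventually_ge_at_top[of "max m l"]
      proof eventually_elim
        case (elim n)
        have "1 / real (Suc n) \<le> inverse (real (Suc l))" using elim by (simp add: inverse_eq_divide divide_simps)
        hence "y \<in> S n" using elim m l by (simp add: S_def)
        thus ?case by simp
      qed
      thus "(\<lambda>n. indicator (S n) y * ((norm (\<psi> y))\<^sup>2 / (norm y)\<^sup>2)) \<longlonglongrightarrow> (norm (\<psi> y))\<^sup>2 / (norm y)\<^sup>2"
        by (rule tendsto_eventually)
    qed
    show "AE y in lborel. norm (indicator (S n) y * ((norm (\<psi> y))\<^sup>2 / (norm y)\<^sup>2)) \<le> (norm (\<psi> y))\<^sup>2 / (norm y)\<^sup>2" for n
      by (rule AE_I2) (simp add: indicator_def)
  qed measurable
  have "(norm k)\<^sup>2 * X \<le> 2 * N * (X + X)"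
  proof (rule LIMSEQ_le)
    show "(\<lambda>n. (norm k)\<^sup>2 * a n) \<longlonglongrightarrow> (norm k)\<^sup>2 * X" by (intro tendsto_intros \<open>a \<longlonglongrightarrow> X\<close>)
    show "(\<lambda>n. 2 * N * (X + a n)) \<longlonglongrightarrow> 2 * N * (X + X)" by (intro tendsto_intros \<open>a \<longlonglongrightarrow> X\<close>)
    show "\<exists>n0. \<forall>n\<ge>n0. (norm k)\<^sup>2 * a n \<le> 2 * N * (X + a n)" using step by blast
  qed
  hence "(norm k)\<^sup>2 * X \<le> (4 * N) * X" by simp
  hence "(norm k)\<^sup>2 \<le> 4 * N" using Xpos by (rule mult_right_le_imp_le)
  hence "((norm k)\<^sup>2)\<^sup>2 \<le> (4 * N)\<^sup>2" by (rule power_mono) simp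
  moreover have "norm z = ((norm k)\<^sup>2)\<^sup>2" unfolding k(1)[symmetric] by (simp add: norm_power)
  ultimately show ?thesis by (simp add: power_mult_distrib)
qed

section \<open>Weak derivatives and the operator\<close>

text \<open>
  Tonelli's theorem on the product space needs Borel measurable functions, whereas the
  function spaces consist of Lebesgue measurable ones.
\<close>

lemma borel_representative:
  fixes f :: "real^'n \<Rightarrow> complex"
  assumes f: "f \<in> borel_measurable lebesgue"
  obtains f' where "f' \<in> borel_measurable borel" "AE x in lborel. f x = f' x"
proof -
  from completion_ex_borel_measurable_real[OF measurable_compose[OF f borel_measurable_Re]]
  obtain g where g: "g \<in> borel_measurable lborel" "AE x in lborel. Re (f x) = g x" by blast
  from completion_ex_borel_measurable_real[OF measurable_compose[OF f borel_measurable_Im]]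
  obtain h where h: "h \<in> borel_measurable lborel" "AE x in lborel. Im (f x) = h x" by blast
  have [measurable]: "g \<in> borel_measurable borel" "h \<in> borel_measurable borel" using g h by auto
  show ?thesis
  proof (rule that[of "\<lambda>x. Complex (g x) (h x)"])
    show "(\<lambda>x. Complex (g x) (h x)) \<in> borel_measurable borel" unfolding Complex_eq by measurable
    show "AE x in lborel. f x = Complex (g x) (h x)" using g(2) h(2) by eventually_elim (simp add: complex_eq_iff)
  qed
qed

lemma AE_lebesgue: "(AE x in lborel. P x) \<Longrightarrow> AE x in lebesgue. P x"
  by (rule AE_completion)

lemma borel_lebesgue: "f \<in> borel_measurable borel \<Longrightarrow> f \<in> borel_measurable lebesgue"
  by (simp add: measurable_completion)

lemma lebesgue_integral_representative:
  fixes f :: "real^'n \<Rightarrow> 'b::{banach, second_countable_topology}"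
  assumes f: "f \<in> borel_measurable lebesgue" and f': "f' \<in> borel_measurable borel" and eq: "AE x in lborel. f x = f' x"
  shows "(LINT x|lebesgue. f x) = (\<integral>x. f' x \<partial>lborel)" "integrable lebesgue f \<longleftrightarrow> integrable lborel f'"
proof -
  have f'm: "f' \<in> borel_measurable lborel" using f' by simp
  have "(LINT x|lebesgue. f x) = (LINT x|lebesgue. f' x)"
    by (rule integral_cong_AE[OF f borel_lebesgue[OF f'] AE_lebesgue[OF eq]])
  thus "(LINT x|lebesgue. f x) = (\<integral>x. f' x \<partial>lborel)" by (simp only: integral_completion[OF f'm])
  have "integrable lebesgue f \<longleftrightarrow> integrable lebesgue f'"
    by (rule integrable_cong_AE[OF f borel_lebesgue[OF f'] AE_lebesgue[OF eq]])
  thus "integrable lebesgue f \<longleftrightarrow> integrable lborel f'" by (simp only: integrable_completion[OF f'm])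
qed

lemma L1_loc_measurable:
  fixes f :: "real^'n \<Rightarrow> complex"
  assumes "f \<in> L1_loc" shows "f \<in> borel_measurable lebesgue"
proof (rule borel_measurable_LIMSEQ_metric)
  have "set_integrable lebesgue (cball 0 (real n)) f" for n using assms unfolding L1_loc_def by auto
  thus "(\<lambda>x. indicator (cball 0 (real n)) x *\<^sub>R f x) \<in> borel_measurable lebesgue" for n
    unfolding set_integrable_def by (rule borel_measurable_integrable)
  fix x :: "real^'n"
  obtain m where m: "norm x \<le> real m" using real_arch_simple by blast
  have "\<forall>\<^sub>F n in sequentially. indicator (cball 0 (real n)) x *\<^sub>R f x = f x"
    using eventually_ge_at_top[of m] by eventually_elim (use m in auto)
  thus "(\<lambda>n. indicator (cball 0 (real n)) x *\<^sub>R f x) \<longlonglongrightarrow> f x" by (rule tendsto_eventually)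
qed

lemma L1_loc_representative:
  fixes f :: "real^'n \<Rightarrow> complex"
  assumes f: "f \<in> L1_loc"
  obtains f' where "f' \<in> borel_measurable borel" "AE x in lborel. f x = f' x" "\<And>R. integrable lborel (\<lambda>y. indicator (cball 0 R) y *\<^sub>R f' y)"
proof -
  note fm = L1_loc_measurable[OF f]
  obtain f' where f' [measurable]: "f' \<in> borel_measurable borel" and eq: "AE x in lborel. f x = f' x" by (rule borel_representative[OF fm])
  have "integrable lborel (\<lambda>y. indicator (cball 0 R) y *\<^sub>R f' y)" for R
  proof -
    have i: "integrable lebesgue (\<lambda>y. indicator (cball 0 R) y *\<^sub>R f y)"
      using f unfolding L1_loc_def set_integrable_def by auto
    have m: "(\<lambda>y. indicator (cball 0 R) y *\<^sub>R f' y) \<in> borel_measurable borel"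
      by (intro borel_measurable_scaleR borel_measurable_indicator f') simp
    have "AE y in lborel. indicator (cball 0 R) y *\<^sub>R f y = indicator (cball 0 R) y *\<^sub>R f' y" using eq by eventually_elim simp
    from lebesgue_integral_representative(2)[OF borel_measurable_integrable[OF i] m this] i show ?thesis by blast
  qed
  with that f' eq show ?thesis by blast
qed

lemma pairing_representative:
  fixes f :: "real^'n \<Rightarrow> complex"
  assumes f: "f \<in> borel_measurable lebesgue" and f': "f' \<in> borel_measurable borel" "AE x in lborel. f x = f' x" and \<eta>: "\<eta> \<in> borel_measurable borel"
  shows "(LINT x|lebesgue. f x * \<eta> x) = (\<integral>x. f' x * \<eta> x \<partial>lborel)"
proof (rule lebesgue_integral_representative(1))
  show "(\<lambda>x. f x * \<eta> x) \<in> borel_measurable lebesgue" using f borel_lebesgue[OF \<eta>] by (rule borel_measurable_times)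
  show "(\<lambda>x. f' x * \<eta> x) \<in> borel_measurable borel" using f'(1) \<eta> by (rule borel_measurable_times)
  show "AE x in lborel. f x * \<eta> x = f' x * \<eta> x" using f'(2) by eventually_elim simp
qed

lemma has_weak_deriv_unique:
  fixes f :: "real^'n \<Rightarrow> complex"
  assumes "has_weak_deriv f is g" "has_weak_deriv f is h"
  shows "AE x in lborel. g x = h x"
proof -
  have gh: "g \<in> L1_loc" "h \<in> L1_loc" using assms by (auto simp: has_weak_deriv_def)
  obtain g' where g': "g' \<in> borel_measurable borel" "AE x in lborel. g x = g' x" "\<And>R. integrable lborel (\<lambda>y. indicator (cball 0 R) y *\<^sub>R g' y)"
    by (rule L1_loc_representative[OF gh(1)]) blast
  obtain h' where h': "h' \<in> borel_measurable borel" "AE x in lborel. h x = h' x" "\<And>R. integrable lborel (\<lambda>y. indicator (cball 0 R) y *\<^sub>R h' y)"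
    by (rule L1_loc_representative[OF gh(2)]) blast
  have "AE x in lborel. g' x - h' x = 0"
  proof (rule du_Bois_Reymond)
    show "(\<lambda>x. g' x - h' x) \<in> borel_measurable borel" using g'(1) h'(1) by (rule borel_measurable_diff)
    show "integrable lborel (\<lambda>y. indicator (cball 0 R) y *\<^sub>R (g' y - h' y))" for R
      unfolding scaleR_diff_right by (rule Bochner_Integration.integrable_diff[OF g'(3) h'(3)])
    fix \<eta> :: "real^'n \<Rightarrow> complex" assume \<eta>: "\<eta> \<in> test_functions"
    have "(LINT x|lebesgue. f x * partials is \<eta> x) = (-1) ^ length is * (LINT x|lebesgue. g x * \<eta> x)"
      "(LINT x|lebesgue. f x * partials is \<eta> x) = (-1) ^ length is * (LINT x|lebesgue. h x * \<eta> x)"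
      using assms \<eta> by (simp_all add: has_weak_deriv_def)
    hence "(-1) ^ length is * (LINT x|lebesgue. g x * \<eta> x) = (-1) ^ length is * (LINT x|lebesgue. h x * \<eta> x)" by (rule subst)
    hence "(LINT x|lebesgue. g x * \<eta> x) = (LINT x|lebesgue. h x * \<eta> x)" by simp
    hence e: "(\<integral>x. g' x * \<eta> x \<partial>lborel) = (\<integral>x. h' x * \<eta> x \<partial>lborel)"
      using pairing_representative[OF L1_loc_measurable[OF gh(1)] g'(1,2) test_measurable[OF \<eta>]]
        pairing_representative[OF L1_loc_measurable[OF gh(2)] h'(1,2) test_measurable[OF \<eta>]] by simp
    have "(\<integral>x. (g' x - h' x) * \<eta> x \<partial>lborel) = (\<integral>x. g' x * \<eta> x - h' x * \<eta> x \<partial>lborel)" by (simp add: left_diff_distrib)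
    also have "\<dots> = (\<integral>x. g' x * \<eta> x \<partial>lborel) - (\<integral>x. h' x * \<eta> x \<partial>lborel)"
      by (rule Bochner_Integration.integral_diff[OF locally_integrable_mult_test[OF g'(3) \<eta>] locally_integrable_mult_test[OF h'(3) \<eta>]])
    finally show "(\<integral>x. (g' x - h' x) * \<eta> x \<partial>lborel) = 0" using e by simp
  qed
  with g'(2) h'(2) show ?thesis by eventually_elim simp
qed

lemma test_L1_loc: "\<phi> \<in> test_functions \<Longrightarrow> \<phi> \<in> L1_loc"
  unfolding L1_loc_def set_integrable_def
proof (safe)
  fix K :: "(real^'a) set" assume \<phi>: "\<phi> \<in> test_functions" and K: "compact K"
  have "integrable lborel (\<lambda>x. indicator K x *\<^sub>R \<phi> x)"
    by (rule borel_integrable_compact[OF K smooth_continuous[OF test_smooth[OF \<phi>]]])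
  thus "integrable lebesgue (\<lambda>x. indicator K x *\<^sub>R \<phi> x)"
    using integrable_completion[OF borel_measurable_integrable] by blast
qed

lemma test_L2: "\<phi> \<in> test_functions \<Longrightarrow> \<phi> \<in> L2"
proof -
  assume \<phi>: "\<phi> \<in> test_functions"
  have "integrable lebesgue (\<lambda>x. (norm (\<phi> x))\<^sup>2)"
    using test_square_integrable[OF \<phi>] integrable_completion[OF borel_measurable_integrable[OF test_square_integrable[OF \<phi>]]] by blast
  thus ?thesis unfolding L2_def using borel_lebesgue[OF test_measurable[OF \<phi>]] by simp
qed

text \<open>The derivatives are peeled off from the outside, which reverses the multi-index.\<close>

lemma integral_partials_by_parts:
  assumes "smooth f" "g \<in> test_functions"
  shows "(\<integral>x. f x * partials is g x \<partial>lborel) = (-1) ^ length is * (\<integral>x. partials (rev is) f x * g x \<partial>lborel)"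
  using assms(1)
proof (induction "is" arbitrary: f)
  case (Cons i "is")
  have "(\<integral>x. f x * partials (i # is) g x \<partial>lborel) = - (\<integral>x. pdir i f x * partials is g x \<partial>lborel)"
    unfolding partials_Cons by (rule integral_by_parts[OF Cons.prems test_partials[OF assms(2)]])
  also have "\<dots> = - ((-1) ^ length is * (\<integral>x. partials (rev is) (pdir i f) x * g x \<partial>lborel))"
    by (simp only: Cons.IH[OF smooth_pdir[OF Cons.prems]])
  finally show ?case by (simp add: partials_append partials_Cons)
qed simp

lemma test_has_weak_deriv:
  assumes \<phi>: "\<phi> \<in> test_functions"
  shows "has_weak_deriv \<phi> is (partials (rev is) \<phi>)"
  unfolding has_weak_deriv_def
proof (intro conjI ballI)
  show "\<phi> \<in> L1_loc" "partials (rev is) \<phi> \<in> L1_loc" by (intro test_L1_loc test_partials \<phi>)+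
  fix \<eta> :: "real^'a \<Rightarrow> complex" assume \<eta>: "\<eta> \<in> test_functions"
  have m: "f \<in> borel_measurable lborel" if "f \<in> test_functions" for f :: "real^'a \<Rightarrow> complex" using test_measurable[OF that] by simp
  have "(LINT x|lebesgue. \<phi> x * partials is \<eta> x) = (\<integral>x. \<phi> x * partials is \<eta> x \<partial>lborel)"
    by (intro integral_completion borel_measurable_times m \<phi> test_partials \<eta>)
  moreover have "(LINT x|lebesgue. partials (rev is) \<phi> x * \<eta> x) = (\<integral>x. partials (rev is) \<phi> x * \<eta> x \<partial>lborel)"
    by (intro integral_completion borel_measurable_times m test_partials \<phi> \<eta>)
  ultimately show "(LINT x|lebesgue. \<phi> x * partials is \<eta> x) = (- 1) ^ length is * (LINT x|lebesgue. partials (rev is) \<phi> x * \<eta> x)"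
    using integral_partials_by_parts[OF test_smooth[OF \<phi>] \<eta>] by simp
qed

lemma test_sobolev: "\<phi> \<in> test_functions \<Longrightarrow> \<phi> \<in> sobolev k"
  unfolding sobolev_def using test_L2 test_has_weak_deriv test_partials by blast

lemma has_weak_deriv_weak_deriv: "has_weak_deriv f is g \<Longrightarrow> has_weak_deriv f is (weak_deriv is f)"
  unfolding weak_deriv_def by (rule someI[where P = "has_weak_deriv f is"])

text \<open>
  The weak derivative is a choice; uniqueness almost everywhere identifies it with the
  classical one.
\<close>

lemma laplacian_test:
  assumes \<phi>: "\<phi> \<in> test_functions"
  shows "AE x in lborel. laplacian \<phi> x = lap \<phi> x"
proof -
  have "AE x in lborel. weak_deriv [i,i] \<phi> x = partials [i,i] \<phi> x" for i
    using has_weak_deriv_unique[OF has_weak_deriv_weak_deriv[OF test_has_weak_deriv[OF \<phi>, of "[i,i]"]] test_has_weak_deriv[OF \<phi>, of "[i,i]"]] by simp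
  hence "AE x in lborel. \<forall>i\<in>UNIV. weak_deriv [i,i] \<phi> x = partials [i,i] \<phi> x" by (intro AE_finite_allI) auto
  thus ?thesis by eventually_elim (simp add: laplacian_def lap_def)
qed

lemma laplacian_measurable_test:
  assumes \<phi>: "\<phi> \<in> test_functions"
  shows "laplacian \<phi> \<in> borel_measurable lebesgue"
proof -
  have "weak_deriv [i,i] \<phi> \<in> borel_measurable lebesgue" for i
    using has_weak_deriv_weak_deriv[OF test_has_weak_deriv[OF \<phi>, of "[i,i]"]] L1_loc_measurable by (auto simp: has_weak_deriv_def)
  thus ?thesis unfolding laplacian_def[abs_def] by (intro borel_measurable_sum)
qed

lemma L2_representative:
  fixes f :: "real^'n \<Rightarrow> complex"
  assumes f: "f \<in> L2"
  obtains f' where "f' \<in> borel_measurable borel" "AE x in lborel. f x = f' x" "integrable lborel (\<lambda>x. (norm (f' x))\<^sup>2)"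
proof -
  have fm: "f \<in> borel_measurable lebesgue" and fi: "integrable lebesgue (\<lambda>x. (norm (f x))\<^sup>2)" using f by (auto simp: L2_def)
  obtain f' where f' [measurable]: "f' \<in> borel_measurable borel" and eq: "AE x in lborel. f x = f' x" by (rule borel_representative[OF fm])
  have e: "AE x in lborel. (norm (f x))\<^sup>2 = (norm (f' x))\<^sup>2" using eq by eventually_elim simp
  have "(\<lambda>x. (norm (f' x))\<^sup>2) \<in> borel_measurable borel" by measurable
  from lebesgue_integral_representative(2)[OF borel_measurable_integrable[OF fi] this e] fi
  have "integrable lborel (\<lambda>x. (norm (f' x))\<^sup>2)" by blast
  with that f' eq show ?thesis by blast
qed

text \<open>
  Borel representatives of \<open>\<psi>\<close> and of its weak Laplacian, for which the defining identity
  reads as an integral with respect to \<^term>\<open>lborel\<close>.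
\<close>

lemma sobolev_laplacian:
  fixes \<psi> :: "real^'n \<Rightarrow> complex"
  assumes \<psi>: "\<psi> \<in> sobolev 2"
  obtains \<psi>' L where "\<psi>' \<in> borel_measurable borel" "AE x in lborel. \<psi> x = \<psi>' x" "integrable lborel (\<lambda>x. (norm (\<psi>' x))\<^sup>2)"
    "laplacian \<psi> \<in> borel_measurable lebesgue"
    "L \<in> borel_measurable borel" "AE x in lborel. laplacian \<psi> x = L x" "integrable lborel (\<lambda>x. (norm (L x))\<^sup>2)"
    "\<And>\<eta>. \<eta> \<in> test_functions \<Longrightarrow> (\<integral>x. \<psi>' x * lap \<eta> x \<partial>lborel) = (\<integral>x. L x * \<eta> x \<partial>lborel)"
proof -
  have \<psi>L2: "\<psi> \<in> L2" using \<psi> by (simp add: sobolev_def)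
  hence \<psi>m: "\<psi> \<in> borel_measurable lebesgue" by (simp add: L2_def)
  obtain \<psi>' where p: "\<psi>' \<in> borel_measurable borel" "AE x in lborel. \<psi> x = \<psi>' x" "integrable lborel (\<lambda>x. (norm (\<psi>' x))\<^sup>2)"
    by (rule L2_representative[OF \<psi>L2])
  have "\<forall>i. \<exists>g. g \<in> borel_measurable borel \<and> (AE x in lborel. weak_deriv [i,i] \<psi> x = g x) \<and> integrable lborel (\<lambda>x. (norm (g x))\<^sup>2)"
  proof
    fix i
    obtain g where g: "g \<in> L2" "has_weak_deriv \<psi> [i,i] g"
      using \<psi> unfolding sobolev_def by (auto dest!: spec[of _ "[i,i]"])
    obtain g' where g': "g' \<in> borel_measurable borel" "AE x in lborel. g x = g' x" "integrable lborel (\<lambda>x. (norm (g' x))\<^sup>2)"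
      by (rule L2_representative[OF g(1)])
    have "AE x in lborel. weak_deriv [i,i] \<psi> x = g' x"
      using has_weak_deriv_unique[OF has_weak_deriv_weak_deriv[OF g(2)] g(2)] g'(2) by eventually_elim simp
    thus "\<exists>g. g \<in> borel_measurable borel \<and> (AE x in lborel. weak_deriv [i,i] \<psi> x = g x) \<and> integrable lborel (\<lambda>x. (norm (g x))\<^sup>2)"
      using g' by blast
  qed
  from choice[OF this] obtain g where g: "\<And>i. g i \<in> borel_measurable borel" "\<And>i. AE x in lborel. weak_deriv [i,i] \<psi> x = g i x" "\<And>i. integrable lborel (\<lambda>x. (norm (g i x))\<^sup>2)" by blast
  have wd: "has_weak_deriv \<psi> [i,i] (weak_deriv [i,i] \<psi>)" for i
  proof -
    obtain h where "has_weak_deriv \<psi> [i,i] h"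
      using \<psi> unfolding sobolev_def by (auto dest!: spec[of _ "[i,i]"])
    thus ?thesis by (rule has_weak_deriv_weak_deriv)
  qed
  have wm: "weak_deriv [i,i] \<psi> \<in> borel_measurable lebesgue" for i
    using wd[of i] by (intro L1_loc_measurable) (simp add: has_weak_deriv_def)
  define L where "L x = (\<Sum>i\<in>UNIV. g i x)" for x
  have Lm: "L \<in> borel_measurable borel" unfolding L_def[abs_def] by (intro borel_measurable_sum g)
  show ?thesis
  proof (rule that[OF p _ Lm])
    show "laplacian \<psi> \<in> borel_measurable lebesgue" unfolding laplacian_def[abs_def] by (intro borel_measurable_sum wm)
    have "AE x in lborel. \<forall>i\<in>UNIV. weak_deriv [i,i] \<psi> x = g i x" by (intro AE_finite_allI g(2)) simp
    thus "AE x in lborel. laplacian \<psi> x = L x" by eventually_elim (simp add: laplacian_def L_def)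
    show "integrable lborel (\<lambda>x. (norm (L x))\<^sup>2)"
    proof (rule Bochner_Integration.integrable_bound)
      show "integrable lborel (\<lambda>x. real CARD('n) * (\<Sum>i\<in>UNIV. (norm (g i x))\<^sup>2))"
        by (intro integrable_mult_right Bochner_Integration.integrable_sum g(3))
      show "(\<lambda>x. (norm (L x))\<^sup>2) \<in> borel_measurable lborel" using Lm by measurable
      show "AE x in lborel. norm ((norm (L x))\<^sup>2) \<le> norm (real CARD('n) * (\<Sum>i\<in>UNIV. (norm (g i x))\<^sup>2))"
      proof (rule AE_I2)
        fix x
        have "norm (L x) \<le> (\<Sum>i\<in>UNIV. norm (g i x))" unfolding L_def by (rule norm_sum)
        hence "(norm (L x))\<^sup>2 \<le> (\<Sum>i\<in>UNIV. norm (g i x))\<^sup>2" by (rule power_mono) simp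
        also have "\<dots> \<le> real CARD('n) * (\<Sum>i\<in>UNIV. (norm (g i x))\<^sup>2)"
          using sum_squared_le_sum_of_squares[of "\<lambda>i. norm (g i x)" UNIV] by (simp add: mult.commute)
        finally show "norm ((norm (L x))\<^sup>2) \<le> norm (real CARD('n) * (\<Sum>i\<in>UNIV. (norm (g i x))\<^sup>2))" by (simp add: sum_nonneg)
      qed
    qed
    fix \<eta> :: "real^'n \<Rightarrow> complex" assume \<eta>: "\<eta> \<in> test_functions"
    have i: "(\<integral>x. \<psi>' x * partials [i,i] \<eta> x \<partial>lborel) = (\<integral>x. g i x * \<eta> x \<partial>lborel)" for i
    proof -
      have "(LINT x|lebesgue. \<psi> x * partials [i,i] \<eta> x) = (LINT x|lebesgue. weak_deriv [i,i] \<psi> x * \<eta> x)"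
        using wd[of i] \<eta> by (simp add: has_weak_deriv_def)
      thus ?thesis
        using pairing_representative[OF \<psi>m p(1,2) test_measurable[OF test_partials[OF \<eta>, of "[i,i]"]]]
          pairing_representative[OF wm g(1,2) test_measurable[OF \<eta>], of i] by simp
    qed
    have "(\<integral>x. \<psi>' x * lap \<eta> x \<partial>lborel) = (\<integral>x. (\<Sum>i\<in>UNIV. \<psi>' x * partials [i,i] \<eta> x) \<partial>lborel)"
      by (simp add: lap_def sum_distrib_left)
    also have "\<dots> = (\<Sum>i\<in>UNIV. \<integral>x. \<psi>' x * partials [i,i] \<eta> x \<partial>lborel)"
    proof (rule Bochner_Integration.integral_sum)
      show "integrable lborel (\<lambda>x. \<psi>' x * partials [i,i] \<eta> x)" for i
      proof (rule square_integrable_mult)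
        show "\<psi>' \<in> borel_measurable lborel" "partials [i,i] \<eta> \<in> borel_measurable lborel"
          using p(1) test_measurable[OF test_partials[OF \<eta>, of "[i,i]"]] by auto
      qed (rule p(3), rule test_square_integrable[OF test_partials[OF \<eta>]])
    qed
    also have "\<dots> = (\<Sum>i\<in>UNIV. \<integral>x. g i x * \<eta> x \<partial>lborel)" by (simp only: i)
    also have "\<dots> = (\<integral>x. (\<Sum>i\<in>UNIV. g i x * \<eta> x) \<partial>lborel)"
    proof (rule Bochner_Integration.integral_sum[symmetric])
      show "integrable lborel (\<lambda>x. g i x * \<eta> x)" for i
      proof (rule square_integrable_mult)
        show "g i \<in> borel_measurable lborel" "\<eta> \<in> borel_measurable lborel"
          using g(1)[of i] test_measurable[OF \<eta>] by auto
      qed (rule g(3), rule test_square_integrable[OF \<eta>])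
    qed
    finally show "(\<integral>x. \<psi>' x * lap \<eta> x \<partial>lborel) = (\<integral>x. L x * \<eta> x \<partial>lborel)" by (simp add: L_def sum_distrib_right)
  qed
qed

theorem corollary2:
  fixes V :: "real^3 \<Rightarrow> complex"
  assumes "V \<in> hardy_class"
  shows "point_spectrum (op_HV V) \<subseteq> {z. ereal (cmod z) \<le> 16 * (hardy_norm V)\<^sup>2}"
proof
  fix z assume "z \<in> point_spectrum (op_HV V)"
  then obtain \<psi> where op: "(\<psi>, \<lambda>x. z * \<psi> x) \<in> op_HV V" and nz: "\<not> (AE x in lebesgue. \<psi> x = 0)"
    by (auto simp: point_spectrum_def)
  have \<psi>: "\<psi> \<in> sobolev 2"
    and form: "\<And>\<phi>. \<phi> \<in> sobolev 2 \<Longrightarrow> form_hV V \<phi> \<psi> = (LINT x|lebesgue. cnj (\<phi> x) * (z * \<psi> x))"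
    using op by (auto simp: op_HV_def)
  have V: "V \<in> L1_loc" "hardy_norm V < \<infinity>" using assms by (auto simp: hardy_class_def)
  note Vl = L1_loc_measurable[OF V(1)]
  obtain V' where V': "V' \<in> borel_measurable borel" "AE x in lborel. V x = V' x" by (rule borel_representative[OF Vl])
  have null: "\<not> (AE x in (lebesgue::(real^3) measure). False)"
  proof
    assume "AE x in (lebesgue::(real^3) measure). False"
    thus False using AE_iff_measurable[of UNIV "lebesgue::(real^3) measure" "\<lambda>_. False"] by simp
  qed
  have le: "AE x in lebesgue. ereal ((norm x)\<^sup>2 * norm (V x)) \<le> hardy_norm V"
    unfolding hardy_norm_def by (rule esssup_AE)
  \<comment> \<open>A negative essential supremum of a nonnegative function would make the whole space a null
    set.\<close>
  have nonneg: "hardy_norm V \<ge> 0"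
  proof (rule ccontr)
    assume "\<not> hardy_norm V \<ge> 0"
    from le have "AE x in (lebesgue::(real^3) measure). False"
    proof eventually_elim
      fix x :: "real^3" assume "ereal ((norm x)\<^sup>2 * norm (V x)) \<le> hardy_norm V"
      moreover have "0 \<le> ereal ((norm x)\<^sup>2 * norm (V x))" by simp
      ultimately show False using \<open>\<not> hardy_norm V \<ge> 0\<close> order_trans by blast
    qed
    with null show False by blast
  qed
  then obtain N where N: "hardy_norm V = ereal N" "N \<ge> 0" using V(2) by (cases "hardy_norm V") auto
  have N': "AE x in lborel. (norm x)\<^sup>2 * norm (V' x) \<le> N"
  proof -
    have "AE x in lborel. ereal ((norm x)\<^sup>2 * norm (V x)) \<le> hardy_norm V"
      using le by (simp add: AE_completion_iff)
    with V'(2) show ?thesis by eventually_elim (simp add: N(1))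
  qed
  obtain \<psi>' L where \<psi>': "\<psi>' \<in> borel_measurable borel" "AE x in lborel. \<psi> x = \<psi>' x" "integrable lborel (\<lambda>x. (norm (\<psi>' x))\<^sup>2)"
    and lm: "laplacian \<psi> \<in> borel_measurable lebesgue"
    and L: "L \<in> borel_measurable borel" "AE x in lborel. laplacian \<psi> x = L x" "integrable lborel (\<lambda>x. (norm (L x))\<^sup>2)"
      "\<And>\<eta>. \<eta> \<in> test_functions \<Longrightarrow> (\<integral>x. \<psi>' x * lap \<eta> x \<partial>lborel) = (\<integral>x. L x * \<eta> x \<partial>lborel)"
    by (rule sobolev_laplacian[OF \<psi>]) (rule that)
  have \<psi>l: "\<psi> \<in> borel_measurable lebesgue" using \<psi> by (simp add: sobolev_def L2_def)
  have eqn: "(\<integral>x. \<psi>' x * lap (lap \<phi>) x \<partial>lborel) + (\<integral>x. V' x * \<phi> x * \<psi>' x \<partial>lborel) = z * (\<integral>x. \<psi>' x * \<phi> x \<partial>lborel)"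
    if \<phi>: "\<phi> \<in> test_functions" for \<phi>
  proof -
    \<comment> \<open>The form is antilinear in its first argument, so the complex conjugate of \<open>\<phi>\<close> is inserted
      to obtain a bilinear pairing.\<close>
    define \<theta> where "\<theta> x = cnj (\<phi> x)" for x
    have \<theta>: "\<theta> \<in> test_functions" unfolding \<theta>_def by (rule test_cnj[OF \<phi>])
    have lap\<theta>: "cnj (lap \<theta> x) = lap \<phi> x" for x
      by (simp add: lap_def \<theta>_def[abs_def] partials_cnj[OF test_smooth[OF \<phi>]])
    note \<phi>m = test_measurable[OF \<phi>]
    note lm' = test_measurable[OF test_lap[OF \<phi>]]
    have cm: "(\<lambda>x. cnj (laplacian \<theta> x)) \<in> borel_measurable lebesgue"
      by (rule measurable_compose[OF laplacian_measurable_test[OF \<theta>] borel_measurable_continuous_onI]) (intro continuous_intros)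
    have 1: "(LINT x|lebesgue. cnj (laplacian \<theta> x) * laplacian \<psi> x) = (\<integral>x. lap \<phi> x * L x \<partial>lborel)"
    proof (rule lebesgue_integral_representative(1))
      show "(\<lambda>x. cnj (laplacian \<theta> x) * laplacian \<psi> x) \<in> borel_measurable lebesgue" using cm lm by (rule borel_measurable_times)
      show "(\<lambda>x. lap \<phi> x * L x) \<in> borel_measurable borel" using lm' L(1) by (rule borel_measurable_times)
      show "AE x in lborel. cnj (laplacian \<theta> x) * laplacian \<psi> x = lap \<phi> x * L x"
        using laplacian_test[OF \<theta>] L(2) by eventually_elim (simp add: lap\<theta>)
    qed
    have 2: "(LINT x|lebesgue. V x * cnj (\<theta> x) * \<psi> x) = (\<integral>x. V' x * \<phi> x * \<psi>' x \<partial>lborel)"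
    proof (rule lebesgue_integral_representative(1))
      show "(\<lambda>x. V x * cnj (\<theta> x) * \<psi> x) \<in> borel_measurable lebesgue"
        unfolding \<theta>_def complex_cnj_cnj by (intro borel_measurable_times Vl \<psi>l borel_lebesgue[OF \<phi>m])
      show "(\<lambda>x. V' x * \<phi> x * \<psi>' x) \<in> borel_measurable borel" by (intro borel_measurable_times V'(1) \<psi>'(1) \<phi>m)
      show "AE x in lborel. V x * cnj (\<theta> x) * \<psi> x = V' x * \<phi> x * \<psi>' x"
        using V'(2) \<psi>'(2) by eventually_elim (simp add: \<theta>_def)
    qed
    have 3: "(LINT x|lebesgue. cnj (\<theta> x) * (z * \<psi> x)) = (\<integral>x. z * (\<psi>' x * \<phi> x) \<partial>lborel)"
    proof (rule lebesgue_integral_representative(1))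
      show "(\<lambda>x. cnj (\<theta> x) * (z * \<psi> x)) \<in> borel_measurable lebesgue"
        unfolding \<theta>_def complex_cnj_cnj by (intro borel_measurable_times borel_measurable_const \<psi>l borel_lebesgue[OF \<phi>m])
      show "(\<lambda>x. z * (\<psi>' x * \<phi> x)) \<in> borel_measurable borel" by (intro borel_measurable_times borel_measurable_const \<psi>'(1) \<phi>m)
      show "AE x in lborel. cnj (\<theta> x) * (z * \<psi> x) = z * (\<psi>' x * \<phi> x)"
        using \<psi>'(2) by eventually_elim (simp add: \<theta>_def)
    qed
    have "(\<integral>x. lap \<phi> x * L x \<partial>lborel) = (\<integral>x. \<psi>' x * lap (lap \<phi>) x \<partial>lborel)"
      using L(4)[OF test_lap[OF \<phi>]] by (simp add: mult.commute)
    thus ?thesis using form[OF test_sobolev[OF \<theta>]] unfolding form_hV_def 1 2 3 by simp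
  qed
  have nz': "\<not> (AE x in lborel. \<psi>' x = 0)"
  proof
    assume "AE x in lborel. \<psi>' x = 0"
    with \<psi>'(2) have "AE x in lborel. \<psi> x = 0" by eventually_elim simp
    thus False using nz AE_lebesgue by blast
  qed
  have "norm z \<le> 16 * N\<^sup>2"
    by (rule eigenvalue_bound_lborel[OF \<psi>'(1,3) L(1,3) _ V'(1) N(2) N' _ nz']) (rule L(4), assumption, rule eqn)
  hence "ereal (norm z) \<le> 16 * (hardy_norm V)\<^sup>2" unfolding N(1) by simp
  thus "z \<in> {z. ereal (norm z) \<le> 16 * (hardy_norm V)\<^sup>2}" by simp
qed

end
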